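(* There is an algorithm that solves Balanced Vertex in ${\cal O}(n\log(|S|+1))$ time on instances $(G,\pi,S)$ where $G$ is a tree with $n$ nodes.
   Context: All graphs are finite, simple, connected, with unit-length edges; $d(u,v)$ is the shortest-path distance. A proper vertex list is a list $S=(s_1,\ldots,s_p)$, $p=|S|$, of pairwise different vertices; $d(v,S)=\min_i d(v,s_i)$. The (prioritized) Voronoi diagram of $G=(V,E)$ with respect to $S$ is the partition of $V$ into territories $\mathbb{T}(s_1,S),\ldots,\mathbb{T}(s_p,S)$ where $v\in\mathbb{T}(s_i,S)$ if and only if $d(v,s_i)=d(v,S)$ and $d(v,s_j)>d(v,S)$ for every $j$ with $1\le j<i$. For a cost function $\pi:V\to\mathbb{R}_{\ge 0}$, the load of $s_i$ is $\ell_\pi(s_i,S)=\sum_{v\in\mathbb{T}(s_i,S)}\pi(v)$, and $L_\pi(S)=\max_i \ell_\pi(s_i,S)$. For $v\in V\setminus S$, $S+v=(s_1,\ldots,s_p,v)$. Balanced Vertex: given a graph $G=(V,E)$, a cost function $\pi:V\to\mathbb{R}_{\ge 0}$ and a proper vertex list $S$, output a vertex $v\in V\setminus S$ such that $L_\pi(S+v)$ is minimized. Running times are worst-case, in the usual unit-cost RAM model. *)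

theory Defs
  imports Complex_Main "Graph_Theory.Graph_Theory"
begin

section \<open>Graphs and prioritized Voronoi diagrams\<close>

text \<open>
  Finite simple undirected graphs are modelled by \<^locale>\<open>pair_graph\<close>: finite loop-free symmetric
  digraphs whose arcs are ordered pairs, every undirected edge being a pair of opposite arcs.
  In this model \<open>u, v, u\<close> counts as a \<open>cycle\<close>, so the library's \<open>forest\<close> and \<open>tree\<close> are not the
  undirected notions; a cycle of the undirected graph is a \<open>cycle\<close> with at least three arcs.
  The library's \<open>connected\<close> includes that the vertex set is nonempty.
\<close>

definition undirected_tree :: "'a pair_pre_digraph \<Rightarrow> bool" where
  "undirected_tree G \<longleftrightarrow>
     pair_graph G \<and> Digraph_Component.connected (with_proj G) \<and>
     \<not> (\<exists>p. pre_digraph.cycle (with_proj G) p \<and> length p \<ge> 3)"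

definition gdist :: "'a pair_pre_digraph \<Rightarrow> 'a \<Rightarrow> 'a \<Rightarrow> ereal" where
  "gdist G u v = wf_digraph.\<mu> (with_proj G) (\<lambda>_. 1) u v"

definition proper_vertex_list :: "'a pair_pre_digraph \<Rightarrow> 'a list \<Rightarrow> bool" where
  "proper_vertex_list G S \<longleftrightarrow> S \<noteq> [] \<and> distinct S \<and> set S \<subseteq> pverts G"

definition list_dist :: "'a pair_pre_digraph \<Rightarrow> 'a \<Rightarrow> 'a list \<Rightarrow> ereal" where
  "list_dist G v S = (MIN s\<in>set S. gdist G v s)"

text \<open>Positions in \<open>S\<close> are counted from \<open>0\<close>.\<close>

definition territory :: "'a pair_pre_digraph \<Rightarrow> 'a list \<Rightarrow> nat \<Rightarrow> 'a set" where
  "territory G S i =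
     {v \<in> pverts G. gdist G v (S ! i) = list_dist G v S \<and>
                    (\<forall>j<i. gdist G v (S ! j) > list_dist G v S)}"

definition load :: "'a pair_pre_digraph \<Rightarrow> ('a \<Rightarrow> real) \<Rightarrow> 'a list \<Rightarrow> nat \<Rightarrow> real" where
  "load G \<pi> S i = (\<Sum>v\<in>territory G S i. \<pi> v)"

definition max_load :: "'a pair_pre_digraph \<Rightarrow> ('a \<Rightarrow> real) \<Rightarrow> 'a list \<Rightarrow> real" where
  "max_load G \<pi> S = (MAX i\<in>{..<length S}. load G \<pi> S i)"

definition balanced_vertex :: "'a pair_pre_digraph \<Rightarrow> ('a \<Rightarrow> real) \<Rightarrow> 'a list \<Rightarrow> 'a \<Rightarrow> bool" where
  "balanced_vertex G \<pi> S v \<longleftrightarrow>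
     v \<in> pverts G - set S \<and>
     (\<forall>u\<in>pverts G - set S. max_load G \<pi> (S @ [v]) \<le> max_load G \<pi> (S @ [u]))"


section \<open>A unit-cost RAM with natural-number and real cells\<close>

text \<open>
  The memory has scalar registers and infinite arrays (memory banks) with computed indices, each for
  natural numbers and for reals. A program names its registers and banks by constants, so it uses
  only finitely many of them. Reals can only be moved, added, subtracted and compared, and never
  influence a natural number or an address except through the outcome of a comparison. As in the RAM of
  Cook and Reckhow, the operations on naturals are addition and (truncated) subtraction; there is no
  unit-cost multiplication, division or bit operation by which long numbers could be exploited.
\<close>

record ram_state =
  ireg :: "nat \<Rightarrow> nat"
  imem :: "nat \<Rightarrow> nat \<Rightarrow> nat"
  rreg :: "nat \<Rightarrow> real"
  rmem :: "nat \<Rightarrow> nat \<Rightarrow> real"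

datatype iexp = INum nat | IReg nat | IMem nat iexp | IAdd iexp iexp | ISub iexp iexp

datatype rexp = RNum int | RReg nat | RMem nat iexp | RAdd rexp rexp | RSub rexp rexp

datatype test = ILess iexp iexp | RLess rexp rexp | Not test | And test test

datatype com =
    Skip
  | SetIReg nat iexp
  | SetIMem nat iexp iexp
  | SetRReg nat rexp
  | SetRMem nat iexp rexp
  | Seq com com
  | If test com com
  | While test com

primrec ival :: "iexp \<Rightarrow> ram_state \<Rightarrow> nat" where
  "ival (INum k) s = k"
| "ival (IReg r) s = ireg s r"
| "ival (IMem b e) s = imem s b (ival e s)"
| "ival (IAdd e f) s = ival e s + ival f s"
| "ival (ISub e f) s = ival e s - ival f s"

primrec rval :: "rexp \<Rightarrow> ram_state \<Rightarrow> real" where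
  "rval (RNum k) s = of_int k"
| "rval (RReg r) s = rreg s r"
| "rval (RMem b e) s = rmem s b (ival e s)"
| "rval (RAdd e f) s = rval e s + rval f s"
| "rval (RSub e f) s = rval e s - rval f s"

primrec tval :: "test \<Rightarrow> ram_state \<Rightarrow> bool" where
  "tval (ILess e f) s \<longleftrightarrow> ival e s < ival f s"
| "tval (RLess e f) s \<longleftrightarrow> rval e s < rval f s"
| "tval (Not b) s \<longleftrightarrow> \<not> tval b s"
| "tval (And b c) s \<longleftrightarrow> tval b s \<and> tval c s"

text \<open>The cost of evaluating an expression is its number of operations, reads and constants.\<close>

primrec icost :: "iexp \<Rightarrow> nat" where
  "icost (INum k) = 1"
| "icost (IReg r) = 1"
| "icost (IMem b e) = 1 + icost e"
| "icost (IAdd e f) = 1 + icost e + icost f"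
| "icost (ISub e f) = 1 + icost e + icost f"

primrec rcost :: "rexp \<Rightarrow> nat" where
  "rcost (RNum k) = 1"
| "rcost (RReg r) = 1"
| "rcost (RMem b e) = 1 + icost e"
| "rcost (RAdd e f) = 1 + rcost e + rcost f"
| "rcost (RSub e f) = 1 + rcost e + rcost f"

primrec tcost :: "test \<Rightarrow> nat" where
  "tcost (ILess e f) = 1 + icost e + icost f"
| "tcost (RLess e f) = 1 + rcost e + rcost f"
| "tcost (Not b) = 1 + tcost b"
| "tcost (And b c) = 1 + tcost b + tcost c"

text \<open>\<open>exec c s t s'\<close>: started in \<open>s\<close>, the program \<open>c\<close> halts in \<open>s'\<close> after \<open>t\<close> steps.\<close>

inductive exec :: "com \<Rightarrow> ram_state \<Rightarrow> nat \<Rightarrow> ram_state \<Rightarrow> bool" where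
  Skip: "exec Skip s 1 s"
| SetIReg: "exec (SetIReg r e) s (1 + icost e) (s\<lparr>ireg := (ireg s)(r := ival e s)\<rparr>)"
| SetIMem: "exec (SetIMem b a e) s (1 + icost a + icost e)
    (s\<lparr>imem := (imem s)(b := (imem s b)(ival a s := ival e s))\<rparr>)"
| SetRReg: "exec (SetRReg r e) s (1 + rcost e) (s\<lparr>rreg := (rreg s)(r := rval e s)\<rparr>)"
| SetRMem: "exec (SetRMem b a e) s (1 + icost a + rcost e)
    (s\<lparr>rmem := (rmem s)(b := (rmem s b)(ival a s := rval e s))\<rparr>)"
| Seq: "exec c s t s' \<Longrightarrow> exec d s' u s'' \<Longrightarrow> exec (Seq c d) s (t + u) s''"
| IfTrue: "tval b s \<Longrightarrow> exec c s t s' \<Longrightarrow> exec (If b c d) s (1 + tcost b + t) s'"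
| IfFalse: "\<not> tval b s \<Longrightarrow> exec d s t s' \<Longrightarrow> exec (If b c d) s (1 + tcost b + t) s'"
| WhileFalse: "\<not> tval b s \<Longrightarrow> exec (While b c) s (1 + tcost b) s"
| WhileTrue: "tval b s \<Longrightarrow> exec c s t s' \<Longrightarrow> exec (While b c) s' u s'' \<Longrightarrow>
    exec (While b c) s (1 + tcost b + t + u) s''"

inductive_cases SkipE: "exec Skip s t s'"
  and SetIRegE: "exec (SetIReg r e) s t s'"
  and SetIMemE: "exec (SetIMem b a e) s t s'"
  and SetRRegE: "exec (SetRReg r e) s t s'"
  and SetRMemE: "exec (SetRMem b a e) s t s'"
  and SeqE: "exec (Seq c d) s t s'"
  and IfE: "exec (If b c d) s t s'"
  and WhileE: "exec (While b c) s t s'"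

lemma exec_deterministic:
  "exec c s t s' \<Longrightarrow> exec c s u s'' \<Longrightarrow> u = t \<and> s'' = s'"
proof (induction arbitrary: u s'' rule: exec.induct)
  case (Skip s)
  then show ?case by (rule SkipE) simp
next
  case (SetIReg r e s)
  then show ?case by (rule SetIRegE) simp
next
  case (SetIMem b a e s)
  then show ?case by (rule SetIMemE) simp
next
  case (SetRReg r e s)
  then show ?case by (rule SetRRegE) simp
next
  case (SetRMem b a e s)
  then show ?case by (rule SetRMemE) simp
next
  case (Seq c s t s' d v s3)
  from Seq.prems show ?case by (rule SeqE) (metis Seq.IH)
next
  case (IfTrue b s c t s' d)
  from IfTrue.prems show ?case
    by (rule IfE) (auto simp: IfTrue.hyps dest!: IfTrue.IH)
next
  case (IfFalse b s d t s' c)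
  from IfFalse.prems show ?case
    by (rule IfE) (auto simp: IfFalse.hyps dest!: IfFalse.IH)
next
  case (WhileFalse b s c)
  from WhileFalse.prems show ?case
    by (rule WhileE) (use WhileFalse.hyps in simp_all)
next
  case (WhileTrue b s c t s' v s3)
  from WhileTrue.prems show ?case
    by (rule WhileE) (auto simp: WhileTrue.hyps dest!: WhileTrue.IH)
qed


section \<open>Encoding of instances\<close>

text \<open>
  Vertices are the numbers below \<open>n\<close>. The adjacency lists, in arbitrary order, are concatenated;
  those of vertex \<open>v\<close> occupy the positions from \<open>offset v\<close> up to (excluding) \<open>offset (v + 1)\<close>.
\<close>

definition adjacency_lists :: "nat pair_pre_digraph \<Rightarrow> nat list list \<Rightarrow> bool" where
  "adjacency_lists G adj \<longleftrightarrow>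
     pverts G = {..<length adj} \<and>
     (\<forall>v<length adj. distinct (adj ! v) \<and> set (adj ! v) = {w. (v, w) \<in> parcs G})"

definition offsets :: "nat list list \<Rightarrow> nat list" where
  "offsets adj = map (\<lambda>v. length (concat (take v adj))) [0..<length adj + 1]"

definition cells :: "'b::zero list \<Rightarrow> nat \<Rightarrow> 'b" where
  "cells xs i = (if i < length xs then xs ! i else 0)"

definition input_state :: "nat list list \<Rightarrow> (nat \<Rightarrow> real) \<Rightarrow> nat list \<Rightarrow> ram_state" where
  "input_state adj \<pi> S =
     \<lparr> ireg = (\<lambda>_. 0)(0 := length adj, 1 := length S),
       imem = (\<lambda>_ _. 0)(0 := cells (offsets adj), 1 := cells (concat adj), 2 := cells S),
       rreg = (\<lambda>_. 0),
       rmem = (\<lambda>_ _. 0)(0 := cells (map \<pi> [0..<length adj])) \<rparr>"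

definition result :: "ram_state \<Rightarrow> nat" where
  "result s = ireg s 0"

end

theory Submission
  imports Defs
begin

text \<open>
  Adding \<open>v\<close> to the sites wins every vertex closer to \<open>v\<close> than to its present site. If \<open>v\<close> gains
  \<open>gain j v\<close> from territory \<open>j\<close> and leaves \<open>rest j v\<close>, the objective is the maximum of the sum of the gains
  and of the largest rest, so it suffices to compute both aggregates for all \<open>v\<close>.

  This is done by a centroid decomposition that halves, at every level, the number of sites whose territory
  no removed centroid has met; after \<open>O(log |S|)\<close> levels of linear cost every territory has been met.
  When the centroid \<open>x\<close> of a component is removed, its own territory is treated for the whole component:
  seen from the site, \<open>v\<close> wins precisely what lies beyond the first vertex in the second half of the path to
  \<open>v\<close>. Any other unmet territory lies in a single branch at \<open>x\<close>, and for \<open>v\<close> outside that branch the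
  outcome for a vertex \<open>u\<close> depends only on whether \<open>D u - d x u\<close> exceeds \<open>d x v\<close>; bucketing by this
  difference yields sums (the own branch is subtracted) and maxima (the best value and the best one from
  another branch are kept) for all \<open>v\<close> in linear time.
\<close>

section \<open>Geodesics in trees\<close>

text \<open>The geodesic arguments use distances only: two axioms describe a tree metric by its
  neighbours, and betweenness \<open>btw\<close> stands in for paths. Centroids weigh unmet sites,
  not vertices. The territory of the centroid resists buckets, since its vertices and
  \<open>v\<close> may share a branch, so that their distance does not run through the centroid; but
  while unmet it lies inside one component, which keeps its treatment linear. Gains are added, so
  every pair of a vertex and a territory must be accounted for exactly once. Rests enter a maximum:
  repetition is harmless there, but the own branch cannot be subtracted, whence the two values per
  bucket. A rest is itself a sum over a territory; it becomes a maximum over vertices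
  \<open>u\<close> of the territory weight beyond \<open>u\<close>, numbers that do not depend on
  \<open>v\<close>.\<close>

locale tree_metric =
  fixes V :: "'a set" and d :: "'a \<Rightarrow> 'a \<Rightarrow> nat"
  assumes fin_V: "finite V"
    and d_0: "u \<in> V \<Longrightarrow> v \<in> V \<Longrightarrow> d u v = 0 \<longleftrightarrow> u = v"
    and d_sym: "u \<in> V \<Longrightarrow> v \<in> V \<Longrightarrow> d u v = d v u"
    and d_tri: "u \<in> V \<Longrightarrow> v \<in> V \<Longrightarrow> w \<in> V \<Longrightarrow> d u w \<le> d u v + d v w"
    and hop: "u \<in> V \<Longrightarrow> v \<in> V \<Longrightarrow> u \<noteq> v \<Longrightarrow> \<exists>w\<in>V. d u w = 1 \<and> d u v = Suc (d w v)"
    and hop_unique: "u \<in> V \<Longrightarrow> v \<in> V \<Longrightarrow> w \<in> V \<Longrightarrow> w' \<in> V \<Longrightarrow> d u w = 1 \<Longrightarrow> d u w' = 1 \<Longrightarrow>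
      w \<noteq> w' \<Longrightarrow> d w v \<le> d u v \<Longrightarrow> d w' v = Suc (d u v)"
begin

definition btw :: "'a \<Rightarrow> 'a \<Rightarrow> 'a \<Rightarrow> bool" where
  "btw u w v \<longleftrightarrow> u \<in> V \<and> w \<in> V \<and> v \<in> V \<and> d u w + d w v = d u v"

text \<open>First vertex on the way from \<open>u\<close> to \<open>v\<close>. The choice is
  unambiguous for \<open>u\<close> different from \<open>v\<close>: by \<open>hop_unique\<close> at
  most one neighbour of \<open>u\<close> is not farther from \<open>v\<close>, which is where
  acyclicity enters.\<close>

definition nx :: "'a \<Rightarrow> 'a \<Rightarrow> 'a" where
  "nx u v = (SOME w. w \<in> V \<and> d u w = 1 \<and> d u v = Suc (d w v))"

lemma d_self [simp]: "u \<in> V \<Longrightarrow> d u u = 0"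
  using d_0 by blast

lemma nx:
  assumes "u \<in> V" "v \<in> V" "u \<noteq> v"
  shows "nx u v \<in> V" "d u (nx u v) = 1" "d u v = Suc (d (nx u v) v)"
proof -
  have "\<exists>w. w \<in> V \<and> d u w = 1 \<and> d u v = Suc (d w v)" using hop[OF assms] by blast
  from someI_ex[OF this] show "nx u v \<in> V" "d u (nx u v) = 1" "d u v = Suc (d (nx u v) v)"
    by (auto simp: nx_def)
qed

lemma nx_unique:
  assumes "u \<in> V" "v \<in> V" "u \<noteq> v" "w \<in> V" "d u w = 1" "d w v \<le> d u v"
  shows "w = nx u v"
proof (rule ccontr)
  assume "w \<noteq> nx u v"
  then have "d (nx u v) v = Suc (d u v)" using hop_unique[of u v w "nx u v"] nx(1,2)[of u v] assms by blast
  then show False using nx(3)[of u v] assms by simp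
qed

lemma step_away:
  assumes "u \<in> V" "v \<in> V" "w \<in> V" "d u w = 1" "u \<noteq> v \<Longrightarrow> w \<noteq> nx u v"
  shows "d w v = Suc (d u v)"
proof (cases "u = v")
  case True
  then show ?thesis using assms d_sym by simp
next
  case False
  then have "d (nx u v) v \<le> d u v" using nx(3)[of u v] assms by simp
  then show ?thesis
    using hop_unique[of u v "nx u v" w] nx(1,2)[of u v] assms False by blast
qed

lemma nx_adj: "u \<in> V \<Longrightarrow> w \<in> V \<Longrightarrow> d u w = 1 \<Longrightarrow> nx u w = w"
  using nx_unique[of u w w] by (metis d_self le0 zero_neq_one)

lemma d_branches:
  assumes "x \<in> V" "u \<in> V" "v \<in> V" "u \<noteq> x" "v \<noteq> x" "nx x u \<noteq> nx x v"
  shows "d u v = d u x + d x v"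
  using assms
proof (induction "d u x" arbitrary: u rule: less_induct)
  case less
  let ?u = "nx u x"
  have u: "?u \<in> V" "d u ?u = 1" "d u x = Suc (d ?u x)" using nx[of u x] less.prems by auto
  show ?case
  proof (cases "?u = x")
    case True
    then have 1: "d x u = 1" using u d_sym less.prems by simp
    then have "nx x u = u" using nx_adj less.prems by simp
    then have "d u v = Suc (d x v)" using step_away[of x v u] 1 less.prems by auto
    then show ?thesis using 1 less.prems d_sym by simp
  next
    case False
    let ?y = "nx x ?u" and ?w = "nx ?u x"
    have y: "?y \<in> V" "d x ?y = 1" "d x ?u = Suc (d ?y ?u)" using nx[of x ?u] False u less.prems by auto
    have "d ?y u \<le> d ?y ?u + d ?u u" using d_tri y u less.prems by blast
    then have "d ?y u \<le> d x u" using y u d_sym less.prems by (metis Suc_eq_plus1 u(1) le_SucI)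
    then have "?y = nx x u" using nx_unique[of x u ?y] y less.prems by blast
    then have IH: "d ?u v = d ?u x + d x v" using less.hyps[of ?u] u False less.prems by simp
    have w: "?w \<in> V" "d ?u ?w = 1" "d ?u x = Suc (d ?w x)" using nx[of ?u x] False u less.prems by auto
    have "d ?w v \<le> d ?w x + d x v" using d_tri w less.prems by blast
    then have le: "d ?w v \<le> d ?u v" using IH w by simp
    have "d ?u u = 1" using u d_sym less.prems by simp
    moreover have "u \<noteq> ?w" using u w by auto
    ultimately have "d u v = Suc (d ?u v)"
      using hop_unique[of ?u v ?w u] w u le less.prems by auto
    then show ?thesis using IH u by simp
  qed
qed

lemma btw_iff:
  assumes "x \<in> V" "u \<in> V" "v \<in> V" "u \<noteq> x" "v \<noteq> x"
  shows "btw u x v \<longleftrightarrow> nx x u \<noteq> nx x v"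
proof
  assume b: "btw u x v"
  show "nx x u \<noteq> nx x v"
  proof
    assume eq: "nx x u = nx x v"
    let ?y = "nx x u"
    have "?y \<in> V" "d x u = Suc (d ?y u)" "d x v = Suc (d ?y v)"
      using nx[of x u] nx[of x v] assms eq by auto
    moreover have "d u v \<le> d u ?y + d ?y v" using d_tri assms calculation by blast
    ultimately show False using b d_sym assms unfolding btw_def by (metis add_Suc add_Suc_right Suc_n_not_le_n le_SucI)
  qed
next
  assume "nx x u \<noteq> nx x v"
  then show "btw u x v" using d_branches assms by (simp add: btw_def)
qed

lemma btwD: "btw u w v \<Longrightarrow> u \<in> V \<and> w \<in> V \<and> v \<in> V" by (simp add: btw_def)

lemma btw_sym: "btw u w v \<longleftrightarrow> btw v w u"
  unfolding btw_def by (metis add.commute d_sym)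

lemma btw_ends [simp]: "u \<in> V \<Longrightarrow> v \<in> V \<Longrightarrow> btw u u v" "u \<in> V \<Longrightarrow> v \<in> V \<Longrightarrow> btw u v v"
  by (simp_all add: btw_def)

lemma btw_refl: "btw u w u \<longleftrightarrow> u \<in> V \<and> w = u"
  unfolding btw_def using d_0[of u w] by (cases "u \<in> V") auto

text \<open>A vertex \<open>w\<close> between \<open>u\<close> and \<open>v\<close> cuts them apart,
  so \<open>z\<close> cannot be in the branches at \<open>w\<close> of both. Cutting is used in this
  form throughout.\<close>

lemma btw_split:
  assumes "btw u w v" "z \<in> V"
  shows "btw u w z \<or> btw z w v"
proof (cases "w = u \<or> w = v \<or> w = z")
  case True
  then show ?thesis using assms btwD by auto
next
  case False
  then show ?thesis using btw_iff[of w] assms btwD by metis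
qed

lemma btw_trans1:
  assumes "btw a b c" "btw a c e" shows "btw a b e" "btw b c e"
proof -
  have "a \<in> V" "b \<in> V" "c \<in> V" "e \<in> V" using assms by (auto simp: btw_def)
  then have "d a e \<le> d a b + d b e" "d b e \<le> d b c + d c e" using d_tri by auto
  then show "btw a b e" "btw b c e" using assms by (auto simp: btw_def)
qed

lemma btw_trans2:
  assumes "btw a b e" "btw b c e" shows "btw a b c" "btw a c e"
  using btw_trans1[of e c b a] assms btw_sym by blast+

lemma btw_linear:
  assumes "btw u a v" "btw u b v" "d u a \<le> d u b" shows "btw u a b"
proof -
  have V: "u \<in> V" "a \<in> V" "b \<in> V" "v \<in> V" using assms by (auto simp: btw_def)
  consider "btw u a b" | "btw b a v" using btw_split[OF assms(1) V(3)] by blast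
  then show ?thesis
  proof cases
    case 2
    then have "d b a = 0" using assms unfolding btw_def by linarith
    then show ?thesis using V d_0 by auto
  qed
qed

text \<open>Take the common vertex of the ways from \<open>x\<close> to \<open>u\<close> and to
  \<open>v\<close> that is farthest from \<open>x\<close>. Were it not between \<open>u\<close> and
  \<open>v\<close>, both would lie in one branch at it, and a step into that branch would be a
  farther common vertex.\<close>

lemma median:
  assumes "x \<in> V" "u \<in> V" "v \<in> V"
  shows "\<exists>z. btw x z u \<and> btw x z v \<and> btw u z v"
proof -
  let ?Z = "{z. btw x z u \<and> btw x z v}"
  have "finite ?Z" using fin_V by (rule finite_subset[rotated]) (auto simp: btw_def)
  moreover have "x \<in> ?Z" using assms by simp
  ultimately have "Max (d x ` ?Z) \<in> d x ` ?Z" "\<And>y. y \<in> ?Z \<Longrightarrow> d x y \<le> Max (d x ` ?Z)"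
    by (blast intro: Max_in, simp)
  then obtain z where z: "z \<in> ?Z" "\<And>y. y \<in> ?Z \<Longrightarrow> d x y \<le> d x z"
    by (auto simp: image_iff)
  have zV: "z \<in> V" using z btwD by blast
  have "btw u z v"
  proof (rule ccontr)
    assume n: "\<not> btw u z v"
    then have ne: "z \<noteq> u" "z \<noteq> v" using assms by auto
    then have eq: "nx z u = nx z v" using n btw_iff zV assms by metis
    let ?y = "nx z u"
    have y: "?y \<in> V" "d z ?y = 1" "d z u = Suc (d ?y u)" "d z v = Suc (d ?y v)"
      using nx[of z u] nx[of z v] ne zV assms eq by auto
    then have "btw z ?y u" "btw z ?y v" using zV assms by (auto simp: btw_def)
    then have "btw x ?y u" "btw x ?y v" "btw x z ?y" using z btw_trans2 by blast+
    then have "d x ?y \<le> d x z" "d x ?y = d x z + 1" using z y by (auto simp: btw_def)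
    then show False by simp
  qed
  then show ?thesis using z by blast
qed

text \<open>Only the position matters at which the way from \<open>u\<close> joins the path from
  \<open>r\<close> to \<open>v\<close>. Distance \<open>d r v div 2 + 1\<close> from
  \<open>r\<close> is the first position strictly past the middle; in the middle itself the tie goes
  to \<open>r\<close>, the older site.\<close>

lemma closer_iff_beyond_half:
  assumes m: "btw r m v" "d r m = Suc (d r v div 2)" and u: "u \<in> V"
  shows "d u v < d u r \<longleftrightarrow> btw u m r"
proof
  have V: "r \<in> V" "m \<in> V" "v \<in> V" using m btwD by auto
  have half: "2 * d r m \<le> d r v + 2" "d r v < 2 * d r m" using m(2) by simp_all
  have dm: "d m r = d r m" "d m v = d v m" "d u v = d v u" "d r m + d m v = d r v" 
    using V u m d_sym by (auto simp: btw_def)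
  {
    assume b: "btw u m r"
    then have "d u v \<le> d u m + d m v" using d_tri u V by blast
    moreover have "d u m + d m r = d u r" using b by (simp add: btw_def)
    ultimately show "d u v < d u r" using half dm by linarith
  next
    assume less: "d u v < d u r"
    show "btw u m r"
    proof (rule ccontr)
      assume n: "\<not> btw u m r"
      then have muv: "btw u m v" using btw_split[OF m(1) u] btw_sym by blast
      have ne: "m \<noteq> u" "m \<noteq> r" using n u V by auto
      then have eq: "nx m u = nx m r" using n btw_iff V u by metis
      \<comment> \<open>Stepping from \<open>m\<close> to \<open>?y\<close> approaches both
        \<open>u\<close> and \<open>r\<close>, so the way through \<open>m\<close> overestimates
        \<open>d u r\<close> by two. This outweighs the at most two by which \<open>m\<close> is
        farther from \<open>r\<close> than from \<open>v\<close>.\<close>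
      let ?y = "nx m u"
      have y: "?y \<in> V" "d m u = Suc (d ?y u)" "d m r = Suc (d ?y r)"
        using nx(1)[of m u] nx(3)[of m u] nx(3)[of m r] ne V u unfolding eq by blast+
      have "d u r \<le> d u ?y + d ?y r" using d_tri u y V by blast
      moreover have "d u ?y = d ?y u" "d u m = d m u" using d_sym u y V by blast+
      moreover have "d u v = d u m + d m v" using muv by (simp add: btw_def)
      ultimately show False using less half dm y(2,3) by linarith
    qed
  }
qed

section \<open>Components left after the removal of a set of vertices\<close>

definition comp :: "'a set \<Rightarrow> 'a \<Rightarrow> 'a set" where
  "comp X r = {v \<in> V. \<forall>x\<in>X. \<not> btw r x v}"

lemma comp_sub: "comp X r \<subseteq> V" by (auto simp: comp_def)

lemma finite_comp [simp]: "finite (comp X r)"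
  using comp_sub fin_V finite_subset by blast

lemma comp_self: "r \<in> V \<Longrightarrow> r \<notin> X \<Longrightarrow> r \<in> comp X r"
  by (auto simp: comp_def btw_refl)

lemma comp_sym: "r \<in> V \<Longrightarrow> v \<in> comp X r \<Longrightarrow> r \<in> comp X v"
  using btw_sym by (auto simp: comp_def)

lemma comp_trans: "v \<in> comp X r \<Longrightarrow> w \<in> comp X v \<Longrightarrow> w \<in> comp X r"
  using btw_split unfolding comp_def by blast

lemma comp_eq: "r \<in> V \<Longrightarrow> v \<in> comp X r \<Longrightarrow> comp X v = comp X r"
  using comp_sym comp_trans by blast

lemma comp_notin: "r \<in> V \<Longrightarrow> v \<in> comp X r \<Longrightarrow> v \<notin> X"
  by (auto simp: comp_def)

lemma comp_btw: "v \<in> comp X r \<Longrightarrow> btw r w v \<Longrightarrow> w \<in> comp X r"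
  using btw_trans1(1) btwD unfolding comp_def by blast

lemma comp_insert_out:
  assumes "r \<in> V" "x \<notin> comp X r"
  shows "comp (insert x X) r = comp X r"
  using comp_btw[of _ X r x] assms by (auto simp: comp_def)

lemma comp_insert_branch:
  assumes "r \<in> V" "x \<in> comp X r" "v \<in> comp X r" "v \<noteq> x"
  shows "comp (insert x X) v = {u \<in> comp X r. u \<noteq> x \<and> nx x u = nx x v}"
proof -
  have V: "x \<in> V" "v \<in> V" using assms comp_sub by auto
  have "comp (insert x X) v = {u \<in> comp X v. \<not> btw v x u}"
    by (auto simp: comp_def)
  also have "comp X v = comp X r" using comp_eq assms by blast
  also have "{u \<in> comp X r. \<not> btw v x u} = {u \<in> comp X r. u \<noteq> x \<and> nx x u = nx x v}"
  proof -
    have "btw v x x" using V by simp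
    then show ?thesis using btw_iff[of x v] V assms(4) comp_sub by (metis (no_types, lifting) subsetD)
  qed
  finally show ?thesis .
qed

end

section \<open>Territories and separating vertices\<close>

locale voronoi = tree_metric V d for V :: "'a set" and d +
  fixes S :: "'a list" and \<pi> :: "'a \<Rightarrow> real"
  assumes S_ne: "S \<noteq> []" and S_distinct: "distinct S" and S_V: "set S \<subseteq> V"
    and \<pi>_nonneg: "v \<in> V \<Longrightarrow> 0 \<le> \<pi> v"
begin

abbreviation p :: nat where "p \<equiv> length S"

text \<open>Position of the site whose territory contains \<open>u\<close>; \<open>LEAST\<close>
  implements the priority among equally near sites.\<close>

definition te :: "'a \<Rightarrow> nat" where
  "te u = (LEAST j. j < p \<and> (\<forall>i<p. d u (S ! j) \<le> d u (S ! i)))"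

definition D :: "'a \<Rightarrow> nat" where
  "D u = d u (S ! te u)"

lemma S_in_V: "j < p \<Longrightarrow> S ! j \<in> V"
  using S_V nth_mem by blast

lemma te_ex: "\<exists>j. j < p \<and> (\<forall>i<p. d u (S ! j) \<le> d u (S ! i))"
proof -
  let ?M = "(\<lambda>j. d u (S ! j)) ` {..<p}"
  have "Min ?M \<in> ?M" "\<forall>y\<in>?M. Min ?M \<le> y" using S_ne by (auto intro!: Min_in)
  then show ?thesis by force
qed

lemma te_lt: "te u < p" and D_le: "i < p \<Longrightarrow> D u \<le> d u (S ! i)"
  using LeastI_ex[OF te_ex] unfolding te_def[symmetric] D_def by blast+

lemma te_first:
  assumes "i < te u" shows "D u < d u (S ! i)"
proof -
  have "i < p" using assms te_lt less_trans by blast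
  have "\<not> (i < p \<and> (\<forall>k<p. d u (S ! i) \<le> d u (S ! k)))"
    using not_less_Least[of i "\<lambda>j. j < p \<and> (\<forall>i<p. d u (S ! j) \<le> d u (S ! i))"] assms
    unfolding te_def by blast
  then obtain k where "k < p" "d u (S ! k) < d u (S ! i)" using \<open>i < p\<close> by (auto simp: not_le)
  then show ?thesis using D_le[of k u] by simp
qed

lemma te_eqI:
  assumes "j < p" "\<And>i. i < p \<Longrightarrow> d u (S ! j) \<le> d u (S ! i)" "\<And>i. i < j \<Longrightarrow> d u (S ! j) < d u (S ! i)"
  shows "te u = j"
proof -
  have "\<not> te u < j" using assms(3)[of "te u"] D_le[of j u] assms(1) unfolding D_def by fastforce
  moreover have "\<not> j < te u" using te_first[of j u] assms(2)[OF te_lt[of u]] unfolding D_def by fastforce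
  ultimately show ?thesis by simp
qed

lemma te_S: assumes "j < p" shows "te (S ! j) = j" "D (S ! j) = 0"
proof -
  have pos: "0 < d (S ! j) (S ! i)" if "i < p" "i \<noteq> j" for i
    using that assms d_0[of "S ! j" "S ! i"] S_in_V S_distinct nth_eq_iff_index_eq by fastforce
  have self: "d (S ! j) (S ! j) = 0" using S_in_V assms by simp
  show te: "te (S ! j) = j"
    by (rule te_eqI) (use self pos assms in \<open>auto\<close>)
  then show "D (S ! j) = 0" by (simp add: D_def self)
qed

lemma D_0_iff: assumes "u \<in> V" shows "D u = 0 \<longleftrightarrow> u \<in> set S"
proof
  assume "D u = 0"
  then have "u = S ! te u" using d_0[OF assms S_in_V[OF te_lt]] by (simp add: D_def)
  then show "u \<in> set S" using te_lt nth_mem by metis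
next
  assume "u \<in> set S"
  then show "D u = 0" using te_S by (metis in_set_conv_nth)
qed

lemma D_0_te: assumes "u \<in> V" "D u = 0" shows "u = S ! te u"
  using d_0[OF assms(1) S_in_V[OF te_lt]] assms(2) by (simp add: D_def)

text \<open>Moving from \<open>u\<close> to \<open>w\<close> shortens the distance to the site of
  \<open>u\<close> by \<open>d u w\<close> and to no site by more. So at \<open>w\<close> neither a
  nearer site nor an equally near one of smaller position can appear.\<close>

lemma te_convex:
  assumes "btw u w (S ! te u)"
  shows "te w = te u" "D u = d u w + D w"
proof -
  have V: "u \<in> V" "w \<in> V" using assms btwD by auto
  have eq: "D u = d u w + d w (S ! te u)" using assms by (simp add: btw_def D_def)
  show te: "te w = te u"
  proof (rule te_eqI[OF te_lt])
    fix i
    { assume "i < p"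
      then show "d w (S ! te u) \<le> d w (S ! i)"
        using D_le[of i u] d_tri[OF V S_in_V[of i]] eq by simp }
    { assume "i < te u"
      then show "d w (S ! te u) < d w (S ! i)"
        using te_first[of i u] d_tri[OF V S_in_V[of i]] te_lt[of u] eq by simp }
  qed
  show "D u = d u w + D w" using eq te by (simp add: D_def)
qed

text \<open>By \<open>btw_split\<close>, a vertex between two members of a territory is on the way
  from one of them to the common site.\<close>

lemma te_connected:
  assumes "te u = te v" "btw u z v"
  shows "te z = te u"
  using btw_split[OF assms(2) S_in_V[OF te_lt[of u]]] te_convex[of u z] te_convex[of v z] assms btw_sym
  by metis

lemma D_lipschitz: assumes "u \<in> V" "w \<in> V" shows "D u \<le> d u w + D w"
  using D_le[OF te_lt[of w], of u] d_tri[OF assms S_in_V[OF te_lt[of w]]] unfolding D_def by simp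

definition gain :: "nat \<Rightarrow> 'a \<Rightarrow> real" where
  "gain j v = (\<Sum>u | u \<in> V \<and> te u = j \<and> d u v < D u. \<pi> u)"

definition rest :: "nat \<Rightarrow> 'a \<Rightarrow> real" where
  "rest j v = (\<Sum>u | u \<in> V \<and> te u = j \<and> D u \<le> d u v. \<pi> u)"

lemma finite_V_Collect [simp]: "finite {u. u \<in> V \<and> P u}"
  using fin_V by simp

lemma rest_nonneg: "0 \<le> rest j v"
  unfolding rest_def by (rule sum_nonneg) (use \<pi>_nonneg in blast)

lemma gain_plus_rest: "gain j v + rest j v = (\<Sum>u | u \<in> V \<and> te u = j. \<pi> u)"
  unfolding gain_def rest_def
  by (subst sum.union_disjoint[symmetric]) (auto intro!: sum.cong)

lemma gain_beyond_half:
  assumes "c < p" "btw (S ! c) h v" "d (S ! c) h = Suc (d (S ! c) v div 2)"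
  shows "gain c v = (\<Sum>u | u \<in> V \<and> te u = c \<and> btw (S ! c) h u. \<pi> u)"
  unfolding gain_def
proof (rule sum.cong)
  have "d u v < D u \<longleftrightarrow> btw (S ! c) h u" if "u \<in> V" "te u = c" for u
    using closer_iff_beyond_half[OF assms(2,3) that(1)] that btw_sym by (auto simp: D_def)
  then show "{u. u \<in> V \<and> te u = c \<and> d u v < D u} = {u. u \<in> V \<and> te u = c \<and> btw (S ! c) h u}"
    by blast
qed simp

text \<open>This weight depends on the centroid \<open>x\<close> and on \<open>u\<close> only; that
  is what lets the largest rest for all \<open>v\<close> be read off bucket maxima.\<close>

definition beyond :: "'a \<Rightarrow> 'a \<Rightarrow> real" where
  "beyond x u = (\<Sum>u' | u' \<in> V \<and> te u' = te u \<and> btw x u u'. \<pi> u')"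

text \<open>Were \<open>u\<close> on the side of \<open>v\<close>, the way from \<open>u\<close> to
  its site would pass \<open>x\<close> and put \<open>x\<close> itself into territory
  \<open>j\<close>.\<close>

lemma separated_territory:
  assumes "btw v x (S ! j)" "te x \<noteq> j" "u \<in> V" "te u = j" "j < p"
  shows "btw v x u"
proof -
  have "\<not> btw u x (S ! j)" using te_convex[of u x] assms by metis
  then show ?thesis using btw_split[OF assms(1,3)] by blast
qed

lemma separated_dist:
  assumes "btw v x (S ! j)" "te x \<noteq> j" "u \<in> V" "te u = j" "j < p"
  shows "d u v = d x v + d x u"
  using separated_territory[OF assms] d_sym unfolding btw_def by (metis)

text \<open>For the second part take the vertex closest to \<open>x\<close> among those of territory \<open>j\<close> that \<open>v\<close> does not win:
  everything that \<open>v\<close> leaves lies beyond it. By the first part the maximum of \<open>beyond x\<close> may range over all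
  vertices that \<open>v\<close> leaves, whether or not they are on the path from \<open>x\<close> to the site.\<close>

lemma rest_separated:
  assumes j: "btw v x (S ! j)" "te x \<noteq> j" "j < p"
  shows "\<And>u. u \<in> V \<Longrightarrow> te u = j \<Longrightarrow> D u \<le> d x v + d x u \<Longrightarrow> beyond x u \<le> rest j v"
    and "\<exists>u\<in>V. te u = j \<and> D u \<le> d x v + d x u \<and> rest j v \<le> beyond x u"
proof -
  have xV: "x \<in> V" and vV: "v \<in> V" using j btwD by auto
  note dist = separated_dist[OF j(1,2) _ _ j(3)]
  have nn: "0 \<le> \<pi> b" if "b \<in> V" for b using that \<pi>_nonneg by blast
  {
    fix u assume u: "u \<in> V" "te u = j" "D u \<le> d x v + d x u"
    show "beyond x u \<le> rest j v" unfolding beyond_def rest_def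
    proof (rule sum_mono2)
      show "{u'. u' \<in> V \<and> te u' = te u \<and> btw x u u'} \<subseteq> {u. u \<in> V \<and> te u = j \<and> D u \<le> d u v}"
      proof
        fix w assume "w \<in> {u'. u' \<in> V \<and> te u' = te u \<and> btw x u u'}"
        then have w: "w \<in> V" "te w = j" "d x w = d x u + d u w" using u by (auto simp: btw_def)
        have "D w \<le> d w u + D u" using D_lipschitz w u by blast
        moreover have "d w u = d u w" using d_sym w u by blast
        ultimately have "D w \<le> d w v" using dist[OF w(1,2)] u w by simp
        then show "w \<in> {u. u \<in> V \<and> te u = j \<and> D u \<le> d u v}" using w by simp
      qed
    qed (use nn in auto)
  }
  let ?Z = "{u. u \<in> V \<and> te u = j \<and> D u \<le> d x v + d x u}"
  have "S ! j \<in> ?Z" using te_S S_in_V j by simp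
  then obtain u where u: "u \<in> ?Z" "\<And>y. y \<in> ?Z \<Longrightarrow> d x u \<le> d x y"
    using ex_has_least_nat[of "\<lambda>u. u \<in> ?Z" "S ! j" "d x"] by blast
  have "btw x u w" if w: "w \<in> ?Z" for w
  proof -
    obtain z where z: "btw x z u" "btw x z w" "btw u z w" using median xV u(1) w by blast
    have zV: "z \<in> V" using z btwD by blast
    have te: "te z = j" using te_connected[of u w z] z u(1) w by auto
    \<comment> \<open>Going from \<open>a\<close> to \<open>z\<close> approaches the site and
      \<open>x\<close> alike, so \<open>D\<close> and the distance to \<open>x\<close> fall by the
      same amount and the defining inequality of \<open>?Z\<close> survives. The median
      \<open>z\<close> lies between \<open>u\<close> and \<open>w\<close>, hence on the way of one
      of them to the site.\<close>
    have *: "D z \<le> d x v + d x z" if "a \<in> ?Z" "btw x z a" "btw a z (S ! j)" for a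
    proof -
      have "D a = d a z + D z" using te_convex[of a z] that by auto
      moreover have "d x a = d x z + d z a" "d a z = d z a" using that d_sym by (auto simp: btw_def)
      ultimately show ?thesis using that(1) by auto
    qed
    have "D z \<le> d x v + d x z"
      using btw_split[OF z(3) S_in_V[OF j(3)]] *[OF u(1) z(1)] *[OF w z(2)] btw_sym by blast
    then have "d x u \<le> d x z" using u(2)[of z] zV te by blast
    then have "z = u" using z(1) d_0[of z u] zV u(1) unfolding btw_def by fastforce
    then show ?thesis using z by simp
  qed
  then have sub: "?Z \<subseteq> {u'. u' \<in> V \<and> te u' = te u \<and> btw x u u'}" using u(1) by auto
  have "rest j v = sum \<pi> ?Z" unfolding rest_def
    by (rule sum.cong) (use dist in auto)
  also have "\<dots> \<le> beyond x u" unfolding beyond_def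
    by (rule sum_mono2) (use sub nn in auto)
  finally show "\<exists>u\<in>V. te u = j \<and> D u \<le> d x v + d x u \<and> rest j v \<le> beyond x u" using u(1) by blast
qed

section \<open>Bookkeeping of the pairs of a vertex and a territory\<close>

definition undone :: "'a set \<Rightarrow> nat \<Rightarrow> bool" where
  "undone X j \<longleftrightarrow> j < p \<and> (\<forall>x\<in>X. te x \<noteq> j)"

text \<open>\<open>X\<close> is the set of removed centroids. The pair of \<open>v\<close> and territory \<open>j\<close> has been accounted for as soon as
  a removed vertex separates them or lies in the territory.\<close>

definition handled :: "'a set \<Rightarrow> 'a \<Rightarrow> nat \<Rightarrow> bool" where
  "handled X v j \<longleftrightarrow> (\<exists>x\<in>X. btw v x (S ! j) \<or> te x = j)"

definition partial_gain :: "'a set \<Rightarrow> 'a \<Rightarrow> real" where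
  "partial_gain X v = (\<Sum>u | u \<in> V \<and> handled X v (te u) \<and> d u v < D u. \<pi> u)"

definition partial_rest :: "'a set \<Rightarrow> 'a \<Rightarrow> real" where
  "partial_rest X v = Max (insert 0 ((\<lambda>j. rest j v) ` {j. j < p \<and> handled X v j}))"

text \<open>The centroid forms a branch of its own, named by itself; thus for \<open>v = x\<close>
  every other vertex counts as lying in a different branch.\<close>

definition branch :: "'a \<Rightarrow> 'a \<Rightarrow> 'a" where
  "branch x u = (if u = x then x else nx x u)"

lemma btw_iff_branch:
  assumes "x \<in> V" "u \<in> V" "v \<in> V" "u \<noteq> x"
  shows "btw v x u \<longleftrightarrow> branch x u \<noteq> branch x v"
proof (cases "v = x")
  case True
  have "nx x u \<noteq> x" using nx[of x u] assms by fastforce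
  then show ?thesis using True assms by (simp add: branch_def)
next
  case False
  then show ?thesis using btw_iff[of x v u] assms by (auto simp: branch_def)
qed

text \<open>All vertices between \<open>u\<close> and its site belong to the territory by
  \<open>te_convex\<close>, and none of them is removed: an unmet territory is never torn
  apart.\<close>

lemma undone_territory_in_comp:
  assumes r: "r \<in> V" and u: "u \<in> V" "undone X (te u)"
  shows "u \<in> comp X r \<longleftrightarrow> S ! te u \<in> comp X r"
proof -
  have "x \<notin> X" if "btw u x (S ! te u)" for x
    using te_convex(1)[OF that] u(2) unfolding undone_def by blast
  then have "S ! te u \<in> comp X u" using S_in_V te_lt unfolding comp_def by blast
  then have "u \<in> comp X (S ! te u)" using comp_sym u by blast
  then show ?thesis using \<open>S ! te u \<in> comp X u\<close> comp_trans by blast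
qed

text \<open>A removed \<open>y\<close> already separates \<open>v\<close> from \<open>x\<close>. It
  then separates \<open>v\<close> from everything that \<open>x\<close> separates from
  \<open>v\<close>; and if \<open>x\<close> is in territory \<open>j\<close>, then \<open>y\<close>
  is in it too or lies between \<open>v\<close> and the site.\<close>

lemma handled_outside:
  assumes "r \<in> V" "x \<in> comp X r" "v \<in> V" "v \<notin> comp X r" "j < p"
  shows "handled (insert x X) v j \<longleftrightarrow> handled X v j"
proof
  have xV: "x \<in> V" using assms comp_sub by blast
  obtain y where y: "y \<in> X" "btw r y v" using assms unfolding comp_def by blast
  have "\<not> btw r y x" using assms(2) y(1) unfolding comp_def by blast
  then have yxv: "btw x y v" using btw_split[OF y(2) xV] by blast
  assume "handled (insert x X) v j"
  then consider "handled X v j" | "btw v x (S ! j)" | "te x = j" unfolding handled_def by blast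
  then show "handled X v j"
  proof cases
    case 2
    then have "btw v y (S ! j)" using yxv btw_trans1[of v y x "S ! j"] btw_sym by blast
    then show ?thesis using y unfolding handled_def by blast
  next
    case 3
    then have "btw v y (S ! j) \<or> te y = j"
      using btw_split[OF yxv S_in_V[OF assms(5)]] te_convex(1)[of x y] btw_sym by metis
    then show ?thesis using y unfolding handled_def by blast
  qed
qed (auto simp: handled_def)

text \<open>The last two claims keep the new pairs apart from those handled earlier; without them
  gains could be counted twice.\<close>

lemma handled_inside:
  assumes "r \<in> V" "x \<in> comp X r" "v \<in> comp X r" "j < p"
  shows "handled (insert x X) v j \<longleftrightarrow> handled X v j \<or> te x = j \<or>
    (undone (insert x X) j \<and> S ! j \<in> comp X r \<and> btw v x (S ! j))"
    and "te x = j \<Longrightarrow> undone X j \<Longrightarrow> \<not> handled X v j"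
    and "undone X j \<Longrightarrow> S ! j \<in> comp X r \<Longrightarrow> \<not> handled X v j"
proof -
  have xV: "x \<in> V" and vV: "v \<in> V" using assms comp_sub by auto
  have c: "comp X v = comp X r" using comp_eq assms by blast
  show *: "\<not> handled X v j" if "undone X j" "S ! j \<in> comp X r"
    using that c unfolding handled_def undone_def comp_def by blast
  show "\<not> handled X v j" if "te x = j" "undone X j"
    using undone_territory_in_comp[OF assms(1) xV, of X] that assms(2) * by blast
  have "S ! j \<in> comp X r" if "\<not> handled X v j"
    using that c S_in_V[OF assms(4)] unfolding handled_def comp_def by blast
  then show "handled (insert x X) v j \<longleftrightarrow> handled X v j \<or> te x = j \<or>
    (undone (insert x X) j \<and> S ! j \<in> comp X r \<and> btw v x (S ! j))"
    using assms(4) unfolding handled_def undone_def by blast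
qed

lemma handled_te: "te x = j \<Longrightarrow> x \<in> X \<Longrightarrow> handled X v j"
  unfolding handled_def by blast

context
  fixes X r x v
  assumes r: "r \<in> V" and x: "x \<in> comp X r" and v: "v \<in> comp X r"
begin

text \<open>The vertices whose contest with \<open>v\<close> is settled by the removal of
  \<open>x\<close> although \<open>x\<close> is not in their territory: their distance to
  \<open>v\<close> runs through \<open>x\<close>.\<close>

definition opposite :: "'a set" where
  "opposite = {u \<in> comp X r. undone (insert x X) (te u) \<and> branch x u \<noteq> branch x v}"

text \<open>As \<open>x\<close> is outside the territory of \<open>u\<close>, it is not between
  \<open>u\<close> and its site. Both are on the same side of \<open>x\<close>, so membership can be
  tested at the site, which is how \<open>handled\<close> is phrased.\<close>

lemma opposite_iff:
  assumes u: "u \<in> V"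
  shows "u \<in> opposite \<longleftrightarrow>
    undone (insert x X) (te u) \<and> S ! te u \<in> comp X r \<and> btw v x (S ! te u)"
proof -
  have xV: "x \<in> V" and vV: "v \<in> V" using x v comp_sub by auto
  show ?thesis
  proof (cases "undone (insert x X) (te u)")
    case True
    then have und: "undone X (te u)" and tx: "te x \<noteq> te u" by (auto simp: undone_def)
    have "u \<noteq> x" using tx by blast
    have "btw v x u \<longleftrightarrow> btw v x (S ! te u)"
    proof
      have n: "\<not> btw u x (S ! te u)" using te_convex(1)[of u x] tx by blast
      then have n': "\<not> btw (S ! te u) x u" using btw_sym by blast
      show "btw v x u \<Longrightarrow> btw v x (S ! te u)" using btw_split[OF _ S_in_V[OF te_lt]] n' by blast
      show "btw v x (S ! te u) \<Longrightarrow> btw v x u" using btw_split[OF _ u] n by blast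
    qed
    then show ?thesis using True undone_territory_in_comp[OF r u und] btw_iff_branch[OF xV u vV \<open>u \<noteq> x\<close>]
      unfolding opposite_def by blast
  qed (auto simp: opposite_def)
qed

lemma opposite_dist:
  assumes "u \<in> opposite"
  shows "d u v = d x v + d x u"
proof -
  have "u \<in> V" using assms comp_sub by (auto simp: opposite_def)
  then show ?thesis
    using separated_dist[of v x "te u" u] opposite_iff[of u] assms te_lt by (auto simp: undone_def)
qed

text \<open>The newly handled pairs belong to the territory of \<open>x\<close>, if that was unmet,
  or to \<open>opposite\<close>. The three parts are disjoint, as a sum requires.\<close>

lemma partial_gain_insert:
  "partial_gain (insert x X) v = partial_gain X v
     + (if undone X (te x) then gain (te x) v else 0)
     + (\<Sum>u | u \<in> opposite \<and> d x v + d x u < D u. \<pi> u)"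
proof -
  let ?G = "{u. u \<in> V \<and> handled X v (te u) \<and> d u v < D u}"
  let ?C = "{u. u \<in> V \<and> undone X (te x) \<and> te u = te x \<and> d u v < D u}"
  let ?O = "{u. u \<in> opposite \<and> d x v + d x u < D u}"
  have sub: "opposite \<subseteq> V" using comp_sub by (auto simp: opposite_def)
  have und: "handled X v j" if "\<not> undone X j" "j < p" for j
    using that unfolding undone_def handled_def by blast
  have O: "?O = {u. u \<in> V \<and> u \<in> opposite \<and> d u v < D u}" using sub opposite_dist by auto
  have U: "{u. u \<in> V \<and> handled (insert x X) v (te u) \<and> d u v < D u} = ?G \<union> ?C \<union> ?O"
    unfolding O using handled_inside(1)[OF r x v te_lt] opposite_iff und te_lt by fastforce
  have GC: "?G \<inter> ?C = {}" using handled_inside(2)[OF r x v te_lt] by force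
  have GCO: "(?G \<union> ?C) \<inter> ?O = {}"
    unfolding O using handled_inside(3)[OF r x v te_lt] opposite_iff by (fastforce simp: undone_def)
  have C: "sum \<pi> ?C = (if undone X (te x) then gain (te x) v else 0)"
    by (simp add: gain_def)
  have fin: "finite ?O" "finite ?G" "finite ?C" unfolding O by simp_all
  have "sum \<pi> (?G \<union> ?C \<union> ?O) = sum \<pi> ?G + sum \<pi> ?C + sum \<pi> ?O"
    using sum.union_disjoint[OF finite_UnI[OF fin(2,3)] fin(1) GCO, of \<pi>]
      sum.union_disjoint[OF fin(2,3) GC, of \<pi>] by (simp only:)
  then show ?thesis unfolding partial_gain_def U C by simp
qed

text \<open>A newly separated territory is represented by the vertices that \<open>v\<close> leaves
  in it: by \<open>rest_separated\<close>, \<open>beyond\<close> never exceeds the rest there and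
  attains it or more at one of them. So the maximum ranges over vertices without grouping them by
  territory.\<close>

lemma partial_rest_insert:
  "partial_rest (insert x X) v = max (partial_rest X v)
     (max (if undone X (te x) then rest (te x) v else 0)
       (Max (insert 0 (beyond x ` {u. u \<in> opposite \<and> D u \<le> d x v + d x u}))))"
  (is "?L = max ?A (max ?B ?M)")
proof -
  let ?U = "{u. u \<in> opposite \<and> D u \<le> d x v + d x u}"
  let ?J = "{j. j < p \<and> handled X v j}" and ?J' = "{j. j < p \<and> handled (insert x X) v j}"
  have sub: "opposite \<subseteq> V" using comp_sub by (auto simp: opposite_def)
  have fin: "finite ?U" by (rule finite_subset[OF _ fin_V]) (use sub in blast)
  have und: "handled X v j" if "\<not> undone X j" "j < p" for j
    using that unfolding undone_def handled_def by blast
  have L: "rest j v \<le> ?L" if "j \<in> ?J'" for j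
    unfolding partial_rest_def using that by (intro Max_ge) auto
  have L0: "0 \<le> ?L" unfolding partial_rest_def by (intro Max_ge) auto
  have A: "rest j v \<le> ?A" if "j \<in> ?J" for j
    unfolding partial_rest_def using that by (intro Max_ge) auto
  have A0: "0 \<le> ?A" unfolding partial_rest_def by (intro Max_ge) auto
  show ?thesis
  proof (rule antisym)
    have "rest j v \<le> max ?A (max ?B ?M)" if j: "j \<in> ?J'" for j
    proof -
      consider "handled X v j" | "te x = j" "undone X j" |
        "undone (insert x X) j" "S ! j \<in> comp X r" "btw v x (S ! j)"
        using handled_inside(1)[OF r x v, of j] j und by blast
      then show ?thesis
      proof cases
        case 1
        then show ?thesis using A[of j] j by auto
      next
        case 2
        then show ?thesis by auto
      next
        case 3
        then have "te x \<noteq> j" by (auto simp: undone_def)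
        then obtain u where u: "u \<in> V" "te u = j" "D u \<le> d x v + d x u" "rest j v \<le> beyond x u"
          using rest_separated(2)[OF 3(3)] j by blast
        then have "u \<in> ?U" using opposite_iff[of u] 3 by blast
        then have "beyond x u \<le> ?M" using fin by (intro Max_ge) auto
        then show ?thesis using u by linarith
      qed
    qed
    then show "?L \<le> max ?A (max ?B ?M)" 
      unfolding partial_rest_def[of "insert x X"] using A0 by (intro Max.boundedI) auto
  next
    have "?A \<le> ?L" unfolding partial_rest_def
      by (intro Max_mono) (auto simp: handled_def)
    moreover have "?B \<le> ?L" using L[of "te x"] L0 te_lt handled_te[of x "te x"] by auto
    moreover have "beyond x u \<le> ?L" if u: "u \<in> ?U" for u
    proof -
      have uV: "u \<in> V" using u sub by blast
      then have o: "undone (insert x X) (te u)" "S ! te u \<in> comp X r" "btw v x (S ! te u)"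
        using opposite_iff u by auto
      then have "te x \<noteq> te u" by (auto simp: undone_def)
      then have "beyond x u \<le> rest (te u) v" using rest_separated(1)[OF o(3) _ te_lt uV] u by blast
      also have "\<dots> \<le> ?L" using L[of "te u"] handled_inside(1)[OF r x v te_lt] o te_lt by blast
      finally show ?thesis .
    qed
    ultimately show "max ?A (max ?B ?M) \<le> ?L" using fin L0 by (auto)
  qed
qed

end

lemma partial_outside:
  assumes "r \<in> V" "x \<in> comp X r" "v \<in> V" "v \<notin> comp X r"
  shows "partial_gain (insert x X) v = partial_gain X v" "partial_rest (insert x X) v = partial_rest X v"
proof -
  have h: "handled (insert x X) v j \<longleftrightarrow> handled X v j" if "j < p" for j
    using handled_outside[OF assms that] .
  have "{j. j < p \<and> handled (insert x X) v j} = {j. j < p \<and> handled X v j}" using h by blast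
  then show "partial_gain (insert x X) v = partial_gain X v" "partial_rest (insert x X) v = partial_rest X v"
    unfolding partial_gain_def partial_rest_def using h te_lt by simp_all
qed

lemma partial_empty: "partial_gain {} v = 0" "partial_rest {} v = 0"
  by (simp_all add: partial_gain_def partial_rest_def handled_def)

lemma partial_complete:
  assumes "\<And>j. j < p \<Longrightarrow> \<not> undone X j"
  shows "partial_gain X v = (\<Sum>u | u \<in> V \<and> d u v < D u. \<pi> u)"
    and "partial_rest X v = Max ((\<lambda>j. rest j v) ` {..<p})"
proof -
  have h: "handled X v j" if "j < p" for j
    using assms[OF that] that unfolding undone_def handled_def by blast
  show "partial_gain X v = (\<Sum>u | u \<in> V \<and> d u v < D u. \<pi> u)"
    unfolding partial_gain_def using h te_lt by simp
  have "{j. j < p \<and> handled X v j} = {..<p}" using h by auto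
  moreover have "0 \<le> Max ((\<lambda>j. rest j v) ` {..<p})"
    using rest_nonneg S_ne by (subst Max_ge_iff) auto
  ultimately show "partial_rest X v = Max ((\<lambda>j. rest j v) ` {..<p})"
    unfolding partial_rest_def using S_ne by (subst Max_insert) auto
qed

section \<open>Unmet sites and their halving at a centroid\<close>

definition sites :: "'a set \<Rightarrow> 'a \<Rightarrow> 'a set" where
  "sites X r = {u \<in> comp X r. D u = 0 \<and> undone X (te u)}"

lemma finite_sites [simp]: "finite (sites X r)"
  by (simp add: sites_def)

lemma sites_empty_iff:
  assumes "r \<in> V"
  shows "sites X r = {} \<longleftrightarrow> (\<forall>j. undone X j \<longrightarrow> S ! j \<notin> comp X r)"
proof
  assume e: "sites X r = {}"
  show "\<forall>j. undone X j \<longrightarrow> S ! j \<notin> comp X r"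
  proof (intro allI impI notI)
    fix j assume "undone X j" "S ! j \<in> comp X r"
    then have "S ! j \<in> sites X r" using te_S[of j] unfolding sites_def undone_def by simp
    then show False using e by blast
  qed
next
  assume *: "\<forall>j. undone X j \<longrightarrow> S ! j \<notin> comp X r"
  have "u \<notin> sites X r" for u
  proof
    assume u: "u \<in> sites X r"
    then have "u = S ! te u" using D_0_te comp_sub unfolding sites_def by blast
    then show False using * u unfolding sites_def by auto
  qed
  then show "sites X r = {}" by blast
qed

lemma sites_insert_sub:
  assumes "r \<in> V" "x \<in> comp X r" "y \<in> comp X r" "y \<noteq> x"
  shows "sites (insert x X) y \<subseteq> {u \<in> sites X r. u \<noteq> x \<and> nx x u = nx x y}"
  unfolding sites_def comp_insert_branch[OF assms] undone_def by blast

text \<open>If \<open>y\<close> is on the side of the root, its new component misses all that is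
  below \<open>x\<close>, which is more than half of the sites. Otherwise \<open>y\<close> is a
  child of \<open>x\<close>, its component is below \<open>y\<close>, and \<open>light\<close>
  applies.\<close>

lemma sites_half:
  assumes r: "r \<in> V" "r \<notin> X" and x: "x \<in> comp X r" and y: "y \<in> comp X r" "d x y = 1"
    and heavy: "card (sites X r) < 2 * card {u \<in> sites X r. btw r x u}"
    and light: "\<And>w. w \<in> comp X r \<Longrightarrow> w \<noteq> r \<Longrightarrow> nx w r = x \<Longrightarrow> 2 * card {u \<in> sites X r. btw r w u} \<le> card (sites X r)"
  shows "card (sites (insert x X) y) \<le> card (sites X r) div 2"
proof -
  have V: "x \<in> V" "y \<in> V" using x y comp_sub by auto
  have ne: "y \<noteq> x" using y V by auto
  have nxy: "nx x y = y" using nx_adj V y by blast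
  have sub: "sites (insert x X) y \<subseteq> {u \<in> sites X r. u \<noteq> x \<and> nx x u = y}"
    using sites_insert_sub[OF r(1) x y(1) ne] nxy by simp
  show ?thesis
  proof (cases "x \<noteq> r \<and> y = nx x r")
    case True
    have "{u \<in> sites X r. u \<noteq> x \<and> nx x u = y} \<subseteq> sites X r - {u \<in> sites X r. btw r x u}"
      using btw_iff[of x r] True V r comp_sub unfolding sites_def by fastforce
    then have "card (sites (insert x X) y) \<le> card (sites X r - {u \<in> sites X r. btw r x u})"
      using sub by (intro card_mono) auto
    also have "\<dots> = card (sites X r) - card {u \<in> sites X r. btw r x u}"
      by (rule card_Diff_subset) auto
    finally show ?thesis using heavy by linarith
  next
    case False
    have dy: "d y r = Suc (d x r)" using step_away[of x r y] False V r y by blast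
    then have yr: "y \<noteq> r" using r by auto
    have "x = nx y r" using nx_unique[of y r x] dy V r yr y d_sym by (metis le_SucI order_refl)
    then have l: "2 * card {u \<in> sites X r. btw r y u} \<le> card (sites X r)" using light yr y by blast
    have "btw r y u" if u: "u \<in> sites X r" "u \<noteq> x" "nx x u = y" for u
    proof -
      have uV: "u \<in> V" using u comp_sub by (auto simp: sites_def)
      have "btw x y u" using nx[of x u] u uV V y by (auto simp: btw_def)
      moreover have "btw r x u"
      proof (cases "x = r")
        case True then show ?thesis using uV V by simp
      next
        case False
        then have "nx x r \<noteq> nx x u" using u \<open>\<not> (x \<noteq> r \<and> y = nx x r)\<close> by auto
        then show ?thesis using btw_iff[of x r u] False uV u V r by auto
      qed
      ultimately show ?thesis using btw_trans2[of r x u y] by blast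
    qed
    then have "sites (insert x X) y \<subseteq> {u \<in> sites X r. btw r y u}" using sub by blast
    then have "card (sites (insert x X) y) \<le> card {u \<in> sites X r. btw r y u}" by (intro card_mono) auto
    then show ?thesis using l by linarith
  qed
qed

end

section \<open>Hop distance of an undirected tree\<close>

context pair_graph
begin

definition hops :: "'a \<Rightarrow> 'a \<Rightarrow> nat" where
  "hops u v = (LEAST k. \<exists>p. awalk u p v \<and> length p = k)"

lemma hops_le: "awalk u p v \<Longrightarrow> hops u v \<le> length p"
  unfolding hops_def by (rule Least_le) blast

context
  assumes conn: "\<And>u v. u \<in> pverts G \<Longrightarrow> v \<in> pverts G \<Longrightarrow> \<exists>p. awalk u p v"
begin

lemma shortest_awalk:
  assumes "u \<in> pverts G" "v \<in> pverts G"
  shows "\<exists>p. awalk u p v \<and> length p = hops u v"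
proof -
  have "\<exists>k p. awalk u p v \<and> length p = k" using conn[OF assms] by blast
  from LeastI_ex[OF this] show ?thesis unfolding hops_def .
qed

lemma hops_0: "u \<in> pverts G \<Longrightarrow> v \<in> pverts G \<Longrightarrow> hops u v = 0 \<longleftrightarrow> u = v"
  using shortest_awalk[of u v] hops_le[of u "[]" v] by (auto simp: awalk_Nil_iff)

lemma hops_sym_le: "u \<in> pverts G \<Longrightarrow> v \<in> pverts G \<Longrightarrow> hops u v \<le> hops v u"
proof -
  assume "u \<in> pverts G" "v \<in> pverts G"
  then obtain p where "awalk v p u" "length p = hops v u" using shortest_awalk by blast
  moreover have "length (rev_path p) = length p" by (induction p) (auto simp: rev_path.simps)
  ultimately show "hops u v \<le> hops v u" using hops_le[of u "rev_path p" v] by simp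
qed

lemma hops_sym: "u \<in> pverts G \<Longrightarrow> v \<in> pverts G \<Longrightarrow> hops u v = hops v u"
  using hops_sym_le by (simp add: le_antisym)

lemma hops_triangle:
  assumes "u \<in> pverts G" "v \<in> pverts G" "w \<in> pverts G"
  shows "hops u w \<le> hops u v + hops v w"
proof -
  obtain p q where "awalk u p v" "length p = hops u v" "awalk v q w" "length q = hops v w"
    using shortest_awalk assms by metis
  then show ?thesis using hops_le[of u "p @ q" w] awalk_appendI[of u p v q w] by simp
qed

lemma hops_1: "u \<in> pverts G \<Longrightarrow> v \<in> pverts G \<Longrightarrow> hops u v = 1 \<longleftrightarrow> (u, v) \<in> parcs G"
proof
  assume V: "u \<in> pverts G" "v \<in> pverts G" and "hops u v = 1"
  then obtain p where p: "awalk u p v" "length p = 1" using shortest_awalk by metis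
  then obtain e where "p = [e]" by (auto simp: length_Suc_conv)
  then show "(u, v) \<in> parcs G" using p by (cases e) (auto simp: awalk_Cons_iff awalk_Nil_iff)
next
  assume V: "u \<in> pverts G" "v \<in> pverts G" and a: "(u, v) \<in> parcs G"
  then have "awalk u [(u, v)] v" by (simp add: awalk_Cons_iff awalk_Nil_iff)
  then have "hops u v \<le> 1" using hops_le[of u "[(u, v)]" v] by simp
  moreover have "u \<noteq> v" using pair_no_loops[OF a] by auto
  then have "hops u v \<noteq> 0" using hops_0[OF V] by simp
  ultimately show "hops u v = 1" by simp
qed

lemma hops_step:
  assumes V: "u \<in> pverts G" "v \<in> pverts G" and ne: "u \<noteq> v"
  shows "\<exists>w\<in>pverts G. hops u w = 1 \<and> hops u v = Suc (hops w v)"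
proof -
  obtain p where p: "awalk u p v" "length p = hops u v" using shortest_awalk V by blast
  have "p \<noteq> []" using p(1) ne by (auto simp: awalk_Nil_iff)
  then obtain e q where eq: "p = e # q" by (cases p) auto
  then obtain w where w: "(u, w) \<in> parcs G" "awalk w q v" using p(1) by (cases e) (auto simp: awalk_Cons_iff)
  have wV: "w \<in> pverts G" using arc_snd_in_verts[OF w(1)] by simp
  have 1: "hops u w = 1" using hops_1 V wV w by blast
  have "hops w v \<le> length q" using hops_le w by blast
  moreover have "hops u v \<le> hops u w + hops w v" using hops_triangle V wV by blast
  ultimately have "hops u v = Suc (hops w v)" using p eq 1 by simp
  then show ?thesis using wV 1 by blast
qed

text \<open>After the first vertex the walk is strictly nearer to \<open>v\<close>, so it avoids
  every other vertex that is at least as far from \<open>v\<close> as its start. The cycle in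
  \<open>hops_unique\<close> needs this for the vertex that closes it.\<close>

lemma descending_awalk:
  assumes "u \<in> pverts G" "v \<in> pverts G"
  shows "\<exists>p. awalk u p v \<and> (\<forall>x\<in>set (awalk_verts u p). x = u \<or> hops x v < hops u v)"
  using assms
proof (induction "hops u v" arbitrary: u)
  case 0
  then have "u = v" using hops_0 by simp
  then show ?case using 0 by (intro exI[of _ "[]"]) (auto simp: awalk_Nil_iff)
next
  case (Suc k)
  then have "u \<noteq> v" using hops_0[of u v] by auto
  then obtain w where w: "w \<in> pverts G" "hops u w = 1" "hops u v = Suc (hops w v)"
    using hops_step Suc.prems by blast
  then obtain p where p: "awalk w p v" "\<forall>x\<in>set (awalk_verts w p). x = w \<or> hops x v < hops w v"
    using Suc by auto
  have "(u, w) \<in> parcs G" using hops_1 w Suc.prems by blast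
  then have "awalk u ((u, w) # p) v" using p by (simp add: awalk_Cons_iff)
  moreover have "\<forall>x\<in>set (awalk_verts u ((u, w) # p)). x = u \<or> hops x v < hops u v"
    using p(2) w(3) by auto
  ultimately show ?case by blast
qed

text \<open>Otherwise both neighbours descend to \<open>v\<close> without meeting \<open>u\<close>.
  Joining the two walks, shortening the result to a path from \<open>w\<close> to \<open>w'\<close>
  and closing it through \<open>u\<close> gives a cycle; as \<open>w\<close> and \<open>w'\<close>
  differ, it has at least three arcs.\<close>

lemma hops_unique:
  assumes acyc: "\<not> (\<exists>p. cycle p \<and> length p \<ge> 3)"
    and V: "u \<in> pverts G" "v \<in> pverts G" "w \<in> pverts G" "w' \<in> pverts G"
    and adj: "hops u w = 1" "hops u w' = 1" "w \<noteq> w'" and le: "hops w v \<le> hops u v"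
  shows "hops w' v = Suc (hops u v)"
proof (rule ccontr)
  assume ne: "hops w' v \<noteq> Suc (hops u v)"
  have w'u: "hops w' u = 1" using adj hops_sym V by simp
  then have le': "hops w' v \<le> hops u v" using ne hops_triangle[of w' u v] V by simp
  have arcs: "(u, w) \<in> parcs G" "(w', u) \<in> parcs G" using hops_1 adj w'u V by blast+
  have wu: "w \<noteq> u" "w' \<noteq> u" using adj hops_0[of u u] V by auto
  obtain p where p: "awalk w p v" "\<forall>x\<in>set (awalk_verts w p). x = w \<or> hops x v < hops w v"
    using descending_awalk V by blast
  obtain p' where p': "awalk w' p' v" "\<forall>x\<in>set (awalk_verts w' p'). x = w' \<or> hops x v < hops w' v"
    using descending_awalk V by blast
  have up: "u \<notin> set (awalk_verts w p)" "u \<notin> set (awalk_verts w' p')" using p p' le le' wu by auto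
  let ?q = "p @ rev_path p'"
  have r: "awalk v (rev_path p') w'" using p' by simp
  have q: "awalk w ?q w'" using awalk_appendI[OF p(1) r] .
  have "set (awalk_verts v (rev_path p')) = set (awalk_verts w' p')"
    using awalk_verts_rev_path[OF p'(1)] by simp
  then have uq: "u \<notin> set (awalk_verts w ?q)"
    using up set_awalk_verts_append[OF p(1) r] by auto
  let ?a = "awalk_to_apath ?q"
  have a: "apath w ?a w'" using apath_awalk_to_apath[OF q] .
  have aw: "awalk w ?a w'" using a by (simp add: apath_def)
  have "set ?a \<subseteq> set ?q" using awalk_to_apath_subset[OF q] .
  then have ua: "u \<notin> set (awalk_verts w ?a)"
    using uq set_awalk_verts[OF q] set_awalk_verts[OF aw] by auto
  let ?c = "(u, w) # ?a @ [(w', u)]"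
  have "awalk u ?c u" using aw arcs V by (auto simp: awalk_Cons_iff awalk_Nil_iff)
  moreover have "distinct (tl (awalk_verts u ?c))"
  proof -
    have "awalk w' [(w', u)] u" using arcs V by (simp add: awalk_Cons_iff awalk_Nil_iff)
    then have "awalk_verts w (?a @ [(w', u)]) = awalk_verts w ?a @ [u]"
      using awalk_verts_append[of w ?a "[(w', u)]" u] aw by (auto simp: awalk_appendI)
    then show ?thesis using a ua by (simp add: apath_def)
  qed
  moreover have "?a \<noteq> []" using aw adj(3) by (auto simp: awalk_Nil_iff)
  then have "length ?c \<ge> 3" by (cases ?a) auto
  ultimately show False using acyc unfolding cycle_def by blast
qed

lemma mu_hops:
  assumes "u \<in> pverts G" "v \<in> pverts G"
  shows "\<mu> (\<lambda>_. 1) u v = ereal (real (hops u v))"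
proof (rule antisym)
  have cost: "awalk_cost (\<lambda>_. 1) p = real (length p)" for p :: "('a \<times> 'a) list"
    by (induction p) auto
  obtain p where "awalk u p v" "length p = hops u v" using shortest_awalk assms by blast
  then show "\<mu> (\<lambda>_. 1) u v \<le> ereal (real (hops u v))" using min_cost_le_walk_cost[of u p v "\<lambda>_. 1"] cost by simp
  show "ereal (real (hops u v)) \<le> \<mu> (\<lambda>_. 1) u v"
    unfolding \<mu>_def by (rule INF_greatest) (use hops_le cost in auto)
qed

end

end

section \<open>Reasoning about RAM programs\<close>

primrec cst :: "com \<Rightarrow> nat" where
  "cst Skip = 1"
| "cst (SetIReg r e) = 1 + icost e"
| "cst (SetIMem b a e) = 1 + icost a + icost e"
| "cst (SetRReg r e) = 1 + rcost e"
| "cst (SetRMem b a e) = 1 + icost a + rcost e"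
| "cst (Seq c d) = cst c + cst d"
| "cst (If b c d) = 1 + tcost b + cst c + cst d"
| "cst (While b c) = 1 + tcost b + cst c"

text \<open>\<open>M\<close> bounds how often each construct of \<open>c\<close> is executed; with the syntactic factor \<open>cst c\<close> split off,
  one and the same \<open>M\<close> serves all parts of a program.\<close>

definition runs :: "com \<Rightarrow> nat \<Rightarrow> (ram_state \<Rightarrow> bool) \<Rightarrow> ram_state \<Rightarrow> bool" where
  "runs c M Q s \<longleftrightarrow> (\<exists>t s'. exec c s t s' \<and> t \<le> cst c * M \<and> Q s')"

primrec loopfree :: "com \<Rightarrow> bool" where
  "loopfree Skip \<longleftrightarrow> True"
| "loopfree (SetIReg r e) \<longleftrightarrow> True"
| "loopfree (SetIMem b a e) \<longleftrightarrow> True"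
| "loopfree (SetRReg r e) \<longleftrightarrow> True"
| "loopfree (SetRMem b a e) \<longleftrightarrow> True"
| "loopfree (Seq c d) \<longleftrightarrow> loopfree c \<and> loopfree d"
| "loopfree (If b c d) \<longleftrightarrow> loopfree c \<and> loopfree d"
| "loopfree (While b c) \<longleftrightarrow> False"

text \<open>A state transformer for straight-line code, so that such code is treated by rewriting
  instead of by inverting \<open>exec\<close>; the value at \<open>While\<close> is a
  default.\<close>

primrec sx :: "com \<Rightarrow> ram_state \<Rightarrow> ram_state" where
  "sx Skip s = s"
| "sx (SetIReg r e) s = s\<lparr>ireg := (ireg s)(r := ival e s)\<rparr>"
| "sx (SetIMem b a e) s = s\<lparr>imem := (imem s)(b := (imem s b)(ival a s := ival e s))\<rparr>"
| "sx (SetRReg r e) s = s\<lparr>rreg := (rreg s)(r := rval e s)\<rparr>"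
| "sx (SetRMem b a e) s = s\<lparr>rmem := (rmem s)(b := (rmem s b)(ival a s := rval e s))\<rparr>"
| "sx (Seq c d) s = sx d (sx c s)"
| "sx (If b c d) s = (if tval b s then sx c s else sx d s)"
| "sx (While b c) s = s"

lemma exec_sx: "loopfree c \<Longrightarrow> \<exists>t. exec c s t (sx c s) \<and> t \<le> cst c"
proof (induction c arbitrary: s)
  case (Seq c d)
  then obtain t u where "exec c s t (sx c s)" "t \<le> cst c"
    "exec d (sx c s) u (sx d (sx c s))" "u \<le> cst d" by fastforce
  then have "exec (Seq c d) s (t + u) (sx d (sx c s)) \<and> t + u \<le> cst (Seq c d)"
    by (auto intro: exec.Seq)
  then show ?case by auto
next
  case (If b c d)
  show ?case
  proof (cases "tval b s")
    case True
    obtain t where t: "exec c s t (sx c s)" "t \<le> cst c" using If by fastforce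
    have "exec (If b c d) s (1 + tcost b + t) (sx c s)" by (rule exec.IfTrue[OF True t(1)])
    then show ?thesis using t(2) True by (intro exI[of _ "1 + tcost b + t"]) simp
  next
    case False
    obtain t where t: "exec d s t (sx d s)" "t \<le> cst d" using If by fastforce
    have "exec (If b c d) s (1 + tcost b + t) (sx d s)" by (rule exec.IfFalse[OF False t(1)])
    then show ?thesis using t(2) False by (intro exI[of _ "1 + tcost b + t"]) simp
  qed
qed (auto intro: exec.intros)

lemma runs_sx:
  assumes "loopfree c" "1 \<le> M" "Q (sx c s)" shows "runs c M Q s"
proof -
  obtain t where t: "exec c s t (sx c s)" "t \<le> cst c" using exec_sx[OF assms(1)] by blast
  have "cst c * 1 \<le> cst c * M" using assms(2) by (intro mult_le_mono) auto
  then have "t \<le> cst c * M" using t(2) by linarith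
  then show ?thesis using t assms(3) unfolding runs_def by blast
qed

lemma runs_mono: "runs c M Q s \<Longrightarrow> M \<le> M' \<Longrightarrow> (\<And>s'. Q s' \<Longrightarrow> Q' s') \<Longrightarrow> runs c M' Q' s"
  unfolding runs_def by (meson le_trans mult_le_mono2)

lemma runs_Seq:
  assumes "runs c M (\<lambda>s'. runs d M Q s') s" shows "runs (Seq c d) M Q s"
proof -
  obtain t s' u s'' where "exec c s t s'" "t \<le> cst c * M" "exec d s' u s''" "u \<le> cst d * M" "Q s''"
    using assms unfolding runs_def by blast
  then have "exec (Seq c d) s (t + u) s'' \<and> t + u \<le> cst (Seq c d) * M \<and> Q s''"
    by (auto intro: exec.Seq simp: add_mult_distrib)
  then show ?thesis unfolding runs_def by blast
qed

lemma runs_If: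
  assumes "1 \<le> M" "tval b s \<Longrightarrow> runs c M Q s" "\<not> tval b s \<Longrightarrow> runs d M Q s"
  shows "runs (If b c d) M Q s"
proof -
  have one: "1 + tcost b \<le> (1 + tcost b) * M" using mult_le_mono2[OF assms(1), of "1 + tcost b"] by simp
  show ?thesis
  proof (cases "tval b s")
    case True
    then obtain t s' where t: "exec c s t s'" "t \<le> cst c * M" "Q s'" using assms unfolding runs_def by blast
    have "exec (If b c d) s (1 + tcost b + t) s'" by (rule exec.IfTrue[OF True t(1)])
    moreover have "1 + tcost b + t \<le> cst (If b c d) * M" using t(2) one by (simp add: algebra_simps)
    ultimately show ?thesis using t unfolding runs_def by blast
  next
    case False
    then obtain t s' where t: "exec d s t s'" "t \<le> cst d * M" "Q s'" using assms unfolding runs_def by blast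
    have "exec (If b c d) s (1 + tcost b + t) s'" by (rule exec.IfFalse[OF False t(1)])
    moreover have "1 + tcost b + t \<le> cst (If b c d) * M" using t(2) one by (simp add: algebra_simps)
    ultimately show ?thesis using t unfolding runs_def by blast
  qed
qed

primrec wir :: "com \<Rightarrow> nat set" where
  "wir Skip = {}" | "wir (SetIReg r e) = {r}" | "wir (SetIMem b a e) = {}" | "wir (SetRReg r e') = {}"
| "wir (SetRMem b a e') = {}" | "wir (Seq c d) = wir c \<union> wir d" | "wir (If b c d) = wir c \<union> wir d"
| "wir (While b c) = wir c"

primrec wim :: "com \<Rightarrow> nat set" where
  "wim Skip = {}" | "wim (SetIReg r e) = {}" | "wim (SetIMem b a e) = {b}" | "wim (SetRReg r e') = {}"
| "wim (SetRMem b a e') = {}" | "wim (Seq c d) = wim c \<union> wim d" | "wim (If b c d) = wim c \<union> wim d"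
| "wim (While b c) = wim c"

primrec wrr :: "com \<Rightarrow> nat set" where
  "wrr Skip = {}" | "wrr (SetIReg r e) = {}" | "wrr (SetIMem b a e) = {}" | "wrr (SetRReg r e') = {r}"
| "wrr (SetRMem b a e') = {}" | "wrr (Seq c d) = wrr c \<union> wrr d" | "wrr (If b c d) = wrr c \<union> wrr d"
| "wrr (While b c) = wrr c"

primrec wrm :: "com \<Rightarrow> nat set" where
  "wrm Skip = {}" | "wrm (SetIReg r e) = {}" | "wrm (SetIMem b a e) = {}" | "wrm (SetRReg r e') = {}"
| "wrm (SetRMem b a e') = {b}" | "wrm (Seq c d) = wrm c \<union> wrm d" | "wrm (If b c d) = wrm c \<union> wrm d"
| "wrm (While b c) = wrm c"

text \<open>The write sets are syntactic, so an invariant only has to mention the cells that its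
  loop writes; everything else is recovered by \<open>frameD\<close>.\<close>

definition frame :: "com \<Rightarrow> ram_state \<Rightarrow> ram_state \<Rightarrow> bool" where
  "frame c s s' \<longleftrightarrow> (\<forall>r. r \<notin> wir c \<longrightarrow> ireg s' r = ireg s r) \<and> (\<forall>b. b \<notin> wim c \<longrightarrow> imem s' b = imem s b) \<and>
     (\<forall>r. r \<notin> wrr c \<longrightarrow> rreg s' r = rreg s r) \<and> (\<forall>b. b \<notin> wrm c \<longrightarrow> rmem s' b = rmem s b)"

lemma frameD:
  assumes "frame c s s'"
  shows "r \<notin> wir c \<Longrightarrow> ireg s' r = ireg s r" "b \<notin> wim c \<Longrightarrow> imem s' b = imem s b"
    "r \<notin> wrr c \<Longrightarrow> rreg s' r = rreg s r" "b \<notin> wrm c \<Longrightarrow> rmem s' b = rmem s b"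
  using assms unfolding frame_def by blast+

lemma frame_refl [simp]: "frame c s s" by (simp add: frame_def)

lemma frame_trans: "frame c s s' \<Longrightarrow> frame c s' s'' \<Longrightarrow> frame c s s''"
  by (simp add: frame_def)

lemma frame_sub: "frame c s s' \<Longrightarrow> wir c \<subseteq> wir d \<Longrightarrow> wim c \<subseteq> wim d \<Longrightarrow> wrr c \<subseteq> wrr d \<Longrightarrow> wrm c \<subseteq> wrm d \<Longrightarrow> frame d s s'"
  unfolding frame_def by blast

lemma exec_frame: "exec c s t s' \<Longrightarrow> frame c s s'"
proof (induction rule: exec.induct)
  case (WhileTrue b s c t s' u s'')
  then have "frame (While b c) s s'" by (auto intro: frame_sub)
  then show ?case using WhileTrue frame_trans by blast
next
  case (Seq c s t s' d u s'')
  then have "frame (Seq c d) s s'" "frame (Seq c d) s' s''" by (auto intro: frame_sub)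
  then show ?case using frame_trans by blast
qed (auto intro: frame_sub simp: frame_def)

lemma frame_loopfree: "loopfree c \<Longrightarrow> frame c s (sx c s)"
  using exec_sx exec_frame by blast

lemma runs_frame: "runs c M Q s \<Longrightarrow> runs c M (\<lambda>s'. Q s' \<and> frame c s s') s"
  unfolding runs_def using exec_frame by blast

lemma runs_conseq:
  assumes "runs c M Q s" "M \<le> M'" "\<And>s'. Q s' \<Longrightarrow> frame c s s' \<Longrightarrow> Q' s'"
  shows "runs c M' Q' s"
  using runs_mono[OF runs_frame[OF assms(1)] assms(2)] assms(3) by blast

lemma runs_then:
  assumes "runs c M Q s" "M \<le> M'" "\<And>s'. Q s' \<Longrightarrow> frame c s s' \<Longrightarrow> runs d M' Q' s'"
  shows "runs (Seq c d) M' Q' s"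
  by (rule runs_Seq, rule runs_conseq[OF assms])

lemma runs_sx_then:
  assumes "loopfree c" "1 \<le> M" "runs d M Q (sx c s)"
  shows "runs (Seq c d) M Q s"
  by (rule runs_Seq, rule runs_sx[OF assms(1,2)]) (rule assms(3))

text \<open>Amortised analysis: a round with factor \<open>M\<close> must lower the potential by
  \<open>M\<close>. Since \<open>M \<ge> 1\<close>, the same amount pays for the test of the round;
  the extra 1 pays for the last, failing test.\<close>

lemma runs_While:
  fixes \<Phi> :: "ram_state \<Rightarrow> nat"
  assumes init: "I s0"
    and step: "\<And>s. I s \<Longrightarrow> frame (While b c) s0 s \<Longrightarrow> tval b s \<Longrightarrow>
      \<exists>M\<ge>1. runs c M (\<lambda>s'. I s' \<and> M + \<Phi> s' \<le> \<Phi> s) s"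
  shows "runs (While b c) (\<Phi> s0 + 1) (\<lambda>s'. I s' \<and> \<not> tval b s') s0"
proof -
  have "runs (While b c) (\<Phi> s + 1) (\<lambda>s'. I s' \<and> \<not> tval b s') s" if "I s" "frame (While b c) s0 s" for s
    using that
  proof (induction "\<Phi> s" arbitrary: s rule: less_induct)
    case less
    show ?case
    proof (cases "tval b s")
      case False
      have "exec (While b c) s (1 + tcost b) s" by (rule exec.WhileFalse[OF False])
      moreover have "1 + tcost b \<le> cst (While b c) * (\<Phi> s + 1)" by simp
      ultimately show ?thesis using False less unfolding runs_def by blast
    next
      case True
      obtain M where M: "M \<ge> 1" "runs c M (\<lambda>s'. I s' \<and> M + \<Phi> s' \<le> \<Phi> s) s"
        using step[OF less.prems True] by blast
      then obtain t s' where s': "exec c s t s'" "t \<le> cst c * M" "I s'" "M + \<Phi> s' \<le> \<Phi> s"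
        unfolding runs_def by blast
      have "frame (While b c) s s'" using exec_frame[OF s'(1)] by (auto intro: frame_sub)
      then have "frame (While b c) s0 s'" using frame_trans less.prems by blast
      moreover have "\<Phi> s' < \<Phi> s" using s' M by linarith
      ultimately obtain u s'' where u: "exec (While b c) s' u s''" "u \<le> cst (While b c) * (\<Phi> s' + 1)" "I s''" "\<not> tval b s''"
        using less.hyps[of s'] s' unfolding runs_def by blast
      have "1 + tcost b + t \<le> (1 + tcost b) * M + cst c * M"
        using s'(2) mult_le_mono2[OF M(1), of "1 + tcost b"] by simp
      also have "\<dots> = cst (While b c) * M" by (simp add: algebra_simps)
      finally have "1 + tcost b + t + u \<le> cst (While b c) * (M + (\<Phi> s' + 1))"
        using u(2) by (simp only: add_mult_distrib2)
      also have "\<dots> \<le> cst (While b c) * (\<Phi> s + 1)" using s'(4) by (intro mult_le_mono2) linarith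
      finally show ?thesis using exec.WhileTrue[OF True s'(1) u(1)] u unfolding runs_def by blast
    qed
  qed
  then show ?thesis using init by simp
qed

definition for_up :: "nat \<Rightarrow> iexp \<Rightarrow> iexp \<Rightarrow> com \<Rightarrow> com" where
  "for_up r a e c = Seq (SetIReg r a)
     (While (ILess (IReg r) e) (Seq c (SetIReg r (IAdd (IReg r) (INum 1)))))"

text \<open>The counter is lowered before the body, which therefore sees \<open>m - 1\<close> down
  to \<open>1\<close>. Index \<open>0\<close> is left out: it is the root in a pass over a search
  order, and in a scan it has no cell to its left.\<close>

definition for_down :: "nat \<Rightarrow> iexp \<Rightarrow> com \<Rightarrow> com" where
  "for_down r a c = Seq (SetIReg r a)
     (While (ILess (INum 1) (IReg r)) (Seq (SetIReg r (ISub (IReg r) (INum 1))) c))"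

lemma w_for [simp]:
  "wir (for_up r a e c) = insert r (wir c)" "wim (for_up r a e c) = wim c"
  "wrr (for_up r a e c) = wrr c" "wrm (for_up r a e c) = wrm c"
  "wir (for_down r a c) = insert r (wir c)" "wim (for_down r a c) = wim c"
  "wrr (for_down r a c) = wrr c" "wrm (for_down r a c) = wrm c"
  by (auto simp: for_up_def for_down_def)

lemma runs_for_up:
  fixes I :: "nat \<Rightarrow> ram_state \<Rightarrow> bool"
  assumes c: "loopfree c" "r \<notin> wir c"
    and k0: "ival a s0 = k0" "k0 \<le> m"
    and M: "m + 2 \<le> M + k0"
    and bound: "\<And>s. frame (for_up r a e c) s0 s \<Longrightarrow> ival e s = m"
    and init: "I k0 (s0\<lparr>ireg := (ireg s0)(r := k0)\<rparr>)"
    and step: "\<And>k s. k0 \<le> k \<Longrightarrow> k < m \<Longrightarrow> ireg s r = k \<Longrightarrow> I k s \<Longrightarrow> frame (for_up r a e c) s0 s \<Longrightarrow>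
      I (Suc k) ((sx c s)\<lparr>ireg := (ireg (sx c s))(r := Suc k)\<rparr>)"
  shows "runs (for_up r a e c) M (I m) s0"
proof -
  let ?s1 = "s0\<lparr>ireg := (ireg s0)(r := k0)\<rparr>"
  let ?c = "Seq c (SetIReg r (IAdd (IReg r) (INum 1)))"
  let ?W = "While (ILess (IReg r) e) ?c"
  let ?J = "\<lambda>s. k0 \<le> ireg s r \<and> ireg s r \<le> m \<and> I (ireg s r) s"
  have fr: "frame (for_up r a e c) s0 s" if "frame ?W ?s1 s" for s
    using that by (auto simp: frame_def)
  have "runs ?W ((m - ireg ?s1 r) + 1) (\<lambda>s'. ?J s' \<and> \<not> tval (ILess (IReg r) e) s') ?s1"
  proof (rule runs_While[where \<Phi> = "\<lambda>s. m - ireg s r"])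
    show "?J ?s1" using init k0 by simp
  next
    fix s assume J: "?J s" and f: "frame ?W ?s1 s" and t: "tval (ILess (IReg r) e) s"
    have lt: "ireg s r < m" using t bound[OF fr[OF f]] by simp
    have "ireg (sx c s) r = ireg s r" using frameD(1)[OF frame_loopfree[OF c(1)] c(2)] .
    then have "?J (sx ?c s) \<and> 1 + (m - ireg (sx ?c s) r) \<le> m - ireg s r"
      using step[OF _ lt refl _ fr[OF f]] J lt by simp
    then have "runs ?c 1 (\<lambda>s'. ?J s' \<and> 1 + (m - ireg s' r) \<le> m - ireg s r) s"
      by (intro runs_sx) (use c in simp_all)
    then show "\<exists>M\<ge>1. runs ?c M (\<lambda>s'. ?J s' \<and> M + (m - ireg s' r) \<le> m - ireg s r) s" by blast
  qed
  then have "runs ?W M (I m) ?s1"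
  proof (rule runs_conseq)
    show "m - ireg ?s1 r + 1 \<le> M" using M k0 by simp
    fix s assume "?J s \<and> \<not> tval (ILess (IReg r) e) s" "frame ?W ?s1 s"
    moreover then have "ival e s = m" using bound fr by blast
    ultimately show "I m s" using le_antisym by auto
  qed
  then show ?thesis unfolding for_up_def by (intro runs_sx_then) (use k0 M in simp_all)
qed

lemma runs_for_down:
  fixes I :: "nat \<Rightarrow> ram_state \<Rightarrow> bool"
  assumes c: "loopfree c" "r \<notin> wir c"
    and k0: "ival a s0 = m" "1 \<le> m"
    and M: "m \<le> M"
    and init: "I m (s0\<lparr>ireg := (ireg s0)(r := m)\<rparr>)"
    and step: "\<And>k s. 1 \<le> k \<Longrightarrow> k < m \<Longrightarrow> ireg s r = k \<Longrightarrow> I (Suc k) (s\<lparr>ireg := (ireg s)(r := Suc k)\<rparr>) \<Longrightarrow>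
      frame (for_down r a c) s0 s \<Longrightarrow> I k (sx c s)"
  shows "runs (for_down r a c) M (I 1) s0"
proof -
  let ?s1 = "s0\<lparr>ireg := (ireg s0)(r := m)\<rparr>"
  let ?c = "Seq (SetIReg r (ISub (IReg r) (INum 1))) c"
  let ?W = "While (ILess (INum 1) (IReg r)) ?c"
  let ?J = "\<lambda>s. 1 \<le> ireg s r \<and> ireg s r \<le> m \<and> I (ireg s r) s"
  have fr: "frame (for_down r a c) s0 s" if "frame ?W ?s1 s" for s
    using that by (auto simp: frame_def)
  have "runs ?W ((ireg ?s1 r - 1) + 1) (\<lambda>s'. ?J s' \<and> \<not> tval (ILess (INum 1) (IReg r)) s') ?s1"
  proof (rule runs_While[where \<Phi> = "\<lambda>s. ireg s r - 1"])
    show "?J ?s1" using init k0 by simp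
  next
    fix s assume J: "?J s" and f: "frame ?W ?s1 s" and t: "tval (ILess (INum 1) (IReg r)) s"
    let ?k = "ireg s r - 1" let ?s = "s\<lparr>ireg := (ireg s)(r := ?k)\<rparr>"
    have k: "1 \<le> ?k" "?k < m" "ireg s r = Suc ?k" using t J by auto
    have f': "frame (for_down r a c) s0 ?s" using fr[OF f] by (auto simp: frame_def)
    have "ireg (sx c ?s) r = ?k" using frameD(1)[OF frame_loopfree[OF c(1)] c(2), of ?s] by simp
    moreover have "I ?k (sx c ?s)"
    proof (rule step[OF k(1,2) _ _ f'])
      have "?s\<lparr>ireg := (ireg ?s)(r := Suc ?k)\<rparr> = s" using k(3) by (simp add: fun_upd_idem)
      then show "I (Suc ?k) (?s\<lparr>ireg := (ireg ?s)(r := Suc ?k)\<rparr>)" using J k(3) by simp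
    qed simp
    ultimately have "?J (sx ?c s) \<and> 1 + (ireg (sx ?c s) r - 1) \<le> ireg s r - 1" using k by simp
    then have "runs ?c 1 (\<lambda>s'. ?J s' \<and> 1 + (ireg s' r - 1) \<le> ireg s r - 1) s"
      by (intro runs_sx) (use c(1) in \<open>simp, simp, blast\<close>)
    then show "\<exists>M\<ge>1. runs ?c M (\<lambda>s'. ?J s' \<and> M + (ireg s' r - 1) \<le> ireg s r - 1) s" by blast
  qed
  then have "runs ?W M (I 1) ?s1"
  proof (rule runs_conseq)
    show "ireg ?s1 r - 1 + 1 \<le> M" using M k0 by simp
    fix s assume "?J s \<and> \<not> tval (ILess (INum 1) (IReg r)) s"
    then have "ireg s r = 1" "I (ireg s r) s" by auto
    then show "I 1 s" by metis
  qed
  then show ?thesis unfolding for_down_def by (intro runs_sx_then) (use k0 M in simp_all)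
qed

definition IEq :: "iexp \<Rightarrow> iexp \<Rightarrow> test" where
  "IEq e f = And (Not (ILess e f)) (Not (ILess f e))"

definition Or :: "test \<Rightarrow> test \<Rightarrow> test" where
  "Or b c = Not (And (Not b) (Not c))"

lemma tval_IEq [simp]: "tval (IEq e f) s \<longleftrightarrow> ival e s = ival f s"
  by (auto simp: IEq_def)

lemma tval_Or [simp]: "tval (Or b c) s \<longleftrightarrow> tval b s \<or> tval c s"
  by (simp add: Or_def)

fun block :: "com list \<Rightarrow> com" where
  "block [] = Skip"
| "block [c] = c"
| "block (c # cs) = Seq c (block cs)"

section \<open>Depth-first search\<close>

text \<open>
  Registers: \<open>rI\<close> is the loop index, \<open>rV\<close> the current vertex, \<open>rU\<close> its parent or a neighbour, \<open>rCnt\<close> the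
  number of visited vertices, \<open>rX\<close> the centroid, \<open>rC\<close> its territory. Banks, indexed by vertices unless
  noted: \<open>bD\<close>, \<open>bTe\<close> distance to and position of the nearest site; \<open>bPar\<close>, \<open>bDep\<close>, \<open>bOrd\<close> (by
  position) the last depth-first search; \<open>bStk\<close> its stack; \<open>bSk\<close> (by depth) the current search path;
  \<open>bHp\<close> the first vertex in the second half of the path from the root; \<open>bHf\<close> a table of \<open>i div 2\<close>;
  \<open>bRem\<close> removed centroids; \<open>bDone\<close> (by territory) finished territories; \<open>bWl\<close> the roots of the
  pending components; \<open>bBr\<close>, \<open>bBz\<close>, \<open>bBase\<close> branch at the centroid, its size and its segment in
  \<open>mOwn\<close>; \<open>bBi\<close>, \<open>mBest\<close>, \<open>mNext\<close>, \<open>mTotal\<close> and \<open>mOwn\<close> buckets. \<open>mGain\<close> and \<open>mRest\<close> accumulate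
  the two halves of the objective, \<open>mAcc\<close> holds subtree weights.
\<close>

abbreviation (input) rN :: nat where "rN \<equiv> 0"
abbreviation (input) rP :: nat where "rP \<equiv> 1"
abbreviation (input) rI :: nat where "rI \<equiv> 2"
abbreviation (input) rV :: nat where "rV \<equiv> 3"
abbreviation (input) rU :: nat where "rU \<equiv> 4"
abbreviation (input) rE :: nat where "rE \<equiv> 5"
abbreviation (input) rCnt :: nat where "rCnt \<equiv> 7"
abbreviation (input) rSp :: nat where "rSp \<equiv> 8"
abbreviation (input) rRoot :: nat where "rRoot \<equiv> 9"
abbreviation (input) rWp :: nat where "rWp \<equiv> 10"
abbreviation (input) rX :: nat where "rX \<equiv> 11"
abbreviation (input) rC :: nat where "rC \<equiv> 12"
abbreviation (input) rK :: nat where "rK \<equiv> 13"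
abbreviation (input) bOff :: nat where "bOff \<equiv> 0"
abbreviation (input) bAdj :: nat where "bAdj \<equiv> 1"
abbreviation (input) bS :: nat where "bS \<equiv> 2"
abbreviation (input) bD :: nat where "bD \<equiv> 3"
abbreviation (input) bTe :: nat where "bTe \<equiv> 4"
abbreviation (input) bPar :: nat where "bPar \<equiv> 5"
abbreviation (input) bDep :: nat where "bDep \<equiv> 6"
abbreviation (input) bOrd :: nat where "bOrd \<equiv> 7"
abbreviation (input) bStk :: nat where "bStk \<equiv> 8"
abbreviation (input) bSk :: nat where "bSk \<equiv> 9"
abbreviation (input) bHp :: nat where "bHp \<equiv> 10"
abbreviation (input) bHf :: nat where "bHf \<equiv> 11"
abbreviation (input) bRem :: nat where "bRem \<equiv> 12"
abbreviation (input) bDone :: nat where "bDone \<equiv> 13"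
abbreviation (input) bWl :: nat where "bWl \<equiv> 14"
abbreviation (input) bBr :: nat where "bBr \<equiv> 15"
abbreviation (input) bBz :: nat where "bBz \<equiv> 16"
abbreviation (input) bBase :: nat where "bBase \<equiv> 17"
abbreviation (input) bBi :: nat where "bBi \<equiv> 18"
abbreviation (input) mPi :: nat where "mPi \<equiv> 0"
abbreviation (input) mGain :: nat where "mGain \<equiv> 2"
abbreviation (input) mRest :: nat where "mRest \<equiv> 3"
abbreviation (input) mAcc :: nat where "mAcc \<equiv> 4"
abbreviation (input) mTotal :: nat where "mTotal \<equiv> 5"
abbreviation (input) mOwn :: nat where "mOwn \<equiv> 6"
abbreviation (input) mBest :: nat where "mBest \<equiv> 7"
abbreviation (input) mNext :: nat where "mNext \<equiv> 8"

abbreviation (input) "ix b r \<equiv> IMem b (IReg r)"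

text \<open>All children are pushed at once. Depths do not decrease towards the top of the stack, hence below the depth
  of the popped vertex \<open>bSk\<close> holds the path leading to it.\<close>

definition dfs_visit :: com where
  "dfs_visit = block
    [SetIReg rSp (ISub (IReg rSp) (INum 1)),
     SetIReg rV (ix bStk rSp),
     SetIMem bOrd (IReg rCnt) (IReg rV),
     SetIReg rCnt (IAdd (IReg rCnt) (INum 1)),
     SetIMem bSk (ix bDep rV) (IReg rV),
     SetIMem bHp (IReg rV) (IMem bSk (IAdd (IMem bHf (ix bDep rV)) (INum 1)))]"

text \<open>The parent test replaces visited marks: in a tree a neighbour other than the parent has
  not been reached before.\<close>

definition dfs_edge :: com where
  "dfs_edge = Seq (SetIReg rU (ix bAdj rE))
    (If (And (Not (IEq (IReg rU) (ix bPar rV))) (IEq (ix bRem rU) (INum 0)))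
      (block
        [SetIMem bPar (IReg rU) (IReg rV),
         SetIMem bDep (IReg rU) (IAdd (ix bDep rV) (INum 1)),
         SetIMem bStk (IReg rSp) (IReg rU),
         SetIReg rSp (IAdd (IReg rSp) (INum 1))])
      Skip)"

text \<open>The root gets the parent \<open>n\<close>, which is no vertex, so that the parent test
  lets all its neighbours pass.\<close>

definition dfs_init :: com where
  "dfs_init = block
    [SetIMem bPar (IReg rRoot) (IReg rN),
     SetIMem bDep (IReg rRoot) (INum 0),
     SetIMem bStk (INum 0) (IReg rRoot),
     SetIReg rSp (INum 1),
     SetIReg rCnt (INum 0)]"

definition dfs :: com where
  "dfs = Seq dfs_init (While (ILess (INum 0) (IReg rSp)) (Seq dfs_visit
     (for_up rE (ix bOff rV) (IMem bOff (IAdd (IReg rV) (INum 1))) dfs_edge)))"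

lemma w_dfs [simp]:
  "wir dfs = {rV, rU, rE, rCnt, rSp}" "wim dfs = {bPar, bDep, bOrd, bStk, bSk, bHp}"
  "wrr dfs = {}" "wrm dfs = {}"
  by (auto simp: dfs_def dfs_init_def dfs_visit_def dfs_edge_def)

locale ram_instance = voronoi "{..<n}" d S \<pi> for n :: nat and d and S :: "nat list" and \<pi> +
  fixes adj :: "nat list list"
  assumes length_adj: "length adj = n"
    and adj_distinct: "v < n \<Longrightarrow> distinct (adj ! v)"
    and set_adj: "v < n \<Longrightarrow> set (adj ! v) = {w. w < n \<and> d v w = 1}"
begin

definition off :: "nat \<Rightarrow> nat" where
  "off v = length (concat (take v adj))"

lemma off_Suc: "v < n \<Longrightarrow> off (Suc v) = off v + length (adj ! v)"
  by (simp add: off_def take_Suc_conv_app_nth length_adj)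

lemma cells_offsets: "v \<le> n \<Longrightarrow> cells (offsets adj) v = off v"
  by (simp add: cells_def offsets_def off_def length_adj del: upt_Suc)

lemma cells_adj:
  assumes "v < n" "i < length (adj ! v)"
  shows "cells (concat adj) (off v + i) = adj ! v ! i"
proof -
  have "concat adj = concat (take v adj) @ adj ! v @ concat (drop (Suc v) adj)"
    using assms(1) length_adj by (metis concat.simps(2) concat_append id_take_nth_drop)
  then show ?thesis using assms(2) by (simp add: cells_def off_def nth_append)
qed

definition input :: "ram_state \<Rightarrow> bool" where
  "input s \<longleftrightarrow> ireg s rN = n \<and> ireg s rP = p \<and> imem s bOff = cells (offsets adj) \<and>
     imem s bAdj = cells (concat adj) \<and> imem s bS = cells S \<and> rmem s mPi = cells (map \<pi> [0..<n])"

definition half_table :: "ram_state \<Rightarrow> bool" where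
  "half_table s \<longleftrightarrow> (\<forall>i\<le>n. imem s bHf i = i div 2)"

definition removed :: "nat set \<Rightarrow> ram_state \<Rightarrow> bool" where
  "removed X s \<longleftrightarrow> X \<subseteq> {..<n} \<and> (\<forall>v<n. imem s bRem v = (if v \<in> X then 1 else 0))"

text \<open>Cost measure of a component. Per vertex, 2 units beyond the adjacency length bound the
  edge loop, and the third leaves room for the outer loop. In a nonempty component the 3 per vertex
  also cover the factor \<open>length L + 2\<close> of a pass over the order.\<close>

definition vol :: "nat set \<Rightarrow> nat" where
  "vol A = (\<Sum>v\<in>A. length (adj ! v) + 3)"

text \<open>\<open>L\<close> holds the visited vertices in order, \<open>K\<close> the stack with
  its top at the end, \<open>P\<close> the arcs of the current vertex still to be scanned. The
  clause on \<open>bSk\<close> serves all stacked vertices at once; because \<open>K\<close> is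
  sorted by depth, overwriting the entry at the depth of the popped vertex leaves the shorter
  prefixes of the others intact.\<close>

definition dfs_inv :: "nat \<Rightarrow> nat set \<Rightarrow> nat list \<Rightarrow> nat list \<Rightarrow> (nat \<times> nat) set \<Rightarrow> ram_state \<Rightarrow> bool" where
  "dfs_inv r X L K P s \<longleftrightarrow>
     ireg s rCnt = length L \<and> ireg s rSp = length K \<and>
     (\<forall>i<length L. imem s bOrd i = L ! i) \<and> (\<forall>i<length K. imem s bStk i = K ! i) \<and>
     distinct (L @ K) \<and> set (L @ K) \<subseteq> comp X r \<and> r \<in> set (L @ K) \<and>
     (\<forall>v\<in>set (L @ K). imem s bDep v = d r v \<and> imem s bPar v = (if v = r then n else nx v r)) \<and>
     (\<forall>u\<in>set K. u \<noteq> r \<longrightarrow> nx u r \<in> set L) \<and>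
     (\<forall>i<length L. L ! i \<noteq> r \<longrightarrow> nx (L ! i) r \<in> set (take i L)) \<and>
     (\<forall>u\<in>set L. \<forall>w\<in>comp X r. d u w = 1 \<longrightarrow> w \<in> set (L @ K) \<or> (u, w) \<in> P) \<and>
     (\<forall>v\<in>set L. v \<noteq> r \<longrightarrow> btw r (imem s bHp v) v \<and> d r (imem s bHp v) = Suc (d r v div 2)) \<and>
     (\<forall>u\<in>set K. \<forall>k<d r u. btw r (imem s bSk k) u \<and> d r (imem s bSk k) = k) \<and>
     sorted (map (d r) K)"

definition dfs_out :: "nat \<Rightarrow> nat set \<Rightarrow> nat list \<Rightarrow> ram_state \<Rightarrow> bool" where
  "dfs_out r X L s \<longleftrightarrow>
     ireg s rCnt = length L \<and> (\<forall>i<length L. imem s bOrd i = L ! i) \<and>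
     distinct L \<and> set L = comp X r \<and>
     (\<forall>v\<in>set L. imem s bDep v = d r v \<and> imem s bPar v = (if v = r then n else nx v r)) \<and>
     (\<forall>i<length L. L ! i \<noteq> r \<longrightarrow> nx (L ! i) r \<in> set (take i L)) \<and>
     (\<forall>v\<in>set L. v \<noteq> r \<longrightarrow> btw r (imem s bHp v) v \<and> d r (imem s bHp v) = Suc (d r v div 2))"

lemma child:
  assumes "r < n" "v \<in> comp X r" "w < n" "d v w = 1" "v \<noteq> r \<Longrightarrow> w \<noteq> nx v r"
  shows "d r w = Suc (d r v)" "nx w r = v" "w \<noteq> r" "btw r v w" "w \<notin> X \<Longrightarrow> w \<in> comp X r"
proof -
  have v: "v < n" using assms comp_sub by auto
  have "d w r = Suc (d v r)" by (rule step_away) (use assms v in auto)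
  then show dw: "d r w = Suc (d r v)" using d_sym assms v by simp
  then show wr: "w \<noteq> r" using assms by auto
  have wv: "d w v = 1" using assms(4) d_sym assms v by simp
  have "d v r \<le> d w r" using \<open>d w r = Suc (d v r)\<close> by simp
  then show nx: "nx w r = v" using nx_unique[of w r v] wv wr assms v by simp
  show b: "btw r v w" using dw assms v by (simp add: btw_def)
  show "w \<in> comp X r" if "w \<notin> X"
  proof -
    have False if y: "y \<in> X" "btw r y w" for y
    proof -
      have yV: "y < n" using y btwD by auto
      have "d y w \<noteq> 0" using y(1) \<open>w \<notin> X\<close> d_0[of y w] yV assms by auto
      then have "d r y \<le> d r v" using y dw unfolding btw_def by linarith
      then have "btw r y v" using btw_linear[OF y(2) b] by blast
      then show False using assms(2) y(1) unfolding comp_def by blast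
    qed
    then show ?thesis using assms unfolding comp_def by auto
  qed
qed

lemma dfs_edge_step:
  assumes inv: "dfs_inv r X L K P s" and rem: "removed X s" and r: "r < n"
    and v: "v \<in> set L" "ireg s rV = v" and w: "w < n" "d v w = 1" and e: "imem s bAdj (ireg s rE) = w"
    and new: "w \<in> set (L @ K) \<Longrightarrow> w \<noteq> r \<Longrightarrow> nx w r \<noteq> v"
    and top: "\<And>u. u \<in> set K \<Longrightarrow> d r u \<le> Suc (d r v)"
    and sk: "\<And>k. k \<le> d r v \<Longrightarrow> btw r (imem s bSk k) v \<and> d r (imem s bSk k) = k"
  shows "\<exists>K'. dfs_inv r X L K' (P - {(v, w)}) (sx dfs_edge s) \<and>
      (K' = K \<or> K' = K @ [w] \<and> d r w = Suc (d r v))"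
proof -
  have vA: "v \<in> comp X r" using inv v by (auto simp: dfs_inv_def)
  have vn: "v < n" using vA comp_sub by auto
  have par: "imem s bPar v = (if v = r then n else nx v r)" and dep: "imem s bDep v = d r v"
    using inv v by (auto simp: dfs_inv_def)
  have rw: "imem s bRem w = (if w \<in> X then 1 else 0)" using rem w by (auto simp: removed_def)
  show ?thesis
  proof (cases "w = imem s bPar v \<or> w \<in> X")
    case True
    have "sx dfs_edge s = s\<lparr>ireg := (ireg s)(rU := w)\<rparr>"
      using True rw v e by (auto simp: dfs_edge_def)
    \<comment> \<open>The only neighbour that is skipped without being removed is the parent, which
      the invariant already places in \<open>L\<close>.\<close>
    moreover have "w \<in> set (L @ K)" if "w \<in> comp X r"
    proof -
      have "w \<notin> X" using comp_notin that r by auto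
      then have "v \<noteq> r" "w = nx v r" using True par w by (auto split: if_splits)
      then show ?thesis using inv v unfolding dfs_inv_def
        by (metis (no_types, lifting) UnI1 in_set_conv_nth in_set_takeD set_append)
    qed
    ultimately have "dfs_inv r X L K (P - {(v, w)}) (sx dfs_edge s)"
      using inv unfolding dfs_inv_def by auto
    then show ?thesis by blast
  next
    case False
    have ne: "w \<noteq> nx v r" if "v \<noteq> r" using False par that by simp
    have ch: "d r w = Suc (d r v)" "nx w r = v" "w \<noteq> r" "btw r v w" "w \<in> comp X r"
      using child[OF r vA w(1,2) ne] False by blast+
    have nw: "w \<notin> set (L @ K)" using new ch by blast
    have s': "sx dfs_edge s = s\<lparr>ireg := (ireg s)(rU := w, rSp := Suc (ireg s rSp)),
      imem := (imem s)(bPar := (imem s bPar)(w := v), bDep := (imem s bDep)(w := Suc (d r v)),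
        bStk := (imem s bStk)(ireg s rSp := w))\<rparr>"
      using False rw v e dep by (auto simp: dfs_edge_def fun_upd_twist)
    have 1: "\<forall>k<d r w. btw r (imem s bSk k) w \<and> d r (imem s bSk k) = k"
    proof (intro allI impI)
      fix k assume "k < d r w"
      then have k: "btw r (imem s bSk k) v \<and> d r (imem s bSk k) = k" using sk ch by simp
      then show "btw r (imem s bSk k) w \<and> d r (imem s bSk k) = k"
        using btw_trans1(1)[OF _ ch(4)] by blast
    qed
    have "dfs_inv r X L (K @ [w]) (P - {(v, w)}) (sx dfs_edge s)"
      using inv nw ch v(1) top 1 unfolding dfs_inv_def s'
      by (auto simp: nth_append sorted_append less_Suc_eq)
    then show ?thesis using ch by blast
  qed
qed

lemma path_vertex: "u < n \<Longrightarrow> v < n \<Longrightarrow> k \<le> d u v \<Longrightarrow> \<exists>w. btw u w v \<and> d u w = k"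
proof (induction "d u v" arbitrary: v)
  case 0
  then show ?case by (intro exI[of _ u]) simp
next
  case (Suc m)
  show ?case
  proof (cases "k = d u v")
    case True
    then show ?thesis using Suc.prems by (intro exI[of _ v]) simp
  next
    case False
    have ne: "v \<noteq> u" using Suc by auto
    let ?y = "nx v u"
    have y: "?y < n" "d v ?y = 1" "d v u = Suc (d ?y u)" using nx[of v u] ne Suc.prems by auto
    have s: "d v u = d u v" "d ?y u = d u ?y" "d v ?y = d ?y v" using d_sym Suc.prems y by auto
    obtain w where w: "btw u w ?y" "d u w = k"
      using Suc.hyps(1)[of ?y] Suc.hyps(2) Suc.prems y s False by auto
    have "btw u ?y v" using y s Suc.prems by (simp add: btw_def)
    then show ?thesis using btw_trans1(1)[OF w(1)] w by blast
  qed
qed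

text \<open>A path realises every distance up to \<open>d u v\<close>, by different vertices. Hence
  a table of halves up to \<open>n\<close> covers all depths.\<close>

lemma d_less: assumes "u < n" "v < n" shows "d u v < n"
proof -
  have "{..d u v} \<subseteq> d u ` {..<n}"
  proof
    fix k assume "k \<in> {..d u v}"
    then obtain w where "btw u w v" "d u w = k" using path_vertex[OF assms] by auto
    then show "k \<in> d u ` {..<n}" using btwD by blast
  qed
  then have "card {..d u v} \<le> card {..<n}" using surj_card_le by blast
  then show ?thesis by simp
qed

lemma dfs_visit_step:
  assumes inv: "dfs_inv r X L (K @ [v]) {} s" and half: "half_table s" and r: "r < n"
  shows "dfs_inv r X (L @ [v]) K ({v} \<times> set (adj ! v)) (sx dfs_visit s)"
    and "ireg (sx dfs_visit s) rV = v"
    and "\<And>k. k \<le> d r v \<Longrightarrow> btw r (imem (sx dfs_visit s) bSk k) v \<and> d r (imem (sx dfs_visit s) bSk k) = k"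
    and "\<And>u. u \<in> set K \<Longrightarrow> d r u \<le> d r v"
    and "\<And>u. u \<in> set (L @ [v] @ K) \<Longrightarrow> u \<noteq> r \<Longrightarrow> nx u r \<noteq> v"
proof -
  have vA: "v \<in> comp X r" and v: "imem s bDep v = d r v" and sp: "imem s bStk (length K) = v"
    "ireg s rSp = Suc (length K)"
    using inv by (auto simp: dfs_inv_def nth_append)
  have vn: "v < n" using vA comp_sub by auto
  have hf: "imem s bHf (d r v) = d r v div 2" using half d_less[OF r vn] by (simp add: half_table_def)
  let ?s = "sx dfs_visit s"
  let ?sk = "(imem s bSk)(d r v := v)"
  have s': "?s = s\<lparr>ireg := (ireg s)(rSp := length K, rV := v, rCnt := Suc (ireg s rCnt)),
     imem := (imem s)(bOrd := (imem s bOrd)(ireg s rCnt := v), bSk := ?sk,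
       bHp := (imem s bHp)(v := ?sk (Suc (d r v div 2))))\<rparr>"
    using sp v hf by (auto simp: dfs_visit_def fun_upd_twist)
  show "ireg ?s rV = v" by (simp add: s')
  have sk: "btw r (?sk k) v \<and> d r (?sk k) = k" if "k \<le> d r v" for k
    using inv that r vn by (cases "k = d r v") (auto simp: dfs_inv_def)
  then show "btw r (imem ?s bSk k) v \<and> d r (imem ?s bSk k) = k" if "k \<le> d r v" for k
    using that by (simp add: s')
  show K: "d r u \<le> d r v" if "u \<in> set K" for u
    using inv that by (auto simp: dfs_inv_def sorted_append)
  have parL: "nx u r \<in> set L" if "u \<in> set (L @ [v] @ K)" "u \<noteq> r" for u
  proof (cases "u \<in> set L")
    case True
    then obtain i where "i < length L" "u = L ! i" by (metis in_set_conv_nth)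
    then show ?thesis using inv that(2) in_set_takeD unfolding dfs_inv_def by fast
  next
    case False
    then show ?thesis using inv that unfolding dfs_inv_def by auto
  qed
  have vL: "v \<notin> set L" using inv by (auto simp: dfs_inv_def)
  then show "nx u r \<noteq> v" if "u \<in> set (L @ [v] @ K)" "u \<noteq> r" for u
    using parL that by metis
  \<comment> \<open>At the root, position 1 is past the end of the path, so the entry of
    \<open>bHp\<close> there carries no meaning; this is why the accumulated totals later exempt
    sites.\<close>
  have hp: "btw r (?sk (Suc (d r v div 2))) v \<and> d r (?sk (Suc (d r v div 2))) = Suc (d r v div 2)"
    if "v \<noteq> r"
  proof -
    have "d r v \<noteq> 0" using that d_0[of r v] r vn by auto
    then have "Suc (d r v div 2) \<le> d r v" by linarith
    then show ?thesis using sk by blast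
  qed
  have K_sk: "btw r (?sk k) u \<and> d r (?sk k) = k" if "u \<in> set K" "k < d r u" for u k
    using inv that K[OF that(1)] unfolding dfs_inv_def by auto
  have pv: "\<forall>i<length (L @ [v]). (L @ [v]) ! i \<noteq> r \<longrightarrow> nx ((L @ [v]) ! i) r \<in> set (take i (L @ [v]))"
    using inv parL[of v] unfolding dfs_inv_def by (auto simp: nth_append less_Suc_eq)
  have cl: "\<forall>u\<in>set (L @ [v]). \<forall>w\<in>comp X r. d u w = 1 \<longrightarrow>
      w \<in> set ((L @ [v]) @ K) \<or> (u, w) \<in> {v} \<times> set (adj ! v)"
  proof (intro ballI impI)
    fix u w assume *: "u \<in> set (L @ [v])" "w \<in> comp X r" "d u w = 1"
    have "w < n" using * comp_sub by auto
    show "w \<in> set ((L @ [v]) @ K) \<or> (u, w) \<in> {v} \<times> set (adj ! v)"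
    proof (cases "u = v")
      case True
      then show ?thesis using * \<open>w < n\<close> set_adj[OF vn] by auto
    next
      case False
      then have "u \<in> set L" using * by auto
      then show ?thesis using inv * unfolding dfs_inv_def by auto
    qed
  qed
  show "dfs_inv r X (L @ [v]) K ({v} \<times> set (adj ! v)) ?s"
    unfolding dfs_inv_def
  proof (intro conjI)
    show "\<forall>u\<in>set (L @ [v]). u \<noteq> r \<longrightarrow> btw r (imem ?s bHp u) u \<and> d r (imem ?s bHp u) = Suc (d r u div 2)"
      using inv hp vL unfolding dfs_inv_def s' by auto
    show "\<forall>u\<in>set K. \<forall>k<d r u. btw r (imem ?s bSk k) u \<and> d r (imem ?s bSk k) = k"
      using K_sk unfolding s' by simp
    show "\<forall>u\<in>set K. u \<noteq> r \<longrightarrow> nx u r \<in> set (L @ [v])" using parL by auto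
  qed (use inv pv cl in \<open>auto simp: dfs_inv_def s' nth_append sorted_append less_Suc_eq\<close>)
qed

lemma dfs_edges:
  assumes inv: "dfs_inv r X (L @ [v]) K ({v} \<times> set (adj ! v)) s" and inp: "input s" and rem: "removed X s"
    and r: "r < n" and V: "ireg s rV = v"
    and sk: "\<And>k. k \<le> d r v \<Longrightarrow> btw r (imem s bSk k) v \<and> d r (imem s bSk k) = k"
    and top: "\<And>u. u \<in> set K \<Longrightarrow> d r u \<le> d r v"
    and new: "\<And>u. u \<in> set (L @ [v] @ K) \<Longrightarrow> u \<noteq> r \<Longrightarrow> nx u r \<noteq> v"
  shows "runs (for_up rE (ix bOff rV) (IMem bOff (IAdd (IReg rV) (INum 1))) dfs_edge)
    (length (adj ! v) + 2) (\<lambda>s'. \<exists>K'. dfs_inv r X (L @ [v]) K' {} s') s" (is "runs ?c _ _ _")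
proof -
  have vn: "v < n" using inv comp_sub by (auto simp: dfs_inv_def)
  have off: "imem s bOff v = off v" "imem s bOff (Suc v) = off v + length (adj ! v)"
    using inp vn cells_offsets off_Suc by (auto simp: input_def)
  \<comment> \<open>The last clause confines the children of \<open>v\<close> found so far to the
    scanned part of its adjacency list; the list being distinct, the next entry cannot be among
    them.\<close>
  let ?I = "\<lambda>k s. \<exists>K'. dfs_inv r X (L @ [v]) K' ({v} \<times> set (drop (k - off v) (adj ! v))) s \<and>
     (\<forall>u\<in>set K'. d r u \<le> Suc (d r v)) \<and>
     (\<forall>u\<in>set ((L @ [v]) @ K'). u \<noteq> r \<longrightarrow> nx u r = v \<longrightarrow> u \<in> set (take (k - off v) (adj ! v)))"
  have "runs ?c (length (adj ! v) + 2) (?I (off v + length (adj ! v))) s"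
  proof (rule runs_for_up[where ?k0.0 = "off v" and I = ?I and m = "off v + length (adj ! v)"])
    fix s1 assume f: "frame ?c s s1"
    show "ival (IMem bOff (IAdd (IReg rV) (INum 1))) s1 = off v + length (adj ! v)"
      using off V by (simp add: frameD[OF f] dfs_edge_def)
  next
    show "?I (off v) (s\<lparr>ireg := (ireg s)(rE := off v)\<rparr>)"
    proof (intro exI[of _ K] conjI)
      show "dfs_inv r X (L @ [v]) K ({v} \<times> set (drop (off v - off v) (adj ! v)))
          (s\<lparr>ireg := (ireg s)(rE := off v)\<rparr>)"
        using inv by (simp add: dfs_inv_def)
      show "\<forall>u\<in>set K. d r u \<le> Suc (d r v)" using top le_SucI by blast
      show "\<forall>u\<in>set ((L @ [v]) @ K). u \<noteq> r \<longrightarrow> nx u r = v \<longrightarrow> u \<in> set (take (off v - off v) (adj ! v))"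
        using new by simp
    qed
  next
    fix k s1 assume k: "off v \<le> k" "k < off v + length (adj ! v)" "ireg s1 rE = k"
      and I: "?I k s1" and f: "frame ?c s s1"
    define i where "i = k - off v"
    have i: "i < length (adj ! v)" "k = off v + i" using k by (auto simp: i_def)
    define w where "w = adj ! v ! i"
    have w: "w < n" "d v w = 1" using set_adj[OF vn] i nth_mem unfolding w_def by blast+
    obtain K' where K': "dfs_inv r X (L @ [v]) K' ({v} \<times> set (drop i (adj ! v))) s1"
      "\<forall>u\<in>set K'. d r u \<le> Suc (d r v)"
      "\<forall>u\<in>set ((L @ [v]) @ K'). u \<noteq> r \<longrightarrow> nx u r = v \<longrightarrow> u \<in> set (take i (adj ! v))"
      using I i_def by blast
    have adjw: "imem s1 bAdj (ireg s1 rE) = w"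
      using inp cells_adj[OF vn i(1)] i k(3) by (simp add: frameD[OF f] dfs_edge_def input_def w_def)
    have wt: "w \<notin> set (take i (adj ! v))"
      using adj_distinct[OF vn] i(1) unfolding w_def by (metis distinct_take id_take_nth_drop not_distinct_conv_prefix append_take_drop_id take_Suc_conv_app_nth)
    have step: "\<exists>K''. dfs_inv r X (L @ [v]) K'' ({v} \<times> set (drop i (adj ! v)) - {(v, w)}) (sx dfs_edge s1) \<and>
      (K'' = K' \<or> K'' = K' @ [w] \<and> d r w = Suc (d r v))"
    proof (rule dfs_edge_step[OF K'(1) _ r _ _ w adjw])
      show "removed X s1" using rem by (simp add: removed_def frameD[OF f] dfs_edge_def)
      show "ireg s1 rV = v" using V by (simp add: frameD[OF f] dfs_edge_def)
      show "nx w r \<noteq> v" if "w \<in> set ((L @ [v]) @ K')" "w \<noteq> r" using K'(3) that wt by blast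
      show "btw r (imem s1 bSk k) v \<and> d r (imem s1 bSk k) = k" if "k \<le> d r v" for k
        using sk[OF that] by (simp add: frameD[OF f] dfs_edge_def)
    qed (use K' in auto)
    then obtain K'' where K'': "dfs_inv r X (L @ [v]) K'' ({v} \<times> set (drop i (adj ! v)) - {(v, w)}) (sx dfs_edge s1)"
      "K'' = K' \<or> K'' = K' @ [w] \<and> d r w = Suc (d r v)" by blast
    have dr: "set (drop i (adj ! v)) = insert w (set (drop (Suc i) (adj ! v)))"
      using i(1) unfolding w_def by (metis Cons_nth_drop_Suc list.simps(15))
    have tk: "set (take (Suc i) (adj ! v)) = insert w (set (take i (adj ! v)))"
      using i(1) unfolding w_def by (simp add: take_Suc_conv_app_nth)
    have wd: "w \<notin> set (drop (Suc i) (adj ! v))"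
      using adj_distinct[OF vn] i(1) unfolding w_def by (metis Cons_nth_drop_Suc distinct.simps(2) distinct_drop)
    have P: "{v} \<times> set (drop i (adj ! v)) - {(v, w)} = {v} \<times> set (drop (Suc i) (adj ! v))"
      using dr wd by auto
    have Suc: "Suc k - off v = Suc i" using i by simp
    let ?s2 = "(sx dfs_edge s1)\<lparr>ireg := (ireg (sx dfs_edge s1))(rE := Suc k)\<rparr>"
    have "dfs_inv r X (L @ [v]) K'' ({v} \<times> set (drop (Suc i) (adj ! v))) ?s2"
      using K''(1) unfolding P by (simp add: dfs_inv_def)
    then show "?I (Suc k) ?s2" unfolding Suc tk using K'(2,3) K''(2) by (intro exI[of _ K'']) auto
  qed (use off V in \<open>auto simp: dfs_edge_def\<close>)
  then show ?thesis
    by (rule runs_mono) auto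
qed

lemma input_frame:
  assumes "input s" "frame c s s'" "wir c \<inter> {rN, rP} = {}" "wim c \<inter> {bOff, bAdj, bS} = {}" "wrm c \<inter> {mPi} = {}"
  shows "input s'"
  using assms unfolding input_def frame_def by auto

lemma half_table_frame: "half_table s \<Longrightarrow> frame c s s' \<Longrightarrow> wim c \<inter> {bHf} = {} \<Longrightarrow> half_table s'"
  unfolding half_table_def frame_def by auto

lemma removed_frame: "removed X s \<Longrightarrow> frame c s s' \<Longrightarrow> wim c \<inter> {bRem} = {} \<Longrightarrow> removed X s'"
  unfolding removed_def frame_def by auto

lemma vol_ge_card: "3 * card A \<le> vol A"
  by (simp add: vol_def sum.distrib)

lemma card_comp_pos: "r < n \<Longrightarrow> r \<notin> X \<Longrightarrow> 1 \<le> card (comp X r)"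
  using comp_self[of r X] card_gt_0_iff[of "comp X r"] by force

lemma runs_dfs:
  assumes inp: "input s" and half: "half_table s" and rem: "removed X s" and r: "r < n" "r \<notin> X" "ireg s rRoot = r"
  shows "runs dfs (vol (comp X r)) (\<lambda>s'. \<exists>L. dfs_out r X L s') s"
proof -
  let ?A = "comp X r"
  let ?s0 = "sx dfs_init s"
  have rA: "r \<in> ?A" using comp_self r by auto
  have f0: "frame dfs s ?s0" 
    by (rule frame_sub[OF frame_loopfree]) (auto simp: dfs_init_def)
  define b where "b = ILess (INum 0) (IReg rSp)"
  define c where "c = Seq dfs_visit (for_up rE (ix bOff rV) (IMem bOff (IAdd (IReg rV) (INum 1))) dfs_edge)"
  \<comment> \<open>A potential must be a function of the state, so the visited set is read off
    \<open>bOrd\<close>.\<close>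
  define \<Phi> :: "ram_state \<Rightarrow> nat" where "\<Phi> s = (\<Sum>v\<in>?A - imem s bOrd ` {..<ireg s rCnt}. length (adj ! v) + 2)" for s
  let ?I = "\<lambda>s. \<exists>L K. dfs_inv r X L K {} s"
  have "runs (While b c) (\<Phi> ?s0 + 1) (\<lambda>s'. ?I s' \<and> \<not> tval b s') ?s0"
  proof (rule runs_While)
    have "dfs_inv r X [] [r] {} ?s0"
      using r rA inp by (auto simp: dfs_inv_def dfs_init_def input_def)
    then show "?I ?s0" by blast
  next
    fix s1 assume "?I s1" and f1: "frame (While b c) ?s0 s1" and t: "tval b s1"
    then obtain L K0 where inv0: "dfs_inv r X L K0 {} s1" by blast
    have "frame dfs ?s0 s1" by (rule frame_sub[OF f1]) (auto simp: b_def c_def dfs_def)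
    then have f: "frame dfs s s1" using frame_trans f0 by blast
    have "K0 \<noteq> []" using inv0 t by (auto simp: dfs_inv_def b_def)
    then obtain K v where K0: "K0 = K @ [v]" by (metis append_butlast_last_id)
    have half1: "half_table s1" using half_table_frame[OF half f] by simp
    note inv = inv0[unfolded K0]
    let ?s2 = "sx dfs_visit s1"
    have f2: "frame dfs s1 ?s2" by (rule frame_sub[OF frame_loopfree]) (auto simp: dfs_visit_def dfs_def)
    then have f': "frame dfs s ?s2" using frame_trans f by blast
    have inp2: "input ?s2" using input_frame[OF inp f'] by simp
    have rem2: "removed X ?s2" using removed_frame[OF rem f'] by simp
    note v = dfs_visit_step[OF inv half1 r(1)]
    have vA: "v \<in> ?A" "v \<notin> set L" using inv by (auto simp: dfs_inv_def)
    have \<Phi>: "\<Phi> s' = (\<Sum>v\<in>?A - set L'. length (adj ! v) + 2)" if "dfs_inv r X L' K' P s'" for L' K' P s'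
    proof -
      have "imem s' bOrd ` {..<ireg s' rCnt} = set L'"
        using that unfolding dfs_inv_def by (auto simp: in_set_conv_nth image_iff)
      then show ?thesis by (simp add: \<Phi>_def)
    qed
    have "runs c (length (adj ! v) + 2) (\<lambda>s'. ?I s' \<and> (length (adj ! v) + 2) + \<Phi> s' \<le> \<Phi> s1) s1"
      unfolding c_def
    proof (rule runs_sx_then)
      show "runs (for_up rE (ix bOff rV) (IMem bOff (IAdd (IReg rV) (INum 1))) dfs_edge) (length (adj ! v) + 2)
        (\<lambda>s'. ?I s' \<and> (length (adj ! v) + 2) + \<Phi> s' \<le> \<Phi> s1) ?s2"
      proof (rule runs_mono[OF dfs_edges[OF v(1) inp2 rem2 r(1) v(2,3,4,5)]])
        fix s' assume "\<exists>K'. dfs_inv r X (L @ [v]) K' {} s'"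
        then obtain K' where K': "dfs_inv r X (L @ [v]) K' {} s'" by blast
        have eq: "?A - set L = insert v (?A - set (L @ [v]))" using vA by auto
        have "finite (?A - set (L @ [v]))" "v \<notin> ?A - set (L @ [v])" by auto
        from sum.insert[OF this] have "\<Phi> s1 = (length (adj ! v) + 2) + \<Phi> s'"
          by (simp only: \<Phi>[OF inv] \<Phi>[OF K'] eq)
        then show "?I s' \<and> (length (adj ! v) + 2) + \<Phi> s' \<le> \<Phi> s1" using K' by fastforce
      qed auto
    qed (simp_all add: dfs_visit_def)
    then show "\<exists>M\<ge>1. runs c M (\<lambda>s'. ?I s' \<and> M + \<Phi> s' \<le> \<Phi> s1) s1"
      by (intro exI[of _ "length (adj ! v) + 2"]) simp
  qed
  then have "runs (While b c) (vol ?A) (\<lambda>s'. \<exists>L. dfs_out r X L s') ?s0"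
  proof (rule runs_conseq)
    have "\<Phi> ?s0 \<le> (\<Sum>v\<in>?A. length (adj ! v) + 2)" unfolding \<Phi>_def by (rule sum_mono2) auto
    moreover have "vol ?A = (\<Sum>v\<in>?A. length (adj ! v) + 2) + card ?A"
      unfolding vol_def sum.distrib by simp
    moreover have "card ?A \<ge> 1" using card_comp_pos r by blast
    ultimately show "\<Phi> ?s0 + 1 \<le> vol ?A" by linarith
  next
    fix s' assume a: "?I s' \<and> \<not> tval b s'"
    then obtain L K where inv: "dfs_inv r X L K {} s'" by blast
    then have K: "K = []" using a by (auto simp: b_def dfs_inv_def)
    \<comment> \<open>With an empty stack and no pending arcs, \<open>L\<close> is closed under
      taking neighbours in the component; induction on the depth then reaches every vertex.\<close>
    have "v \<in> set L" if "v \<in> ?A" for v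
      using that
    proof (induction "d r v" arbitrary: v)
      case 0
      then have "v = r" using d_0[of r v] r comp_sub by auto
      then show ?case using inv K by (auto simp: dfs_inv_def)
    next
      case (Suc m)
      have vn: "v < n" using Suc.prems comp_sub by auto
      have ne: "v \<noteq> r" using Suc.hyps r by auto
      let ?y = "nx v r"
      have y: "?y < n" "d v ?y = 1" "d v r = Suc (d ?y r)" using nx[of v r] ne vn r by auto
      have s: "d v r = d r v" "d ?y r = d r ?y" "d v ?y = d ?y v" using d_sym vn y r by auto
      then have "btw r ?y v" using y r vn by (simp add: btw_def)
      then have "?y \<in> ?A" using comp_btw Suc.prems by blast
      then have "?y \<in> set L" using Suc.hyps y s by simp
      then show ?case using inv K Suc.prems y s unfolding dfs_inv_def by auto
    qed
    then have "dfs_out r X L s'" using inv K unfolding dfs_out_def dfs_inv_def by auto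
    then show "\<exists>L. dfs_out r X L s'" by blast
  qed
  then show ?thesis unfolding dfs_def b_def c_def
  proof (intro runs_sx_then)
    show "1 \<le> vol ?A" using vol_ge_card[of ?A] card_comp_pos[OF r(1,2)] by linarith
  qed (simp_all add: dfs_init_def)
qed

end

section \<open>Passes over a depth-first order\<close>

definition each :: "com \<Rightarrow> com" where
  "each c = for_up rI (INum 0) (IReg rCnt) (Seq (SetIReg rV (ix bOrd rI)) c)"

text \<open>The reverse search order visits children before their parents. The root, at position 0,
  has no parent and is left out by \<open>for_down\<close>.\<close>

definition each_down :: "com \<Rightarrow> com" where
  "each_down c = for_down rI (IReg rCnt)
     (Seq (SetIReg rV (ix bOrd rI)) (Seq (SetIReg rU (ix bPar rV)) c))"

lemma w_each [simp]:
  "wir (each c) = insert rI (insert rV (wir c))" "wim (each c) = wim c"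
  "wrr (each c) = wrr c" "wrm (each c) = wrm c"
  "wir (each_down c) = insert rI (insert rV (insert rU (wir c)))" "wim (each_down c) = wim c"
  "wrr (each_down c) = wrr c" "wrm (each_down c) = wrm c"
  by (auto simp: each_def each_down_def)

definition acc_sum :: "test \<Rightarrow> com" where
  "acc_sum q = each_down (If q (SetRMem mAcc (IReg rU) (RAdd (RMem mAcc (IReg rU)) (RMem mAcc (IReg rV)))) Skip)"

lemma w_acc_sum [simp]:
  "wir (acc_sum q) = {rI, rV, rU}" "wim (acc_sum q) = {}" "wrr (acc_sum q) = {}" "wrm (acc_sum q) = {mAcc}"
  by (auto simp: acc_sum_def)

context ram_instance
begin

lemma dfs_out_frame:
  assumes "dfs_out r X L s" "frame c s s'" "rCnt \<notin> wir c" "wim c \<inter> {bOrd, bDep, bPar, bHp} = {}"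
  shows "dfs_out r X L s'"
  using assms unfolding dfs_out_def frame_def by auto

lemma dfs_out_nth:
  assumes "dfs_out r X L s" "k < length L"
  shows "L ! k < n" "L ! k \<in> comp X r"
  using assms nth_mem comp_sub unfolding dfs_out_def by blast+

lemma dfs_out_length: "dfs_out r X L s \<Longrightarrow> length L = card (comp X r)"
  unfolding dfs_out_def using distinct_card[of L] by simp

lemma dfs_out_0:
  assumes "dfs_out r X L s" "r < n" "r \<notin> X"
  shows "0 < length L" "L ! 0 = r"
proof -
  have "r \<in> set L" using assms comp_self unfolding dfs_out_def by auto
  then show l: "0 < length L" by auto
  show "L ! 0 = r" using assms(1) l unfolding dfs_out_def by force
qed

lemma dfs_out_parent:
  assumes "dfs_out r X L s" "r < n" "r \<notin> X" "1 \<le> k" "k < length L"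
  shows "L ! k \<noteq> r" "imem s bPar (L ! k) = nx (L ! k) r" "\<exists>j<k. nx (L ! k) r = L ! j"
proof -
  have "L ! k \<noteq> L ! 0" using assms dfs_out_0[OF assms(1-3)] nth_eq_iff_index_eq[of L k 0]
    unfolding dfs_out_def by auto
  then show ne: "L ! k \<noteq> r" using dfs_out_0[OF assms(1-3)] by simp
  then show "imem s bPar (L ! k) = nx (L ! k) r" using assms(1) nth_mem[OF assms(5)] unfolding dfs_out_def by simp
  have "nx (L ! k) r \<in> set (take k L)" using assms(1,5) ne unfolding dfs_out_def by blast
  then show "\<exists>j<k. nx (L ! k) r = L ! j" by (auto simp: in_set_conv_nth)
qed

lemma runs_each:
  assumes out: "dfs_out r X L s0" and c: "loopfree c" "rI \<notin> wir c" "rCnt \<notin> wir c" "bOrd \<notin> wim c"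
    and M: "length L + 2 \<le> M"
    and insens: "\<And>k s x y. J k (s\<lparr>ireg := (ireg s)(rI := x, rV := y)\<rparr>) \<longleftrightarrow> J k s"
    and init: "J 0 s0"
    and step: "\<And>k s. k < length L \<Longrightarrow> J k s \<Longrightarrow> ireg s rV = L ! k \<Longrightarrow> ireg s rI = k \<Longrightarrow> frame (each c) s0 s \<Longrightarrow>
      J (Suc k) (sx c s)"
  shows "runs (each c) M (J (length L)) s0"
proof -
  have insI: "J k (s\<lparr>ireg := (ireg s)(rI := x)\<rparr>) \<longleftrightarrow> J k s" for k s x
    using insens[of k s x "ireg s rV"] by (simp add: fun_upd_idem)
  let ?c = "Seq (SetIReg rV (ix bOrd rI)) c"
  show ?thesis unfolding each_def
  proof (rule runs_for_up[where ?k0.0 = 0 and I = J and m = "length L"])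
    fix s assume f: "frame (for_up rI (INum 0) (IReg rCnt) ?c) s0 s"
    show "ival (IReg rCnt) s = length L"
      using out c by (simp add: frameD[OF f] dfs_out_def)
  next
    show "J 0 (s0\<lparr>ireg := (ireg s0)(rI := 0)\<rparr>)" using init insI by simp
  next
    fix k s assume k: "k < length L" "ireg s rI = k" "J k s"
      and f: "frame (for_up rI (INum 0) (IReg rCnt) ?c) s0 s"
    let ?s = "s\<lparr>ireg := (ireg s)(rV := L ! k)\<rparr>"
    have o: "imem s bOrd k = L ! k"
      using out c k by (simp add: frameD[OF f] dfs_out_def)
    have "frame (each c) s0 s" using f by (simp add: each_def)
    then have f': "frame (each c) s0 ?s" unfolding frame_def w_each by auto
    have "J k ?s" using k(3) insens[of k s "ireg s rI" "L ! k"] by (simp add: fun_upd_idem)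
    then have "J (Suc k) (sx c ?s)" using step[OF k(1) _ _ _ f'] k(2) by simp
    then show "J (Suc k) ((sx ?c s)\<lparr>ireg := (ireg (sx ?c s))(rI := Suc k)\<rparr>)"
      using insI k(2) o by simp
  qed (use c M in auto)
qed

lemma runs_each_down:
  assumes out: "dfs_out r X L s0" and r: "r < n" "r \<notin> X"
    and c: "loopfree c" "rI \<notin> wir c" "rCnt \<notin> wir c" "wim c \<inter> {bOrd, bPar} = {}"
    and M: "length L \<le> M"
    and insens: "\<And>k s x y z. J k (s\<lparr>ireg := (ireg s)(rI := x, rV := y, rU := z)\<rparr>) \<longleftrightarrow> J k s"
    and init: "J (length L) s0"
    and step: "\<And>k s. 1 \<le> k \<Longrightarrow> k < length L \<Longrightarrow> J (Suc k) s \<Longrightarrow> ireg s rV = L ! k \<Longrightarrow>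
      ireg s rU = nx (L ! k) r \<Longrightarrow> frame (each_down c) s0 s \<Longrightarrow> J k (sx c s)"
  shows "runs (each_down c) M (J 1) s0"
proof -
  have insI: "J k (s\<lparr>ireg := (ireg s)(rI := x)\<rparr>) \<longleftrightarrow> J k s" for k s x
    using insens[of k s x "ireg s rV" "ireg s rU"] by (simp add: fun_upd_idem fun_upd_twist)
  let ?c = "Seq (SetIReg rV (ix bOrd rI)) (Seq (SetIReg rU (ix bPar rV)) c)"
  show ?thesis unfolding each_down_def
  proof (rule runs_for_down[where I = J and m = "length L"])
    show "ival (IReg rCnt) s0 = length L" using out by (simp add: dfs_out_def)
    show "1 \<le> length L" using dfs_out_0(1)[OF out r] by linarith
    show "J (length L) (s0\<lparr>ireg := (ireg s0)(rI := length L)\<rparr>)" using init insI by simp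
  next
    fix k s assume k: "1 \<le> k" "k < length L" "ireg s rI = k" "J (Suc k) (s\<lparr>ireg := (ireg s)(rI := Suc k)\<rparr>)"
      and f: "frame (for_down rI (IReg rCnt) ?c) s0 s"
    let ?s = "s\<lparr>ireg := (ireg s)(rV := L ! k, rU := nx (L ! k) r)\<rparr>"
    have o: "imem s bOrd k = L ! k"
      using out c k by (simp add: frameD[OF f] dfs_out_def)
    have p: "imem s bPar (L ! k) = nx (L ! k) r"
      using dfs_out_parent(2)[OF out r k(1,2)] c by (simp add: frameD[OF f])
    have "frame (each_down c) s0 s" using f by (simp add: each_down_def)
    then have f': "frame (each_down c) s0 ?s" unfolding frame_def w_each by auto
    have "J (Suc k) s" using k(4) insI by simp
    then have "J (Suc k) ?s" using insens[of "Suc k" s "ireg s rI" "L ! k" "nx (L ! k) r"] by (simp add: fun_upd_idem)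
    then have "J k (sx c ?s)" using step[OF k(1,2) _ _ _ f'] by simp
    then show "J k (sx ?c s)" using k(3) o p by simp
  qed (use c M in auto)
qed

text \<open>With constant \<open>g\<close> this is a subtree sum; with \<open>te\<close> for
  \<open>g\<close> and the centroid as root it is the weight beyond \<open>v\<close> within one
  territory.\<close>

definition class_sum :: "nat set \<Rightarrow> nat \<Rightarrow> (nat \<Rightarrow> nat) \<Rightarrow> (nat \<Rightarrow> real) \<Rightarrow> nat \<Rightarrow> real" where
  "class_sum A r g f v = (\<Sum>u | u \<in> A \<and> btw r v u \<and> g u = g v. f u)"

text \<open>By convexity of the classes, a member below \<open>v\<close> is reached through a child
  of \<open>v\<close> in the same class. Hence it suffices to pass sums up along edges whose ends
  are in the same class.\<close>

lemma class_sum_rec: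
  assumes r: "r < n" and v: "v \<in> comp X r"
    and conv: "\<And>v z u. btw v z u \<Longrightarrow> g u = g v \<Longrightarrow> g z = g v"
  shows "class_sum (comp X r) r g f v = f v +
    (\<Sum>w | w \<in> comp X r \<and> w \<noteq> r \<and> nx w r = v \<and> g w = g v. class_sum (comp X r) r g f w)"
proof -
  let ?A = "comp X r"
  let ?B = "\<lambda>w. {u \<in> ?A. btw r w u \<and> g u = g w}"
  let ?W = "{w \<in> ?A. w \<noteq> r \<and> nx w r = v \<and> g w = g v}"
  have vn: "v < n" using v comp_sub by auto
  have ch: "d r w = Suc (d r v)" "btw r v w" "nx v w = w" "w < n" "w \<noteq> v" if "w \<in> ?W" for w
  proof -
    have w: "w < n" "w \<noteq> r" "nx w r = v" using that comp_sub by auto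
    then have y: "d w v = 1" "d w r = Suc (d v r)" using nx[of w r] r by auto
    have s: "d r w = d w r" "d r v = d v r" "d v w = d w v" using d_sym w vn r by auto
    then show 1: "d r w = Suc (d r v)" "w < n" using y w by auto
    then show "w \<noteq> v" by auto
    show "btw r v w" using y s w vn r by (simp add: btw_def)
    show "nx v w = w" using nx_adj vn w y s by simp
  qed
  have "?B v = insert v (\<Union>w\<in>?W. ?B w)"
  proof (intro set_eqI iffI)
    fix u assume u: "u \<in> ?B v"
    show "u \<in> insert v (\<Union>w\<in>?W. ?B w)"
    proof (cases "u = v")
      case False
      have un: "u < n" using u comp_sub by auto
      let ?w = "nx v u"
      have w: "?w < n" "d v ?w = 1" "d v u = Suc (d ?w u)" using nx[of v u] vn un False by auto
      have b: "btw v ?w u" using w vn un by (simp add: btw_def)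
      have b2: "btw r ?w u" "btw r v ?w" using btw_trans2[of r v u ?w] b u by auto
      have wA: "?w \<in> ?A" using comp_btw[OF _ b2(1)] u by blast
      have gw: "g ?w = g v" using conv[OF b] u by simp
      have dr: "d r ?w = Suc (d r v)" using b2(2) w by (simp add: btw_def)
      then have wr: "?w \<noteq> r" using r by auto
      have "v = nx ?w r"
        using nx_unique[of ?w r v] dr w wr r vn d_sym[of r ?w] d_sym[of r v] d_sym[of v ?w] by simp
      then have "?w \<in> ?W" using wA wr gw by auto
      moreover have "u \<in> ?B ?w" using u b2 gw by auto
      ultimately show ?thesis by blast
    qed simp
  next
    fix u assume "u \<in> insert v (\<Union>w\<in>?W. ?B w)"
    then consider "u = v" | w where "w \<in> ?W" "u \<in> ?B w" by blast
    then show "u \<in> ?B v"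
    proof cases
      case 1
      then show ?thesis using v vn r by auto
    next
      case 2
      then have "btw r v u" using btw_trans1(1)[OF ch(2), of w u] by blast
      then show ?thesis using 2 by auto
    qed
  qed
  moreover have "v \<notin> (\<Union>w\<in>?W. ?B w)"
  proof
    assume "v \<in> (\<Union>w\<in>?W. ?B w)"
    then obtain w where w: "w \<in> ?W" "btw r w v" by blast
    then show False using ch(1)[OF w(1)] by (auto simp: btw_def)
  qed
  moreover have "sum f (\<Union>w\<in>?W. ?B w) = (\<Sum>w\<in>?W. sum f (?B w))"
  proof (rule sum.UNION_disjoint)
    show "\<forall>w\<in>?W. \<forall>w'\<in>?W. w \<noteq> w' \<longrightarrow> ?B w \<inter> ?B w' = {}"
    proof (intro ballI impI equals0I)
      fix w w' u assume w: "w \<in> ?W" "w' \<in> ?W" "w \<noteq> w'" "u \<in> ?B w \<inter> ?B w'"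
      then have b: "btw r w u" "btw r w' u" by auto
      have "btw r w w'" by (rule btw_linear[OF b]) (use ch(1)[OF w(1)] ch(1)[OF w(2)] in simp)
      then have "d w w' = 0" using ch(1)[OF w(1)] ch(1)[OF w(2)] by (simp add: btw_def)
      then show False using d_0[of w w'] ch(4)[OF w(1)] ch(4)[OF w(2)] w(3) by simp
    qed
  qed auto
  ultimately show ?thesis by (simp add: class_sum_def)
qed

lemma runs_acc_sum:
  assumes out: "dfs_out r X L s0" and r: "r < n" "r \<notin> X" and M: "length L \<le> M"
    and conv: "\<And>v z u. btw v z u \<Longrightarrow> g u = g v \<Longrightarrow> g z = g v"
    and f: "\<And>v. v \<in> comp X r \<Longrightarrow> rmem s0 mAcc v = f v"
    and q: "\<And>s v. frame (acc_sum q) s0 s \<Longrightarrow> v < n \<Longrightarrow> nx v r < n \<Longrightarrow> ireg s rV = v \<Longrightarrow> ireg s rU = nx v r \<Longrightarrow>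
      tval q s \<longleftrightarrow> g v = g (nx v r)"
  shows "runs (acc_sum q) M (\<lambda>s'. \<forall>v\<in>comp X r. rmem s' mAcc v = class_sum (comp X r) r g f v) s0"
proof -
  let ?A = "comp X r" and ?F = "class_sum (comp X r) r g f"
  let ?ch = "\<lambda>k v. {w \<in> set (drop k L). w \<noteq> r \<and> nx w r = v \<and> g w = g v}"
  \<comment> \<open>Exactly the children of \<open>v\<close> from position \<open>k\<close> on have
    handed up their sums.\<close>
  let ?J = "\<lambda>k s. \<forall>v\<in>?A. rmem s mAcc v = f v + sum ?F (?ch k v)"
  have L: "set L = ?A" "distinct L" using out by (auto simp: dfs_out_def)
  have "runs (acc_sum q) M (?J 1) s0"
    unfolding acc_sum_def
  proof (rule runs_each_down[OF out r _ _ _ _ M, where J = ?J])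
    fix k s assume k: "1 \<le> k" "k < length L" and J: "?J (Suc k) s" and v: "ireg s rV = L ! k" "ireg s rU = nx (L ! k) r"
      and fr: "frame (each_down (If q (SetRMem mAcc (IReg rU) (RAdd (RMem mAcc (IReg rU)) (RMem mAcc (IReg rV)))) Skip)) s0 s"
    let ?v = "L ! k" and ?u = "nx (L ! k) r"
    obtain j where j: "j < k" "?u = L ! j" using dfs_out_parent(3)[OF out r k] by blast
    have A: "?v \<in> ?A" "?u \<in> ?A" using dfs_out_nth(2)[OF out] k j by auto
    have An: "?v < n" "?u < n" using A comp_sub by auto
    have ne: "?v \<noteq> r" using dfs_out_parent(1)[OF out r k] .
    have tq: "tval q s \<longleftrightarrow> g ?v = g ?u" using q[OF _ An v] fr by (simp add: acc_sum_def)
    have drop: "set (drop k L) = insert ?v (set (drop (Suc k) L))" "?v \<notin> set (drop (Suc k) L)"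
      using Cons_nth_drop_Suc[OF k(2)] L(2) distinct_drop[of L k] by (metis list.simps(15), metis distinct.simps(2))
    \<comment> \<open>Parents precede their children in the order, so at position \<open>k\<close>
      all children of \<open>?v\<close> have been processed and its own sum is final.\<close>
    have "?ch (Suc k) ?v = {w \<in> ?A. w \<noteq> r \<and> nx w r = ?v \<and> g w = g ?v}"
    proof -
      have "w \<in> set (drop (Suc k) L)" if w: "w \<in> ?A" "w \<noteq> r" "nx w r = ?v" for w
      proof -
        have "w \<in> set L" using L(1) w(1) by simp
        then obtain i where i: "i < length L" "w = L ! i" unfolding in_set_conv_nth by blast
        have "i \<noteq> 0" using dfs_out_0(2)[OF out r] i w(2) by (cases i) auto
        then obtain j' where j': "j' < i" "?v = L ! j'" using dfs_out_parent(3)[OF out r, of i] i w(3) by auto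
        have "k = j'" using nth_eq_iff_index_eq[OF L(2) k(2), of j'] j' i by simp
        then have "w = drop (Suc k) L ! (i - Suc k)" "i - Suc k < length (drop (Suc k) L)" using i j' by auto
        then show ?thesis using nth_mem by blast
      qed
      moreover have "set (drop (Suc k) L) \<subseteq> ?A" using L set_drop_subset by metis
      ultimately show ?thesis by blast
    qed
    then have Fv: "rmem s mAcc ?v = ?F ?v" using J A(1) class_sum_rec[OF r(1) A(1) conv, where f = f] by simp
    have chk: "?ch k v = (if v = ?u \<and> g ?v = g ?u then insert ?v (?ch (Suc k) v) else ?ch (Suc k) v)" for v
      using drop ne by auto
    have sumk: "sum ?F (?ch k v) = (if v = ?u \<and> g ?v = g ?u then ?F ?v + sum ?F (?ch (Suc k) v) else sum ?F (?ch (Suc k) v))" for v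
      unfolding chk using drop by auto
    show "?J k (sx (If q (SetRMem mAcc (IReg rU) (RAdd (RMem mAcc (IReg rU)) (RMem mAcc (IReg rV)))) Skip) s)"
      using J Fv tq v by (simp add: sumk)
  qed (use f in auto)
  then show ?thesis
  proof (rule runs_mono)
    fix s' assume J: "?J 1 s'"
    have d1: "set (drop 1 L) = ?A - {r}"
      using dfs_out_0[OF out r] L by (cases L) auto
    show "\<forall>v\<in>?A. rmem s' mAcc v = ?F v"
    proof
      fix v assume v: "v \<in> ?A"
      have "?ch 1 v = {w \<in> ?A. w \<noteq> r \<and> nx w r = v \<and> g w = g v}" unfolding d1 by auto
      then show "rmem s' mAcc v = ?F v" using J v class_sum_rec[OF r(1) v conv, where f = f] by simp
    qed
  qed simp
qed

end

section \<open>Centroids, and the territory of the centroid\<close>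

abbreviation (input) tt :: test where "tt \<equiv> Not (ILess (INum 0) (INum 0))"

definition count_sites :: com where
  "count_sites = each (If (And (IEq (ix bD rV) (INum 0)) (IEq (IMem bDone (ix bTe rV)) (INum 0)))
     (SetRMem mAcc (IReg rV) (RNum 1)) (SetRMem mAcc (IReg rV) (RNum 0)))"

text \<open>The vertices with more than half of the sites below them form a path from the root, so the last one in the
  search order is the lowest.\<close>

definition find_heavy :: com where
  "find_heavy = each (If (RLess (RMem mAcc (IReg rRoot)) (RAdd (RMem mAcc (IReg rV)) (RMem mAcc (IReg rV))))
     (SetIReg rX (IReg rV)) Skip)"

definition find_centroid :: com where
  "find_centroid = block [count_sites, acc_sum tt, SetIReg rX (IReg rRoot), find_heavy]"

definition own_init :: com where
  "own_init = each (If (IEq (ix bTe rV) (IReg rC))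
     (SetRMem mAcc (IReg rV) (RMem mPi (IReg rV))) (SetRMem mAcc (IReg rV) (RNum 0)))"

definition own_add :: com where
  "own_add = each (block
    [SetRMem mGain (IReg rV) (RAdd (RMem mGain (IReg rV)) (RMem mAcc (ix bHp rV))),
     SetRReg 0 (RSub (RMem mAcc (IReg rRoot)) (RMem mAcc (ix bHp rV))),
     If (RLess (RMem mRest (IReg rV)) (RReg 0)) (SetRMem mRest (IReg rV) (RReg 0)) Skip])"

definition own :: com where
  "own = block [SetIReg rRoot (ix bS rC), dfs, own_init, acc_sum tt, own_add,
     SetIMem bDone (IReg rC) (INum 1)]"

lemma w_own [simp]:
  "wir count_sites = {rI, rV}" "wim count_sites = {}" "wrr count_sites = {}" "wrm count_sites = {mAcc}"
  "wir find_heavy = {rI, rV, rX}" "wim find_heavy = {}" "wrr find_heavy = {}" "wrm find_heavy = {}"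
  "wir find_centroid = {rI, rV, rU, rX}" "wim find_centroid = {}" "wrr find_centroid = {}" "wrm find_centroid = {mAcc}"
  "wir own_init = {rI, rV}" "wim own_init = {}" "wrr own_init = {}" "wrm own_init = {mAcc}"
  "wir own_add = {rI, rV}" "wim own_add = {}" "wrr own_add = {0}" "wrm own_add = {mGain, mRest}"
  "wir own = {rRoot, rV, rU, rE, rCnt, rSp, rI}" "wim own = {bPar, bDep, bOrd, bStk, bSk, bHp, bDone}"
  "wrr own = {0}" "wrm own = {mGain, mRest, mAcc}"
  by (auto simp: count_sites_def find_heavy_def find_centroid_def own_init_def own_add_def own_def)

context ram_instance
begin

definition labels :: "ram_state \<Rightarrow> bool" where
  "labels s \<longleftrightarrow> (\<forall>v<n. imem s bD v = D v \<and> imem s bTe v = te v)"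

definition done_table :: "nat set \<Rightarrow> ram_state \<Rightarrow> bool" where
  "done_table X s \<longleftrightarrow> (\<forall>j<p. imem s bDone j = (if undone X j then 0 else 1))"

definition centroid :: "nat set \<Rightarrow> nat \<Rightarrow> nat \<Rightarrow> bool" where
  "centroid X r x \<longleftrightarrow> x \<in> comp X r \<and> card (sites X r) < 2 * card {u \<in> sites X r. btw r x u} \<and>
     (\<forall>w\<in>comp X r. w \<noteq> r \<longrightarrow> nx w r = x \<longrightarrow> 2 * card {u \<in> sites X r. btw r w u} \<le> card (sites X r))"

lemma labels_frame: "labels s \<Longrightarrow> frame c s s' \<Longrightarrow> wim c \<inter> {bD, bTe} = {} \<Longrightarrow> labels s'"
  unfolding labels_def frame_def by auto

lemma done_table_frame: "done_table X s \<Longrightarrow> frame c s s' \<Longrightarrow> wim c \<inter> {bDone} = {} \<Longrightarrow> done_table X s'"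
  unfolding done_table_def frame_def by auto

lemma \<pi>_cells: "input s \<Longrightarrow> v < n \<Longrightarrow> rmem s mPi v = \<pi> v"
  by (simp add: input_def cells_def)

lemma S_cells: "input s \<Longrightarrow> j < p \<Longrightarrow> imem s bS j = S ! j"
  by (simp add: input_def cells_def)

lemma set_take_Suc: "k < length L \<Longrightarrow> set (take (Suc k) L) = insert (L ! k) (set (take k L))"
  by (simp add: take_Suc_conv_app_nth)

lemma not_in_take: "distinct L \<Longrightarrow> k < length L \<Longrightarrow> L ! k \<notin> set (take k L)"
  by (auto simp: in_set_conv_nth nth_eq_iff_index_eq)

lemma runs_each_fill:
  assumes out: "dfs_out r X L s0" and c: "loopfree c" "rI \<notin> wir c" "rCnt \<notin> wir c" "bOrd \<notin> wim c"
    and M: "length L + 2 \<le> M"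
    and eff: "\<And>s v. frame (each c) s0 s \<Longrightarrow> ireg s rV = v \<Longrightarrow> v \<in> comp X r \<Longrightarrow> rmem (sx c s) mAcc = (rmem s mAcc)(v := f v)"
  shows "runs (each c) M (\<lambda>s'. \<forall>v\<in>comp X r. rmem s' mAcc v = f v) s0"
proof -
  have "runs (each c) M (\<lambda>s. \<forall>v\<in>set (take (length L) L). rmem s mAcc v = f v) s0"
  proof (rule runs_each[OF out c M, where J = "\<lambda>k s. \<forall>v\<in>set (take k L). rmem s mAcc v = f v"])
    fix k s assume k: "k < length L" "\<forall>v\<in>set (take k L). rmem s mAcc v = f v" "ireg s rV = L ! k"
      and fr: "frame (each c) s0 s"
    show "\<forall>v\<in>set (take (Suc k) L). rmem (sx c s) mAcc v = f v"
      unfolding eff[OF fr k(3) dfs_out_nth(2)[OF out k(1)]] set_take_Suc[OF k(1)]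
      using k(2) by simp
  qed simp_all
  then show ?thesis by (rule runs_mono) (use out in \<open>auto simp: dfs_out_def\<close>)
qed

lemma length_le_vol:
  assumes "dfs_out r X L s" "r < n" "r \<notin> X"
  shows "length L + 2 \<le> vol (comp X r)" "length L \<le> vol (comp X r)" "1 \<le> vol (comp X r)"
  using vol_ge_card[of "comp X r"] card_comp_pos[OF assms(2,3)] dfs_out_length[OF assms(1)] by auto

lemma class_sum_card:
  "class_sum (comp X r) r (\<lambda>_. 0) (\<lambda>u. if D u = 0 \<and> undone X (te u) then 1 else 0) v =
    real (card {u \<in> sites X r. btw r v u})"
proof -
  have "{u \<in> sites X r. btw r v u} = {u \<in> {u \<in> comp X r. btw r v u}. D u = 0 \<and> undone X (te u)}"
    by (auto simp: sites_def)
  then show ?thesis unfolding class_sum_def by (simp add: sum.If_cases Int_def)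
qed

text \<open>If there are unmet sites, the root itself is heavy, so the register ends at the last
  heavy vertex of the order. Its children come later and are therefore not heavy. Comparing a
  doubled weight with the root weight avoids halving.\<close>

lemma runs_find_centroid:
  assumes out: "dfs_out r X L s" and r: "r < n" "r \<notin> X" and lab: "labels s" and dt: "done_table X s"
    and root: "ireg s rRoot = r"
  shows "runs find_centroid (vol (comp X r)) (\<lambda>s'. rmem s' mAcc r = real (card (sites X r)) \<and>
     (sites X r \<noteq> {} \<longrightarrow> centroid X r (ireg s' rX))) s"
proof -
  let ?A = "comp X r" let ?M = "vol ?A"
  let ?f = "\<lambda>u. if D u = 0 \<and> undone X (te u) then 1 else 0 :: real"
  let ?c = "\<lambda>v. card {u \<in> sites X r. btw r v u}"
  note M = length_le_vol[OF out r]
  have 1: "runs count_sites ?M (\<lambda>s'. \<forall>v\<in>?A. rmem s' mAcc v = ?f v) s"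
    unfolding count_sites_def
  proof (rule runs_each_fill[OF out _ _ _ _ M(1)])
    fix s1 v assume f: "frame (each (If (And (IEq (ix bD rV) (INum 0)) (IEq (IMem bDone (ix bTe rV)) (INum 0)))
     (SetRMem mAcc (IReg rV) (RNum 1)) (SetRMem mAcc (IReg rV) (RNum 0)))) s s1" and v: "ireg s1 rV = v" "v \<in> ?A"
    have "v < n" using v comp_sub by auto
    then show "rmem (sx (If (And (IEq (ix bD rV) (INum 0)) (IEq (IMem bDone (ix bTe rV)) (INum 0)))
     (SetRMem mAcc (IReg rV) (RNum 1)) (SetRMem mAcc (IReg rV) (RNum 0))) s1) 4 = (rmem s1 mAcc)(v := ?f v)"
      using v lab dt te_lt[of v] by (auto simp: frameD[OF f] labels_def done_table_def)
  qed auto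
  show ?thesis unfolding find_centroid_def block.simps
  proof (rule runs_then[OF 1 order_refl])
    fix s1 assume s1: "\<forall>v\<in>?A. rmem s1 mAcc v = ?f v" and f1: "frame count_sites s s1"
    have out1: "dfs_out r X L s1" using dfs_out_frame[OF out f1] by simp
    have 2: "runs (acc_sum tt) ?M (\<lambda>s'. \<forall>v\<in>?A. rmem s' mAcc v = class_sum ?A r (\<lambda>_. 0) ?f v) s1"
      by (rule runs_acc_sum[OF out1 r M(2)]) (use s1 in auto)
    show "runs (Seq (acc_sum tt) (Seq (SetIReg rX (IReg rRoot)) find_heavy)) ?M
      (\<lambda>s'. rmem s' mAcc r = real (card (sites X r)) \<and> (sites X r \<noteq> {} \<longrightarrow> centroid X r (ireg s' rX))) s1"
    proof (rule runs_then[OF 2 order_refl])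
      fix s2 assume s2: "\<forall>v\<in>?A. rmem s2 mAcc v = class_sum ?A r (\<lambda>_. 0) ?f v" and f2: "frame (acc_sum tt) s1 s2"
      let ?s3 = "s2\<lparr>ireg := (ireg s2)(rX := r)\<rparr>"
      have root2: "ireg s2 rRoot = r" using root by (simp add: frameD[OF f1] frameD[OF f2])
      have c2: "\<forall>v\<in>?A. rmem s2 mAcc v = real (?c v)" using s2 by (simp add: class_sum_card)
      have "dfs_out r X L s2" using dfs_out_frame[OF out1 f2] by simp
      then have out3: "dfs_out r X L ?s3" by (simp add: dfs_out_def)
      have rA: "r \<in> ?A" using comp_self r by simp
      have sub: "?A \<subseteq> {..<n}" using comp_sub .
      have rc: "{u \<in> sites X r. btw r r u} = sites X r" using sub r by (auto simp: sites_def)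
      let ?heavy = "\<lambda>v. card (sites X r) < 2 * ?c v"
      let ?J = "\<lambda>k s. ireg s rX = r \<and> (\<forall>j<k. \<not> ?heavy (L ! j)) \<or>
        (\<exists>i<k. ireg s rX = L ! i \<and> ?heavy (L ! i) \<and> (\<forall>j. i < j \<longrightarrow> j < k \<longrightarrow> \<not> ?heavy (L ! j)))"
      have 3: "runs find_heavy ?M (?J (length L)) ?s3"
        unfolding find_heavy_def
      proof (rule runs_each[OF out3 _ _ _ _ M(1), where J = ?J])
        fix k s assume k: "k < length L" and J: "?J k s" and v: "ireg s rV = L ! k"
          and f: "frame (each (If (RLess (RMem mAcc (IReg rRoot)) (RAdd (RMem mAcc (IReg rV)) (RMem mAcc (IReg rV))))
            (SetIReg rX (IReg rV)) Skip)) ?s3 s"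
        have "L ! k \<in> ?A" using dfs_out_nth(2)[OF out k] .
        then have "rmem s mAcc (L ! k) = real (?c (L ! k))" "rmem s mAcc r = real (card (sites X r))" "ireg s rRoot = r"
          using c2 rA rc root2 by (auto simp: frameD[OF f])
        then have *: "sx (If (RLess (RMem mAcc (IReg rRoot)) (RAdd (RMem mAcc (IReg rV)) (RMem mAcc (IReg rV))))
            (SetIReg rX (IReg rV)) Skip) s = (if ?heavy (L ! k) then s\<lparr>ireg := (ireg s)(rX := L ! k)\<rparr> else s)"
          using v by (auto simp: of_nat_less_iff[symmetric, where 'a = real] simp del: of_nat_less_iff)
        show "?J (Suc k) (sx (If (RLess (RMem mAcc (IReg rRoot)) (RAdd (RMem mAcc (IReg rV)) (RMem mAcc (IReg rV))))
            (SetIReg rX (IReg rV)) Skip) s)"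
        proof (cases "?heavy (L ! k)")
          case True
          then show ?thesis unfolding * by (intro disjI2 exI[of _ k]) simp
        next
          case False
          show ?thesis using J
          proof
            assume "ireg s rX = r \<and> (\<forall>j<k. \<not> ?heavy (L ! j))"
            then show ?thesis unfolding * using False by (simp add: less_Suc_eq)
          next
            assume "\<exists>i<k. ireg s rX = L ! i \<and> ?heavy (L ! i) \<and> (\<forall>j. i < j \<longrightarrow> j < k \<longrightarrow> \<not> ?heavy (L ! j))"
            then obtain i where "i < k" "ireg s rX = L ! i" "?heavy (L ! i)" "\<forall>j. i < j \<longrightarrow> j < k \<longrightarrow> \<not> ?heavy (L ! j)"
              by blast
            then show ?thesis unfolding * using False by (intro disjI2 exI[of _ i]) (simp add: less_Suc_eq)
          qed
        qed
      qed simp_all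
      have "runs find_heavy ?M (\<lambda>s'. rmem s' mAcc r = real (card (sites X r)) \<and>
         (sites X r \<noteq> {} \<longrightarrow> centroid X r (ireg s' rX))) ?s3"
      proof (rule runs_conseq[OF 3 order_refl])
        fix s4 assume J: "?J (length L) s4" and f: "frame find_heavy ?s3 s4"
        have "rmem s4 mAcc r = real (card (sites X r))" using c2 rA rc by (simp add: frameD[OF f])
        moreover have "centroid X r (ireg s4 rX)" if "sites X r \<noteq> {}"
        proof -
          have "?heavy (L ! 0)" "0 < length L"
            using that rc dfs_out_0[OF out r] card_gt_0_iff[of "sites X r"] by auto
          then obtain i where i: "i < length L" "ireg s4 rX = L ! i" "?heavy (L ! i)"
            "\<And>j. i < j \<Longrightarrow> j < length L \<Longrightarrow> \<not> ?heavy (L ! j)" using J by blast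
          have "\<not> ?heavy w" if w: "w \<in> ?A" "w \<noteq> r" "nx w r = L ! i" for w
          proof -
            have "w \<in> set L" using out w by (simp add: dfs_out_def)
            then obtain j where j: "j < length L" "w = L ! j" unfolding in_set_conv_nth by blast
            have "j \<noteq> 0" using dfs_out_0(2)[OF out r] j w(2) by (cases j) auto
            then obtain j' where j': "j' < j" "L ! i = L ! j'" using dfs_out_parent(3)[OF out r, of j] j w by auto
            have "i = j'" using nth_eq_iff_index_eq[of L i j'] out i(1) j j' by (simp add: dfs_out_def)
            then show ?thesis using i(4)[of j] j j' by simp
          qed
          then show ?thesis unfolding centroid_def i(2)
            using dfs_out_nth(2)[OF out i(1)] i(3) by (auto simp: not_less)
        qed
        ultimately show "rmem s4 mAcc r = real (card (sites X r)) \<and> (sites X r \<noteq> {} \<longrightarrow> centroid X r (ireg s4 rX))"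
          by blast
      qed
      then show "runs (Seq (SetIReg rX (IReg rRoot)) find_heavy) ?M
        (\<lambda>s'. rmem s' mAcc r = real (card (sites X r)) \<and> (sites X r \<noteq> {} \<longrightarrow> centroid X r (ireg s' rX))) s2"
        by (intro runs_sx_then) (use M root2 in simp_all)
    qed
  qed
qed

text \<open>This permits the search to start at the site instead of at \<open>r\<close>: the unmet
  territory of \<open>x\<close> lies inside the component, so its site is another root of the same
  component.\<close>

lemma comp_territory:
  assumes r: "r < n" and x: "x \<in> comp X r" "undone X (te x)"
  shows "comp X (S ! te x) = comp X r" "S ! te x \<notin> X" "S ! te x < n"
    "u < n \<Longrightarrow> te u = te x \<Longrightarrow> u \<in> comp X r"
proof -
  have xn: "x < n" using x comp_sub by auto
  have sA: "S ! te x \<in> comp X r" using undone_territory_in_comp[of r x X] r xn x by simp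
  show "comp X (S ! te x) = comp X r" by (rule comp_eq) (use r sA in auto)
  show "S ! te x \<notin> X" by (rule comp_notin[of r]) (use r sA in auto)
  show "S ! te x < n" using comp_sub[of X r] sA by auto
  show "u \<in> comp X r" if "u < n" "te u = te x"
    using undone_territory_in_comp[of r u X] that r x sA by simp
qed

text \<open>By \<open>gain_beyond_half\<close> the gain is the subtree sum at the half vertex
  \<open>bHp v\<close>, and the rest is what remains of the sum at the root. Sites are exempt, among
  them the root, which has no half vertex.\<close>

lemma runs_own:
  assumes inp: "input s" and half: "half_table s" and rem: "removed X s" and lab: "labels s"
    and r: "r < n" "r \<notin> X" and x: "x \<in> comp X r" and und: "undone X (te x)" and C: "ireg s rC = te x"
  shows "runs own (vol (comp X r)) (\<lambda>s'.
     (\<forall>v<n. v \<notin> set S \<longrightarrow>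
        rmem s' mGain v = (if v \<in> comp X r then rmem s mGain v + gain (te x) v else rmem s mGain v) \<and>
        rmem s' mRest v = (if v \<in> comp X r then max (rmem s mRest v) (rest (te x) v) else rmem s mRest v)) \<and>
     imem s' bDone = (imem s bDone)(te x := 1)) s"
proof -
  let ?c = "te x" and ?A = "comp X r"
  let ?q = "S ! ?c" let ?M = "vol ?A"
  note q = comp_territory[OF r(1) x und]
  note qn = q(3,2)
  have cp: "?c < p" using te_lt .
  let ?s1 = "s\<lparr>ireg := (ireg s)(rRoot := ?q)\<rparr>"
  have inp1: "input ?s1" and half1: "half_table ?s1" and rem1: "removed X ?s1" and lab1: "labels ?s1"
    using inp half rem lab by (simp_all add: input_def half_table_def removed_def labels_def)
  have M1: "1 \<le> ?M" using vol_ge_card[of ?A] card_comp_pos[OF r] by simp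
  \<comment> \<open>Zero weights outside the territory make plain subtree sums suffice; since the
    territory lies within the component, the search misses nothing of it.\<close>
  let ?f = "\<lambda>u. if te u = ?c then \<pi> u else 0"
  let ?F = "class_sum ?A ?q (\<lambda>_. 0) ?f"
  have Fbtw: "?F h = (\<Sum>u | u < n \<and> te u = ?c \<and> btw ?q h u. \<pi> u)" for h
  proof -
    have "{u \<in> {u \<in> ?A. btw ?q h u}. te u = ?c} = {u. u < n \<and> te u = ?c \<and> btw ?q h u}"
      using q(4) comp_sub by fast
    then show ?thesis unfolding class_sum_def by (simp add: sum.If_cases Int_def)
  qed
  have Fq: "?F ?q = gain ?c v + rest ?c v" for v
    unfolding Fbtw gain_plus_rest by (rule sum.cong) (use q in auto)
  show ?thesis unfolding own_def block.simps
  proof (rule runs_sx_then)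
    show "runs (Seq dfs (Seq own_init (Seq (acc_sum tt) (Seq own_add (SetIMem bDone (IReg rC) (INum 1)))))) ?M
      (\<lambda>s'. (\<forall>v<n. v \<notin> set S \<longrightarrow>
        rmem s' mGain v = (if v \<in> ?A then rmem s mGain v + gain ?c v else rmem s mGain v) \<and>
        rmem s' mRest v = (if v \<in> ?A then max (rmem s mRest v) (rest ?c v) else rmem s mRest v)) \<and>
        imem s' bDone = (imem s bDone)(?c := 1)) (sx (SetIReg rRoot (ix bS rC)) s)"
      (is "runs _ _ ?Post _")
    proof -
      have s1: "sx (SetIReg rRoot (ix bS rC)) s = ?s1" using C S_cells[OF inp cp] by simp
      have d: "runs dfs ?M (\<lambda>s'. \<exists>L. dfs_out ?q X L s') ?s1"
        using runs_dfs[OF inp1 half1 rem1 qn] q(1) by simp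
      show ?thesis unfolding s1
      proof (rule runs_then[OF d order_refl])
        fix s2 assume "\<exists>L. dfs_out ?q X L s2" and f2: "frame dfs ?s1 s2"
        then obtain L where out2: "dfs_out ?q X L s2" by blast
        have M: "length L + 2 \<le> ?M" "length L \<le> ?M" using length_le_vol[OF out2 qn] q(1) by auto
        have inp2: "input s2" using input_frame[OF inp1 f2] by simp
        have lab2: "labels s2" using labels_frame[OF lab1 f2] by simp
        have 3: "runs own_init ?M (\<lambda>s'. \<forall>v\<in>comp X ?q. rmem s' mAcc v = ?f v) s2"
          unfolding own_init_def
        proof (rule runs_each_fill[OF out2 _ _ _ _ M(1)])
          fix s v assume f: "frame (each (If (IEq (ix bTe rV) (IReg rC))
             (SetRMem mAcc (IReg rV) (RMem mPi (IReg rV))) (SetRMem mAcc (IReg rV) (RNum 0)))) s2 s"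
            and v: "ireg s rV = v" "v \<in> comp X ?q"
          have "v < n" using v comp_sub by auto
          then show "rmem (sx (If (IEq (ix bTe rV) (IReg rC))
             (SetRMem mAcc (IReg rV) (RMem mPi (IReg rV))) (SetRMem mAcc (IReg rV) (RNum 0))) s) 4 = (rmem s mAcc)(v := ?f v)"
            using v lab2 C \<pi>_cells[OF inp2] by (auto simp: frameD[OF f] frameD[OF f2] labels_def)
        qed auto
        show "runs (Seq own_init (Seq (acc_sum tt) (Seq own_add (SetIMem bDone (IReg rC) (INum 1))))) ?M ?Post s2"
        proof (rule runs_then[OF 3 order_refl])
          fix s3 assume s3: "\<forall>v\<in>comp X ?q. rmem s3 mAcc v = ?f v" and f3: "frame own_init s2 s3"
          have out3: "dfs_out ?q X L s3" using dfs_out_frame[OF out2 f3] by simp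
          have 4: "runs (acc_sum tt) ?M (\<lambda>s'. \<forall>v\<in>comp X ?q. rmem s' mAcc v = class_sum (comp X ?q) ?q (\<lambda>_. 0) ?f v) s3"
            by (rule runs_acc_sum[OF out3 qn M(2)]) (use s3 in auto)
          show "runs (Seq (acc_sum tt) (Seq own_add (SetIMem bDone (IReg rC) (INum 1)))) ?M ?Post s3"
          proof (rule runs_then[OF 4 order_refl])
            fix s4 assume "\<forall>v\<in>comp X ?q. rmem s4 mAcc v = class_sum (comp X ?q) ?q (\<lambda>_. 0) ?f v"
              and f4: "frame (acc_sum tt) s3 s4"
            then have F4: "\<forall>v\<in>?A. rmem s4 mAcc v = ?F v" using q(1) by simp
            have out4: "dfs_out ?q X L s4" using dfs_out_frame[OF out3 f4] by simp
            have W4: "rmem s4 mGain = rmem s mGain" "rmem s4 mRest = rmem s mRest" "imem s4 bDone = imem s bDone"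
              "ireg s4 rC = ?c" "ireg s4 rRoot = ?q"
              using C by (simp_all add: frameD[OF f2] frameD[OF f3] frameD[OF f4])
            let ?J = "\<lambda>k t. \<forall>v<n. v \<notin> set S \<longrightarrow>
              rmem t mGain v = (if v \<in> set (take k L) then rmem s mGain v + gain ?c v else rmem s mGain v) \<and>
              rmem t mRest v = (if v \<in> set (take k L) then max (rmem s mRest v) (rest ?c v) else rmem s mRest v)"
            have 5: "runs own_add ?M (?J (length L)) s4"
              unfolding own_add_def
            proof (rule runs_each[OF out4 _ _ _ _ M(1), where J = ?J])
              let ?b = "block
                [SetRMem mGain (IReg rV) (RAdd (RMem mGain (IReg rV)) (RMem mAcc (ix bHp rV))),
                 SetRReg 0 (RSub (RMem mAcc (IReg rRoot)) (RMem mAcc (ix bHp rV))),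
                 If (RLess (RMem mRest (IReg rV)) (RReg 0)) (SetRMem mRest (IReg rV) (RReg 0)) Skip]"
              fix k t assume k: "k < length L" and J: "?J k t" and v: "ireg t rV = L ! k" and f: "frame (each ?b) s4 t"
              let ?v = "L ! k"
              let ?h = "imem s4 bHp ?v"
              have vA: "?v \<in> ?A" "?v < n" using dfs_out_nth[OF out4 k] q(1) by auto
              have vt: "?v \<notin> set (take k L)" using not_in_take k out4 by (auto simp: dfs_out_def)
              have t: "rmem t mAcc = rmem s4 mAcc" "imem t bHp = imem s4 bHp" "ireg t rRoot = ?q"
                using W4 by (simp_all add: frameD[OF f])
              have vS: "rmem s4 mAcc ?h = gain ?c ?v" "rmem s4 mAcc ?q - rmem s4 mAcc ?h = rest ?c ?v" if "?v \<notin> set S"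
              proof -
                have "?v \<noteq> ?q" using that cp nth_mem by metis
                then have h: "btw ?q ?h ?v" "d ?q ?h = Suc (d ?q ?v div 2)"
                  using out4 k nth_mem[OF k] unfolding dfs_out_def by auto
                have "?h \<in> ?A" using comp_btw[OF _ h(1), of X] vA q(1) by simp
                moreover have "gain ?c ?v = ?F ?h" using gain_beyond_half[OF cp h] Fbtw by simp
                moreover have "?q \<in> ?A" using q(1) comp_self[of ?q X] qn by simp
                ultimately show "rmem s4 mAcc ?h = gain ?c ?v" "rmem s4 mAcc ?q - rmem s4 mAcc ?h = rest ?c ?v"
                  using F4 Fq[of ?v] by simp_all
              qed
              show "?J (Suc k) (sx ?b t)" unfolding set_take_Suc[OF k]
              proof (intro allI impI)
                fix u assume u: "u < n" "u \<notin> set S"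
                show "rmem (sx ?b t) mGain u = (if u \<in> insert ?v (set (take k L)) then rmem s mGain u + gain ?c u else rmem s mGain u) \<and>
                  rmem (sx ?b t) mRest u = (if u \<in> insert ?v (set (take k L)) then max (rmem s mRest u) (rest ?c u) else rmem s mRest u)"
                proof (cases "u = ?v")
                  case True
                  then show ?thesis using vS J u vt v t by (simp add: max_def)
                next
                  case False
                  then show ?thesis using J u v by simp
                qed
              qed
            qed (auto simp: W4)
            show "runs (Seq own_add (SetIMem bDone (IReg rC) (INum 1))) ?M ?Post s4"
            proof (rule runs_then[OF 5 order_refl])
              fix s5 assume J: "?J (length L) s5" and f5: "frame own_add s4 s5"
              have "set (take (length L) L) = ?A" using out4 q(1) by (simp add: dfs_out_def)
              then show "runs (SetIMem bDone (IReg rC) (INum 1)) ?M ?Post s5"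
                by (intro runs_sx) (use J M1 W4 in \<open>simp_all add: frameD[OF f5]\<close>)
            qed
          qed
        qed
      qed
    qed
  qed (use M1 in simp_all)
qed

end

section \<open>Buckets\<close>

definition insert_sum :: "nat \<Rightarrow> test \<Rightarrow> iexp \<Rightarrow> com" where
  "insert_sum b g e = each (If g (Seq (SetIReg rK e)
     (SetRMem b (IReg rK) (RAdd (RMem b (IReg rK)) (RMem mPi (IReg rV))))) Skip)"

text \<open>A query asks for the total from a threshold upwards, so the bucket sums are turned into
  suffix sums.\<close>

definition scan_sum :: "nat \<Rightarrow> com" where
  "scan_sum b = for_down rI (IReg rCnt) (SetRMem b (ISub (IReg rI) (INum 1))
     (RAdd (RMem b (ISub (IReg rI) (INum 1))) (RMem b (IReg rI))))"

text \<open>A bucket \<open>k\<close> holds the largest value put into it, the branch \<open>bBi\<close> which that value came from,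
  and the largest value from any other branch. Merging joins the triple in real registers 1, 2 and
  register \<open>rU\<close> to bucket \<open>rK\<close>.\<close>

definition merge :: com where
  "merge = If (RLess (RMem mBest (IReg rK)) (RReg 1))
     (block
       [If (IEq (ix bBi rK) (IReg rU))
          (If (RLess (RMem mNext (IReg rK)) (RReg 2)) (SetRMem mNext (IReg rK) (RReg 2)) Skip)
          (If (RLess (RMem mBest (IReg rK)) (RReg 2)) (SetRMem mNext (IReg rK) (RReg 2)) (SetRMem mNext (IReg rK) (RMem mBest (IReg rK)))),
        SetRMem mBest (IReg rK) (RReg 1),
        SetIMem bBi (IReg rK) (IReg rU)])
     (If (IEq (ix bBi rK) (IReg rU))
        (If (RLess (RMem mNext (IReg rK)) (RReg 2)) (SetRMem mNext (IReg rK) (RReg 2)) Skip)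
        (If (RLess (RMem mNext (IReg rK)) (RReg 1)) (SetRMem mNext (IReg rK) (RReg 1)) Skip))"

definition insert_max :: "test \<Rightarrow> iexp \<Rightarrow> com" where
  "insert_max g e = each (If g (block [SetIReg rK e, SetRReg 1 (RMem mAcc (IReg rV)), SetRReg 2 (RNum 0),
     SetIReg rU (ix bBr rV), merge]) Skip)"

definition scan_max :: com where
  "scan_max = for_up rI (INum 1) (IReg rCnt) (block [SetIReg rK (IReg rI),
     SetRReg 1 (RMem mBest (ISub (IReg rI) (INum 1))), SetRReg 2 (RMem mNext (ISub (IReg rI) (INum 1))),
     SetIReg rU (IMem bBi (ISub (IReg rI) (INum 1))), merge])"

lemma w_scan [simp]:
  "wir (insert_sum b g e) = {rI, rV, rK}" "wim (insert_sum b g e) = {}" "wrr (insert_sum b g e) = {}" "wrm (insert_sum b g e) = {b}"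
  "wir (scan_sum b) = {rI}" "wim (scan_sum b) = {}" "wrr (scan_sum b) = {}" "wrm (scan_sum b) = {b}"
  "wir merge = {}" "wim merge = {bBi}" "wrr merge = {}" "wrm merge = {mBest, mNext}"
  "wir (insert_max g e) = {rI, rV, rK, rU}" "wim (insert_max g e) = {bBi}" "wrr (insert_max g e) = {1, 2}" "wrm (insert_max g e) = {mBest, mNext}"
  "wir scan_max = {rI, rK, rU}" "wim scan_max = {bBi}" "wrr scan_max = {1, 2}" "wrm scan_max = {mBest, mNext}"
  by (auto simp: insert_sum_def scan_sum_def merge_def insert_max_def scan_max_def)

lemma loopfree_merge [simp]: "loopfree merge"
  by (simp add: merge_def)

text \<open>The best value from a branch other than \<open>y\<close>. All claims about buckets go
  through this reading, in which merging is a plain maximum for every \<open>y\<close>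
  simultaneously.\<close>

definition bucket :: "ram_state \<Rightarrow> nat \<Rightarrow> nat \<Rightarrow> real" where
  "bucket s k y = (if imem s bBi k = y then rmem s mNext k else rmem s mBest k)"

definition bucket_ok :: "ram_state \<Rightarrow> nat \<Rightarrow> bool" where
  "bucket_ok s k \<longleftrightarrow> rmem s mNext k \<le> rmem s mBest k"

lemma bucket_upd [simp]:
  "bucket (s\<lparr>ireg := f\<rparr>) = bucket s" "bucket (s\<lparr>rreg := g\<rparr>) = bucket s"
  "bucket_ok (s\<lparr>ireg := f\<rparr>) = bucket_ok s" "bucket_ok (s\<lparr>rreg := g\<rparr>) = bucket_ok s"
  by (auto simp: bucket_def bucket_ok_def fun_eq_iff)

lemma merge:
  assumes "ireg s rK = k" "bucket_ok s k" "rreg s 2 \<le> rreg s 1"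
  shows "bucket (sx merge s) k y = max (bucket s k y) (if ireg s rU = y then rreg s 2 else rreg s 1)"
    and "bucket_ok (sx merge s) k"
    and "i \<noteq> k \<Longrightarrow> bucket (sx merge s) i y = bucket s i y \<and> bucket_ok (sx merge s) i = bucket_ok s i
      \<and> rmem (sx merge s) mBest i = rmem s mBest i \<and> rmem (sx merge s) mNext i = rmem s mNext i \<and> imem (sx merge s) bBi i = imem s bBi i"
  using assms unfolding merge_def bucket_def bucket_ok_def by (auto simp: max_def)

text \<open>The 0 stands for an empty bucket; the values put into buckets are nonnegative, so it
  does not distort their maximum.\<close>

definition max0 :: "('a \<Rightarrow> real) \<Rightarrow> 'a set \<Rightarrow> real" where
  "max0 f Z = Max (insert 0 (f ` Z))"

lemma max0_empty [simp]: "max0 f {} = 0"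
  by (simp add: max0_def)

lemma max0_nonneg: "finite Z \<Longrightarrow> 0 \<le> max0 f Z"
  by (simp add: max0_def)

lemma max0_insert: "finite Z \<Longrightarrow> 0 \<le> f v \<Longrightarrow> max0 f (insert v Z) = max (max0 f Z) (f v)"
  unfolding max0_def by (simp add: insert_commute[of 0] max.commute)

lemma max0_Un: "finite Y \<Longrightarrow> finite Z \<Longrightarrow> max0 f (Y \<union> Z) = max (max0 f Y) (max0 f Z)"
  unfolding max0_def using Max_Un[of "insert 0 (f ` Y)" "insert 0 (f ` Z)"] by (simp add: image_Un)

context ram_instance
begin

lemma runs_insert_sum:
  assumes out: "dfs_out r X L s0" and inp: "input s0" and b: "b \<noteq> 0" and M: "length L + 2 \<le> M"
    and zero: "\<And>i. i < length L \<Longrightarrow> rmem s0 b i = 0"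
    and g: "\<And>s v. frame (insert_sum b g e) s0 s \<Longrightarrow> ireg s rV = v \<Longrightarrow> v \<in> comp X r \<Longrightarrow> tval g s \<longleftrightarrow> P v"
    and e: "\<And>s v. frame (insert_sum b g e) s0 s \<Longrightarrow> ireg s rV = v \<Longrightarrow> v \<in> comp X r \<Longrightarrow> P v \<Longrightarrow> ival e s = j v"
  shows "runs (insert_sum b g e) M (\<lambda>s'. \<forall>i<length L. rmem s' b i = (\<Sum>v | v \<in> comp X r \<and> P v \<and> j v = i. \<pi> v)) s0"
proof -
  let ?Z = "\<lambda>k i. {v \<in> set (take k L). P v \<and> j v = i}"
  let ?J = "\<lambda>k (s :: ram_state). \<forall>i<length L. rmem s b i = sum \<pi> (?Z k i)"
  let ?c = "If g (Seq (SetIReg rK e) (SetRMem b (IReg rK) (RAdd (RMem b (IReg rK)) (RMem mPi (IReg rV))))) Skip"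
  have "runs (insert_sum b g e) M (?J (length L)) s0"
    unfolding insert_sum_def
  proof (rule runs_each[OF out _ _ _ _ M, where J = ?J])
    fix k and s :: ram_state assume k: "k < length L" and J: "?J k s" and v: "ireg s rV = L ! k" and f: "frame (each ?c) s0 s"
    let ?v = "L ! k"
    have vA: "?v \<in> comp X r" "?v < n" using dfs_out_nth[OF out k] by auto
    have vt: "?v \<notin> set (take k L)" using not_in_take k out by (auto simp: dfs_out_def)
    have f': "frame (insert_sum b g e) s0 s" using f by (simp add: insert_sum_def)
    have pi: "rmem s mPi ?v = \<pi> ?v" using \<pi>_cells[OF inp vA(2)] b by (simp add: frameD[OF f])
    show "?J (Suc k) (sx ?c s)"
    proof (cases "P ?v")
      case False
      then have "?Z (Suc k) i = ?Z k i" for i unfolding set_take_Suc[OF k] by auto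
      then show ?thesis using J g[OF f' v vA(1)] False by simp
    next
      case True
      have "?Z (Suc k) i = (if j ?v = i then insert ?v (?Z k i) else ?Z k i)" for i
        unfolding set_take_Suc[OF k] using True by auto
      then have "sum \<pi> (?Z (Suc k) i) = (if j ?v = i then \<pi> ?v + sum \<pi> (?Z k i) else sum \<pi> (?Z k i))" for i
        using vt by simp
      then show ?thesis using J g[OF f' v vA(1)] e[OF f' v vA(1) True] True v pi by simp
    qed
  qed (use zero in auto)
  then show ?thesis by (rule runs_mono) (use out in \<open>auto simp: dfs_out_def\<close>)
qed

lemma runs_scan_sum:
  assumes out: "dfs_out r X L s0" and r: "r < n" "r \<notin> X" and M: "length L \<le> M"
    and f: "\<And>i. i < length L \<Longrightarrow> rmem s0 b i = (\<Sum>v | v \<in> comp X r \<and> P v \<and> j v = i. \<pi> v)"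
    and j: "\<And>v. v \<in> comp X r \<Longrightarrow> P v \<Longrightarrow> j v < length L"
  shows "runs (scan_sum b) M (\<lambda>s'. \<forall>i<length L. rmem s' b i = (\<Sum>v | v \<in> comp X r \<and> P v \<and> i \<le> j v. \<pi> v)) s0"
proof -
  let ?f = "\<lambda>i. \<Sum>v | v \<in> comp X r \<and> P v \<and> j v = i. \<pi> v"
  let ?g = "\<lambda>i. \<Sum>v | v \<in> comp X r \<and> P v \<and> i \<le> j v. \<pi> v"
  have gS: "?g i = ?f i + ?g (Suc i)" for i
  proof -
    have "{v. v \<in> comp X r \<and> P v \<and> i \<le> j v} = {v. v \<in> comp X r \<and> P v \<and> j v = i} \<union> {v. v \<in> comp X r \<and> P v \<and> Suc i \<le> j v}"
      by auto
    then show ?thesis by (simp add: sum.union_disjoint[symmetric] del: Suc_le_eq) (subst sum.union_disjoint; auto)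
  qed
  have g0: "?g i = 0" if "length L \<le> i" for i
  proof -
    have "{v. v \<in> comp X r \<and> P v \<and> i \<le> j v} = {}" using j that by fastforce
    then show ?thesis by (simp only: sum.empty)
  qed
  \<comment> \<open>After the round with counter \<open>k\<close> cell \<open>k - 1\<close> has just
    been updated, so the cells from \<open>k - 1\<close> on hold suffix sums. The last cell is its
    own suffix sum from the start.\<close>
  let ?J = "\<lambda>k (s :: ram_state). \<forall>i<length L. rmem s b i = (if k \<le> Suc i then ?g i else ?f i)"
  have "runs (scan_sum b) M (?J 1) s0"
    unfolding scan_sum_def
  proof (rule runs_for_down[where I = ?J and m = "length L"])
    show "1 \<le> length L" using dfs_out_0(1)[OF out r] by linarith
    show "?J (length L) (s0\<lparr>ireg := (ireg s0)(rI := length L)\<rparr>)"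
    proof (intro allI impI)
      fix i assume i: "i < length L"
      show "rmem (s0\<lparr>ireg := (ireg s0)(rI := length L)\<rparr>) b i = (if length L \<le> Suc i then ?g i else ?f i)"
        using f[OF i] gS[of i] g0[of "Suc i"] by simp
    qed
  next
    fix k and s :: ram_state assume k: "1 \<le> k" "k < length L" "ireg s rI = k" and J: "?J (Suc k) (s\<lparr>ireg := (ireg s)(rI := Suc k)\<rparr>)"
    have J': "rmem s b i = (if k \<le> i then ?g i else ?f i)" if "i < length L" for i
      using J that by simp
    obtain k' where k': "k = Suc k'" using k by (cases k) auto
    show "?J k (sx (SetRMem b (ISub (IReg rI) (INum 1)) (RAdd (RMem b (ISub (IReg rI) (INum 1))) (RMem b (IReg rI)))) s)"
    proof (intro allI impI)
      fix i assume i: "i < length L"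
      show "rmem (sx (SetRMem b (ISub (IReg rI) (INum 1)) (RAdd (RMem b (ISub (IReg rI) (INum 1))) (RMem b (IReg rI)))) s) b i
        = (if k \<le> Suc i then ?g i else ?f i)"
        using J'[of i] J'[of k] gS[of k'] i k k' by (cases "i = k'") auto
    qed
  qed (use out M in \<open>auto simp: dfs_out_def\<close>)
  then show ?thesis by (rule runs_mono) auto
qed

lemma runs_insert_max:
  assumes out: "dfs_out r X L s0" and M: "length L + 2 \<le> M"
    and init: "\<And>i. i < length L \<Longrightarrow> rmem s0 mBest i = 0 \<and> rmem s0 mNext i = 0"
    and F: "\<And>v. v \<in> comp X r \<Longrightarrow> rmem s0 mAcc v = F v \<and> 0 \<le> F v" and br: "\<And>v. v \<in> comp X r \<Longrightarrow> imem s0 bBr v = br v"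
    and g: "\<And>s v. frame (insert_max g e) s0 s \<Longrightarrow> ireg s rV = v \<Longrightarrow> v \<in> comp X r \<Longrightarrow> tval g s \<longleftrightarrow> P v"
    and e: "\<And>s v. frame (insert_max g e) s0 s \<Longrightarrow> ireg s rV = v \<Longrightarrow> v \<in> comp X r \<Longrightarrow> P v \<Longrightarrow> ival e s = j v"
    and j: "\<And>v. v \<in> comp X r \<Longrightarrow> P v \<Longrightarrow> j v < length L"
  shows "runs (insert_max g e) M (\<lambda>s'. \<forall>i<length L. bucket_ok s' i \<and>
      (\<forall>y. bucket s' i y = max0 F {v \<in> comp X r. P v \<and> j v = i \<and> br v \<noteq> y})) s0"
proof -
  let ?Z = "\<lambda>k i y. {v \<in> set (take k L). P v \<and> j v = i \<and> br v \<noteq> y}"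
  let ?J = "\<lambda>k (s :: ram_state). \<forall>i<length L. bucket_ok s i \<and> (\<forall>y. bucket s i y = max0 F (?Z k i y))"
  let ?c = "If g (block [SetIReg rK e, SetRReg 1 (RMem mAcc (IReg rV)), SetRReg 2 (RNum 0),
     SetIReg rU (ix bBr rV), merge]) Skip"
  have "runs (insert_max g e) M (?J (length L)) s0"
    unfolding insert_max_def
  proof (rule runs_each[OF out _ _ _ _ M, where J = ?J])
    show "?J k (s\<lparr>ireg := (ireg s)(rI := x, rV := y)\<rparr>) = ?J k s" for k s x y
      by (simp add: bucket_def bucket_ok_def)
    show "?J 0 s0" using init by (simp add: bucket_def bucket_ok_def)
  next
    fix k and s :: ram_state assume k: "k < length L" and J: "?J k s" and v: "ireg s rV = L ! k" and f: "frame (each ?c) s0 s"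
    let ?v = "L ! k"
    have vA: "?v \<in> comp X r" using dfs_out_nth[OF out k] by auto
    have f': "frame (insert_max g e) s0 s" using f by (simp add: insert_max_def)
    show "?J (Suc k) (sx ?c s)"
    proof (cases "P ?v")
      case False
      then have "?Z (Suc k) i y = ?Z k i y" for i y unfolding set_take_Suc[OF k] by auto
      then show ?thesis using J g[OF f' v vA(1)] False by simp
    next
      case True
      let ?s = "s\<lparr>rreg := (rreg s)(1 := F ?v, 2 := 0), ireg := (ireg s)(rK := j ?v, rU := br ?v)\<rparr>"
      have s: "sx ?c s = sx merge ?s"
        using g[OF f' v vA] e[OF f' v vA True] True v F[OF vA] br[OF vA] by (simp add: frameD[OF f])
      have Z: "?Z (Suc k) i y = (if j ?v = i \<and> br ?v \<noteq> y then insert ?v (?Z k i y) else ?Z k i y)" for i y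
        unfolding set_take_Suc[OF k] using True by auto
      have Zm: "max0 F (?Z (Suc k) i y) = (if j ?v = i \<and> br ?v \<noteq> y then max (max0 F (?Z k i y)) (F ?v) else max0 F (?Z k i y))" for i y
        unfolding Z using F[OF vA] max0_insert[of "?Z k i y" F ?v] by simp
      have jl: "j ?v < length L" using j[OF vA True] .
      have pre: "ireg ?s rK = j ?v" "bucket_ok ?s (j ?v)" "rreg ?s 2 \<le> rreg ?s 1"
        using J jl F[OF vA] by (simp_all)
      define t where "t = sx merge ?s"
      have m1: "bucket t (j ?v) y = max (bucket s (j ?v) y) (if br ?v = y then 0 else F ?v)" for y
        using merge(1)[OF pre, of y] by (simp add: t_def)
      have m2: "bucket_ok t (j ?v)" using merge(2)[OF pre] by (simp add: t_def)
      have m3: "bucket t i y = bucket s i y \<and> bucket_ok t i = bucket_ok s i" if "i \<noteq> j ?v" for i y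
        using merge(3)[OF pre that, of y] by (simp add: t_def)
      show ?thesis unfolding s Zm t_def[symmetric]
      proof (intro allI impI conjI)
        fix i assume i: "i < length L"
        show "bucket_ok t i" using m2 m3[of i] J i by (cases "i = j ?v") auto
        fix y
        have nn: "max (max0 F (?Z k i y)) 0 = max0 F (?Z k i y)"
          using max0_nonneg[of "?Z k i y" F] by simp
        show "bucket t i y = (if j ?v = i \<and> br ?v \<noteq> y then max (max0 F (?Z k i y)) (F ?v) else max0 F (?Z k i y))"
        proof (cases "i = j ?v")
          case True
          have "bucket s i y = max0 F (?Z k i y)" using J i by blast
          then show ?thesis using m1[of y] nn unfolding True by simp
        next
          case False
          have "bucket s i y = max0 F (?Z k i y)" using J i by blast
          then show ?thesis using m3[OF False, of y] False by auto
        qed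
      qed
    qed
  qed auto
  then show ?thesis by (rule runs_mono) (use out in \<open>auto simp: dfs_out_def\<close>)
qed

text \<open>Prefix maxima, because \<open>v\<close> leaves the vertices whose difference is at most
  \<open>d x v\<close>. One pass serves all excluded branches \<open>y\<close>, since merging acts
  as a maximum on each reading \<open>bucket s i y\<close>.\<close>

lemma runs_scan_max:
  assumes out: "dfs_out r X L s0" and r: "r < n" "r \<notin> X" and M: "length L + 2 \<le> M"
    and init: "\<And>i y. i < length L \<Longrightarrow> bucket_ok s0 i \<and> bucket s0 i y = max0 F {v \<in> comp X r. P v \<and> j v = i \<and> br v \<noteq> y}"
  shows "runs scan_max M (\<lambda>s'. \<forall>i<length L. \<forall>y. bucket s' i y = max0 F {v \<in> comp X r. P v \<and> j v \<le> i \<and> br v \<noteq> y}) s0"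
proof -
  let ?f = "\<lambda>i y. max0 F {v \<in> comp X r. P v \<and> j v = i \<and> br v \<noteq> y}"
  let ?g = "\<lambda>i y. max0 F {v \<in> comp X r. P v \<and> j v \<le> i \<and> br v \<noteq> y}"
  have gS: "?g (Suc i) y = max (?f (Suc i) y) (?g i y)" for i y
  proof -
    have "{v \<in> comp X r. P v \<and> j v \<le> Suc i \<and> br v \<noteq> y} =
      {v \<in> comp X r. P v \<and> j v = Suc i \<and> br v \<noteq> y} \<union> {v \<in> comp X r. P v \<and> j v \<le> i \<and> br v \<noteq> y}"
      by auto
    then show ?thesis by (simp add: max0_Un)
  qed
  let ?J = "\<lambda>k (s :: ram_state). \<forall>i<length L. bucket_ok s i \<and> (\<forall>y. bucket s i y = (if i < k then ?g i y else ?f i y))"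
  let ?c = "block [SetIReg rK (IReg rI),
     SetRReg 1 (RMem mBest (ISub (IReg rI) (INum 1))), SetRReg 2 (RMem mNext (ISub (IReg rI) (INum 1))),
     SetIReg rU (IMem bBi (ISub (IReg rI) (INum 1))), merge]"
  have "runs scan_max M (?J (length L)) s0"
    unfolding scan_max_def
  proof (rule runs_for_up[where I = ?J and m = "length L" and ?k0.0 = 1])
    show "1 \<le> length L" using dfs_out_0(1)[OF out r] by linarith
    show "?J 1 (s0\<lparr>ireg := (ireg s0)(rI := 1)\<rparr>)" using init by (simp add: bucket_def bucket_ok_def)
  next
    fix k and s :: ram_state assume k: "1 \<le> k" "k < length L" "ireg s rI = k" and J: "?J k s"
    obtain k' where k': "k = Suc k'" using k by (cases k) auto
    let ?s = "s\<lparr>rreg := (rreg s)(1 := rmem s mBest k', 2 := rmem s mNext k'), ireg := (ireg s)(rK := k, rU := imem s bBi k')\<rparr>"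
    have s: "sx ?c s = sx merge ?s" using k k' by simp
    have ok: "rmem s mNext k' \<le> rmem s mBest k'" using J k k' by (simp add: bucket_ok_def)
    have pre: "ireg ?s rK = k" "bucket_ok ?s k" "rreg ?s 2 \<le> rreg ?s 1"
      using J k ok by (simp_all)
    define t where "t = sx merge ?s"
    have m1: "bucket t k y = max (bucket s k y) (if imem s bBi k' = y then rmem s mNext k' else rmem s mBest k')" for y
      using merge(1)[OF pre, of y] by (simp add: t_def)
    have m2: "bucket_ok t k" using merge(2)[OF pre] by (simp add: t_def)
    have m3: "bucket t i y = bucket s i y \<and> bucket_ok t i = bucket_ok s i" if "i \<noteq> k" for i y
      using merge(3)[OF pre that, of y] by (simp add: t_def)
    show "?J (Suc k) ((sx ?c s)\<lparr>ireg := (ireg (sx ?c s))(rI := Suc k)\<rparr>)"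
      unfolding bucket_upd s t_def[symmetric]
    proof (intro allI impI conjI)
      fix i assume i: "i < length L"
      show "bucket_ok t i" using m2 m3[of i] J i by (cases "i = k") auto
      fix y
      have s_i: "bucket s i y = (if i < k then ?g i y else ?f i y)" using J i by blast
      show "bucket t i y = (if i < Suc k then ?g i y else ?f i y)"
      proof (cases "i = k")
        case True
        have "(if imem s bBi k' = y then rmem s mNext k' else rmem s mBest k') = ?g k' y"
          using J k k' unfolding bucket_def[symmetric] by simp
        then have "bucket t k y = max (bucket s k y) (?g k' y)" using m1[of y] by (simp only:)
        then show ?thesis using s_i gS[of k' y] unfolding True k' by simp
      next
        case False
        then show ?thesis using m3[OF False, of y] s_i by auto
      qed
    qed
  qed (use out M in \<open>auto simp: dfs_out_def frame_def\<close>)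
  then show ?thesis by (rule runs_mono) auto
qed

end

section \<open>The other territories of a component\<close>

text \<open>Truncation at 0 is harmless: compared with a natural threshold, the truncated
  \<open>D u - d x u\<close> decides as the integer difference would.\<close>

abbreviation (input) excess :: iexp where "excess \<equiv> ISub (ix bD rV) (ix bDep rV)"
abbreviation (input) imin :: "iexp \<Rightarrow> iexp \<Rightarrow> iexp" where "imin a b \<equiv> ISub a (ISub a b)"
abbreviation (input) live :: test where "live \<equiv> IEq (IMem bDone (ix bTe rV)) (INum 0)"

definition split_init :: com where
  "split_init = each (block [SetRMem mAcc (IReg rV) (RMem mPi (IReg rV)), SetIMem bBz (IReg rV) (INum 0),
     SetRMem mTotal (IReg rI) (RNum 0), SetRMem mOwn (IReg rI) (RNum 0),
     SetRMem mBest (IReg rI) (RNum 0), SetRMem mNext (IReg rI) (RNum 0)])"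

text \<open>Parents come first in the order, so a vertex inherits the branch of its parent, and only
  the neighbours of the centroid start new ones.\<close>

definition branches :: com where
  "branches = each (If (ILess (INum 0) (ix bDep rV))
     (Seq (If (IEq (ix bDep rV) (INum 1)) (SetIMem bBr (IReg rV) (IReg rV))
         (SetIMem bBr (IReg rV) (IMem bBr (ix bPar rV))))
       (SetIMem bBz (ix bBr rV) (IAdd (IMem bBz (ix bBr rV)) (INum 1))))
     (SetIMem bBr (IReg rV) (IReg rV)))"

text \<open>Running totals of the branch sizes yield disjoint segments. The same pass pushes the
  neighbours of the centroid, which are the roots of the new components.\<close>

definition bases :: com where
  "bases = each (If (IEq (ix bDep rV) (INum 1))
     (block [SetIMem bBase (IReg rV) (IReg rK), SetIReg rK (IAdd (IReg rK) (ix bBz rV)),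
       SetIMem bWl (IReg rWp) (IReg rV), SetIReg rWp (IAdd (IReg rWp) (INum 1))])
     Skip)"

text \<open>The index is the difference minus 1, because \<open>v\<close> wins \<open>u\<close> iff
  \<open>d x v\<close> is strictly below the difference. The cap at the number of vertices keeps the
  index in range, and every depth is below it.\<close>

definition insert_total :: com where
  "insert_total = insert_sum mTotal (And live (ILess (INum 0) excess)) (ISub (imin excess (IReg rCnt)) (INum 1))"

text \<open>Within a branch depths start at 1, so a difference of 1 is never won there, and index 0
  of the segment belongs to difference 2; hence the subtraction of 2.\<close>

definition insert_branch :: com where
  "insert_branch = insert_sum mOwn (And live (ILess (INum 1) excess))
     (ISub (IAdd (IMem bBase (ix bBr rV)) (imin excess (IAdd (IMem bBz (ix bBr rV)) (INum 1)))) (INum 2))"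

definition insert_beyond :: com where
  "insert_beyond = insert_max (And live (ILess excess (IReg rCnt))) excess"

text \<open>The part of the own branch is a difference of two suffix sums, one starting inside its
  segment and one at its end. For the centroid itself nothing is subtracted.\<close>

definition query :: com where
  "query = each (block [SetIReg rU (ix bBr rV),
     If (ILess (INum 0) (ix bDep rV))
       (SetRReg 0 (RSub (RMem mOwn (ISub (IAdd (ix bBase rU) (ix bDep rV)) (INum 1)))
          (RMem mOwn (IAdd (ix bBase rU) (ix bBz rU)))))
       (SetRReg 0 (RNum 0)),
     SetRMem mGain (IReg rV) (RAdd (RMem mGain (IReg rV)) (RSub (RMem mTotal (ix bDep rV)) (RReg 0))),
     If (IEq (IMem bBi (ix bDep rV)) (IReg rU)) (SetRReg 0 (RMem mNext (ix bDep rV))) (SetRReg 0 (RMem mBest (ix bDep rV))),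
     If (RLess (RMem mRest (IReg rV)) (RReg 0)) (SetRMem mRest (IReg rV) (RReg 0)) Skip])"

definition split :: com where
  "split = block [SetIReg rRoot (IReg rX), dfs, split_init, acc_sum (IEq (ix bTe rV) (ix bTe rU)), branches,
     SetIReg rK (INum 0), bases, insert_total, insert_branch, insert_beyond,
     scan_sum mTotal, scan_sum mOwn, scan_max, query, SetIMem bRem (IReg rX) (INum 1)]"

lemma w_split [simp]:
  "wir split_init = {rI, rV}" "wim split_init = {bBz}" "wrr split_init = {}" "wrm split_init = {mAcc, mTotal, mOwn, mBest, mNext}"
  "wir branches = {rI, rV}" "wim branches = {bBr, bBz}" "wrr branches = {}" "wrm branches = {}"
  "wir bases = {rI, rV, rK, rWp}" "wim bases = {bBase, bWl}" "wrr bases = {}" "wrm bases = {}"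
  "wir insert_total = {rI, rV, rK}" "wim insert_total = {}" "wrr insert_total = {}" "wrm insert_total = {mTotal}"
  "wir insert_branch = {rI, rV, rK}" "wim insert_branch = {}" "wrr insert_branch = {}" "wrm insert_branch = {mOwn}"
  "wir insert_beyond = {rI, rV, rK, rU}" "wim insert_beyond = {bBi}" "wrr insert_beyond = {1, 2}" "wrm insert_beyond = {mBest, mNext}"
  "wir query = {rI, rV, rU}" "wim query = {}" "wrr query = {0}" "wrm query = {mGain, mRest}"
  "wir split = {rRoot, rV, rU, rE, rCnt, rSp, rI, rK, rWp}"
  "wim split = {bPar, bDep, bOrd, bStk, bSk, bHp, bBz, bBr, bBase, bWl, bBi, bRem}"
  "wrr split = {0, 1, 2}" "wrm split = {mGain, mRest, mAcc, mTotal, mOwn, mBest, mNext}"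
  by (auto simp: split_init_def branches_def bases_def insert_total_def insert_branch_def insert_beyond_def
      query_def split_def)

lemma takeWhile_neq_nth: "distinct xs \<Longrightarrow> i < length xs \<Longrightarrow> takeWhile (\<lambda>u. u \<noteq> xs ! i) xs = take i xs"
  by (rule takeWhile_eq_take_P_nth) (auto simp: nth_eq_iff_index_eq)

lemma imin_min: "(a::nat) - (a - b) = min a b"
  by simp

context ram_instance
begin

lemma nx_parent:
  assumes "x < n" "v < n" "v \<noteq> x" "nx v x \<noteq> x"
  shows "nx x (nx v x) = nx x v"
proof -
  let ?u = "nx v x" let ?y = "nx x ?u"
  have u: "?u < n" "d v ?u = 1" "d v x = Suc (d ?u x)" using nx[of v x] assms by auto
  have y: "?y < n" "d x ?y = 1" "d x ?u = Suc (d ?y ?u)" using nx[of x ?u] assms u by auto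
  have s: "d v x = d x v" "d ?u x = d x ?u" "d ?u v = d v ?u" using d_sym assms u by auto
  have "d ?y v \<le> d ?y ?u + d ?u v" using d_tri y u assms by simp
  then have "d ?y v \<le> d x v" using u y s by simp
  then show ?thesis using nx_unique[of x v ?y] y assms by auto
qed

lemma branch_step:
  assumes "x < n" "v < n" "v \<noteq> x"
  shows "branch x v = (if d x v = 1 then v else branch x (nx v x))"
proof (cases "d x v = 1")
  case True
  then show ?thesis using nx_adj[of x v] assms by (simp add: branch_def)
next
  case False
  have "d v (nx v x) = 1" "nx v x < n" using nx[of v x] assms by auto
  then have "nx v x \<noteq> x" using False d_sym[of v x] assms by auto
  then show ?thesis using nx_parent[OF assms] False assms by (simp add: branch_def)
qed

lemma branch_btw:
  assumes "btw x w v" "w \<noteq> x"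
  shows "branch x w = branch x v" "v \<noteq> x"
proof -
  have V: "x < n" "w < n" "v < n" using assms btwD by auto
  show "v \<noteq> x" using assms btw_refl by auto
  let ?y = "nx x w"
  have y: "?y < n" "d x ?y = 1" "d x w = Suc (d ?y w)" using nx[of x w] V assms by auto
  have "d ?y v \<le> d ?y w + d w v" using d_tri V y by simp
  then have "d ?y v \<le> d x v" using assms(1) y by (simp add: btw_def)
  then have "?y = nx x v" using nx_unique[of x v ?y] V y \<open>v \<noteq> x\<close> by simp
  then show "branch x w = branch x v" using assms \<open>v \<noteq> x\<close> by (simp add: branch_def)
qed

definition worklist :: "nat list \<Rightarrow> ram_state \<Rightarrow> bool" where
  "worklist R s \<longleftrightarrow> ireg s rWp = length R \<and> (\<forall>i<length R. imem s bWl i = R ! i)"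

end

section \<open>The layout of the branches at a centroid\<close>

locale centroid_step = ram_instance +
  fixes x :: nat and X :: "nat set"
  assumes x: "x < n" "x \<notin> X"
begin

abbreviation "A \<equiv> comp X x"

definition bz :: "nat \<Rightarrow> nat" where
  "bz y = card {v \<in> A. v \<noteq> x \<and> branch x v = y}"

text \<open>Total size of the branches whose first vertex occurs in \<open>L\<close>; on a prefix of
  the search order it is the address at which the next segment begins.\<close>

definition prior :: "nat list \<Rightarrow> nat" where
  "prior L = sum_list (map bz (filter (\<lambda>v. d x v = 1) L))"

definition base :: "nat list \<Rightarrow> nat \<Rightarrow> nat" where
  "base L y = prior (takeWhile (\<lambda>u. u \<noteq> y) L)"

lemma branch_child:
  assumes "v \<in> A" "v \<noteq> x"
  shows "branch x v \<in> A" "d x (branch x v) = 1" "branch x v \<noteq> x"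
proof -
  have V: "v < n" using assms comp_sub by auto
  have y: "nx x v < n" "d x (nx x v) = 1" "d x v = Suc (d (nx x v) v)" using nx[of x v] V x assms by auto
  then have "btw x (nx x v) v" using V x by (simp add: btw_def)
  then show "branch x v \<in> A" using comp_btw assms by (simp add: branch_def)
  show "d x (branch x v) = 1" using y assms by (simp add: branch_def)
  then show "branch x v \<noteq> x" using x by auto
qed

lemma branch_eq_x: "v \<in> A \<Longrightarrow> branch x v = x \<longleftrightarrow> v = x"
  using branch_child(3) by (auto simp: branch_def)

text \<open>The path from \<open>x\<close> to \<open>v\<close> contributes a vertex of the branch
  for each distance from 1 to \<open>d x v\<close>. Hence a query address stays within the segment
  of the branch.\<close>

lemma depth_le_bz:
  assumes "v \<in> A" "v \<noteq> x"
  shows "d x v \<le> bz (branch x v)"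
proof -
  let ?B = "{u \<in> A. u \<noteq> x \<and> branch x u = branch x v}"
  have V: "v < n" using assms comp_sub by auto
  have "{1..d x v} \<subseteq> d x ` ?B"
  proof
    fix k assume k: "k \<in> {1..d x v}"
    then obtain w where w: "btw x w v" "d x w = k" using path_vertex[OF x(1) V] by auto
    have ne: "w \<noteq> x" using w(2) k x by auto
    then have "w \<in> ?B" using branch_btw[OF w(1) ne] comp_btw[OF assms(1) w(1)] by auto
    then show "k \<in> d x ` ?B" using w(2) by blast
  qed
  then have "card {1..d x v} \<le> card ?B" by (intro surj_card_le) auto
  then show ?thesis by (simp add: bz_def)
qed

lemma bz_pos: "v \<in> A \<Longrightarrow> v \<noteq> x \<Longrightarrow> 1 \<le> bz (branch x v)"
  using depth_le_bz[of v] d_0[of x v] x comp_sub by fastforce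

text \<open>The branches partition the component without \<open>x\<close>. The one spare cell makes
  the end \<open>base + bz\<close> of even the last segment a valid address.\<close>

lemma prior_total:
  assumes "distinct L" "set L = A"
  shows "Suc (prior L) = length L"
proof -
  have "prior L = (\<Sum>y\<in>{v \<in> A. d x v = 1}. \<Sum>v\<in>{v \<in> A - {x}. branch x v = y}. 1)"
    using assms unfolding prior_def bz_def
    by (subst sum_list_distinct_conv_sum_set) (auto intro!: sum.cong arg_cong[where f = card])
  also have "\<dots> = (\<Sum>v\<in>A - {x}. 1)"
    by (rule sum.group) (use branch_child in auto)
  also have "\<dots> = card A - 1" using comp_self[of x X] x by simp
  finally show ?thesis using assms distinct_card[of L] card_comp_pos[OF x] by simp
qed

lemma prior_append [simp]: "prior (K @ L) = prior K + prior L"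
  by (simp add: prior_def)

lemma base_nth:
  assumes "distinct L" "i < length L"
  shows "base L (L ! i) = prior (take i L)"
  using takeWhile_neq_nth[OF assms] by (simp add: base_def)

lemma base_next:
  assumes "distinct L" "i < j" "j \<le> length L" "d x (L ! i) = 1"
  shows "base L (L ! i) + bz (L ! i) \<le> prior (take j L)"
proof -
  have "take j L = take i L @ [L ! i] @ drop (Suc i) (take j L)"
    using assms id_take_nth_drop[of i "take j L"] by simp
  then have "prior (take j L) = prior (take i L) + (prior [L ! i] + prior (drop (Suc i) (take j L)))"
    by (metis prior_append)
  then show ?thesis using assms base_nth[of L i] by (simp add: prior_def)
qed

lemma base_bound:
  assumes "distinct L" "set L = A" "y \<in> A" "d x y = 1"
  shows "base L y + bz y < length L"
proof -
  obtain i where i: "i < length L" "y = L ! i" using assms by (metis in_set_conv_nth)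
  show ?thesis using base_next[OF assms(1) i(1) order_refl] prior_total[OF assms(1,2)] i assms(4) by simp
qed

lemma base_disjoint:
  assumes L: "distinct L" "set L = A" and y: "y \<in> A" "d x y = 1" "z \<in> A" "d x z = 1"
    and k: "base L y \<le> k" "k < base L y + bz y" "base L z \<le> k" "k < base L z + bz z"
  shows "y = z"
proof -
  obtain i where i: "i < length L" "y = L ! i" using L y by (metis in_set_conv_nth)
  obtain j where j: "j < length L" "z = L ! j" using L y by (metis in_set_conv_nth)
  have "\<not> i < j" using base_next[OF L(1), of i j] base_nth[OF L(1) j(1)] i j y k by auto
  moreover have "\<not> j < i" using base_next[OF L(1), of j i] base_nth[OF L(1) i(1)] i j y k by auto
  ultimately show ?thesis using i j by (metis nat_neq_iff)
qed

text \<open>Every branch owns a segment of \<open>mOwn\<close> as long as the branch has vertices; larger differences need not be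
  distinguished because no vertex of the branch is farther from \<open>x\<close>.\<close>

definition slot :: "nat list \<Rightarrow> nat \<Rightarrow> nat" where
  "slot L u = base L (branch x u) + min (D u - d x u) (Suc (bz (branch x u))) - 2"

lemma slot_range:
  assumes "u \<in> A" "u \<noteq> x" "1 < D u - d x u"
  shows "base L (branch x u) \<le> slot L u" "slot L u < base L (branch x u) + bz (branch x u)"
  using bz_pos[OF assms(1,2)] assms(3) by (auto simp: slot_def)

text \<open>Both sums contain all later segments, which cancel; what remains is the own segment from
  position \<open>d x v - 1\<close> on. The cap in \<open>slot\<close> does not interfere because
  \<open>d x v\<close> is at most \<open>bz\<close>.\<close>

lemma branch_segment_sum:
  fixes P :: "nat \<Rightarrow> bool"
  assumes L: "distinct L" "set L = A" and v: "v \<in> A" "v \<noteq> x" and P: "\<not> P x"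
  shows "(\<Sum>u | u \<in> A \<and> (P u \<and> 1 < D u - d x u) \<and> base L (branch x v) + d x v - 1 \<le> slot L u. \<pi> u)
    - (\<Sum>u | u \<in> A \<and> (P u \<and> 1 < D u - d x u) \<and> base L (branch x v) + bz (branch x v) \<le> slot L u. \<pi> u)
    = (\<Sum>u | u \<in> A \<and> P u \<and> branch x u = branch x v \<and> d x v + d x u < D u. \<pi> u)"
proof -
  let ?y = "branch x v" and ?t = "d x v"
  let ?P = "\<lambda>u. u \<in> A \<and> (P u \<and> 1 < D u - d x u)"
  let ?S1 = "{u. ?P u \<and> base L ?y + ?t - 1 \<le> slot L u}"
  let ?S2 = "{u. ?P u \<and> base L ?y + bz ?y \<le> slot L u}"
  let ?S3 = "{u. u \<in> A \<and> P u \<and> branch x u = ?y \<and> ?t + d x u < D u}"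
  note y = branch_child[OF v]
  have "v < n" using v comp_sub by auto
  then have "0 < d x v" using d_0[of x v] x v by auto
  then have t: "1 \<le> ?t" "?t \<le> bz ?y" using depth_le_bz[OF v] by auto
  have S1: "?S1 = ?S2 \<union> ?S3"
  proof (intro set_eqI iffI)
    fix u assume u: "u \<in> ?S1"
    then have ux: "u \<noteq> x" using P by auto
    note r = slot_range[OF _ ux, of L] and yu = branch_child[of u, OF _ ux]
    show "u \<in> ?S2 \<union> ?S3"
    proof (cases "base L ?y + bz ?y \<le> slot L u")
      case False
      have "branch x u = ?y"
        by (rule base_disjoint[OF L yu(1,2) y(1,2), of "slot L u"]) (use u False r t in auto)
      then show ?thesis using u t False by (auto simp: slot_def)
    qed (use u in auto)
  next
    fix u assume u: "u \<in> ?S2 \<union> ?S3"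
    show "u \<in> ?S1"
    proof (cases "u \<in> ?S2")
      case True
      then show ?thesis using t by auto
    next
      case False
      then have "u \<in> ?S3" using u by blast
      then show ?thesis using t by (auto simp: slot_def)
    qed
  qed
  have disj: "?S2 \<inter> ?S3 = {}"
  proof (intro equals0I)
    fix u assume u: "u \<in> ?S2 \<inter> ?S3"
    then have ux: "u \<noteq> x" using P by auto
    show False using slot_range[OF _ ux, of L] u by auto
  qed
  have "finite ?S2" "finite ?S3" by simp_all
  from sum.union_disjoint[OF this disj, of \<pi>]
  have "sum \<pi> ?S1 = sum \<pi> ?S2 + sum \<pi> ?S3" by (simp only: S1)
  then show ?thesis by (simp add: conj_assoc)
qed

text \<open>The table of finished territories already includes that of \<open>x\<close>, since
  \<open>own\<close> runs before \<open>split\<close>; so the buckets do not treat the territory of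
  the centroid again.\<close>

definition ctx :: "nat list \<Rightarrow> ram_state \<Rightarrow> bool" where
  "ctx L s \<longleftrightarrow> dfs_out x X L s \<and> input s \<and> labels s \<and> done_table (insert x X) s"

lemma ctx_frame:
  assumes "ctx L s" "frame c s s'" "wir c \<inter> {rN, rP, rCnt} = {}"
    "wim c \<inter> {bOff, bAdj, bS, bD, bTe, bOrd, bPar, bDep, bHp, bDone} = {}" "wrm c \<inter> {mPi} = {}"
  shows "ctx L s'"
proof -
  have s: "dfs_out x X L s" "input s" "labels s" "done_table (insert x X) s" using assms(1) by (auto simp: ctx_def)
  have "dfs_out x X L s'" by (rule dfs_out_frame[OF s(1) assms(2)]) (use assms(3,4) in blast)+
  moreover have "input s'" by (rule input_frame[OF s(2) assms(2)]) (use assms(3-5) in blast)+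
  moreover have "labels s'" by (rule labels_frame[OF s(3) assms(2)]) (use assms(4) in blast)
  moreover have "done_table (insert x X) s'" by (rule done_table_frame[OF s(4) assms(2)]) (use assms(4) in blast)
  ultimately show ?thesis by (simp add: ctx_def)
qed

lemma ctxD:
  assumes "ctx L s"
  shows "dfs_out x X L s" "input s" "distinct L" "set L = A" "ireg s rCnt = length L"
    "v \<in> A \<Longrightarrow> imem s bDep v = d x v" "v \<in> A \<Longrightarrow> imem s bD v = D v" "v \<in> A \<Longrightarrow> imem s bTe v = te v"
    "v \<in> A \<Longrightarrow> imem s bDone (te v) = 0 \<longleftrightarrow> undone (insert x X) (te v)"
  using assms subsetD[OF comp_sub, of v X x] te_lt[of v]
  unfolding ctx_def dfs_out_def labels_def done_table_def by auto

lemma runs_split_init: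
  assumes c: "ctx L s" and M: "length L + 2 \<le> M"
  shows "runs split_init M (\<lambda>s'. (\<forall>v\<in>A. rmem s' mAcc v = \<pi> v \<and> imem s' bBz v = 0) \<and>
     (\<forall>i<length L. rmem s' mTotal i = 0 \<and> rmem s' mOwn i = 0 \<and> rmem s' mBest i = 0 \<and> rmem s' mNext i = 0)) s"
proof -
  let ?J = "\<lambda>k (s :: ram_state). (\<forall>v\<in>set (take k L). rmem s mAcc v = \<pi> v \<and> imem s bBz v = 0) \<and>
     (\<forall>i<k. rmem s mTotal i = 0 \<and> rmem s mOwn i = 0 \<and> rmem s mBest i = 0 \<and> rmem s mNext i = 0)"
  let ?c = "block [SetRMem mAcc (IReg rV) (RMem mPi (IReg rV)), SetIMem bBz (IReg rV) (INum 0),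
     SetRMem mTotal (IReg rI) (RNum 0), SetRMem mOwn (IReg rI) (RNum 0),
     SetRMem mBest (IReg rI) (RNum 0), SetRMem mNext (IReg rI) (RNum 0)]"
  have "runs split_init M (?J (length L)) s" unfolding split_init_def
  proof (rule runs_each[OF ctxD(1)[OF c] _ _ _ _ M, where J = ?J])
    fix k t assume k: "k < length L" "?J k t" "ireg t rV = L ! k" "ireg t rI = k" and f: "frame (each ?c) s t"
    have "rmem t mPi (L ! k) = \<pi> (L ! k)"
      using \<pi>_cells[OF ctxD(2)[OF c]] dfs_out_nth(1)[OF ctxD(1)[OF c] k(1)] by (simp add: frameD[OF f])
    then show "?J (Suc k) (sx ?c t)" using k by (auto simp: set_take_Suc less_Suc_eq)
  qed auto
  then show ?thesis by (rule runs_mono) (use ctxD(4)[OF c] in auto)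
qed

lemma runs_branches:
  assumes c: "ctx L s" and M: "length L + 2 \<le> M" and z: "\<And>v. v \<in> A \<Longrightarrow> imem s bBz v = 0"
  shows "runs branches M (\<lambda>s'. \<forall>v\<in>A. imem s' bBr v = branch x v \<and> (d x v = 1 \<longrightarrow> imem s' bBz v = bz v)) s"
proof -
  let ?B = "\<lambda>k y. {v \<in> set (take k L). v \<noteq> x \<and> branch x v = y}"
  let ?J = "\<lambda>k (s :: ram_state). (\<forall>v\<in>set (take k L). imem s bBr v = branch x v) \<and>
     (\<forall>y\<in>A. d x y = 1 \<longrightarrow> imem s bBz y = card (?B k y))"
  let ?c = "If (ILess (INum 0) (ix bDep rV))
     (Seq (If (IEq (ix bDep rV) (INum 1)) (SetIMem bBr (IReg rV) (IReg rV))
         (SetIMem bBr (IReg rV) (IMem bBr (ix bPar rV))))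
       (SetIMem bBz (ix bBr rV) (IAdd (IMem bBz (ix bBr rV)) (INum 1))))
     (SetIMem bBr (IReg rV) (IReg rV))"
  have "runs branches M (?J (length L)) s" unfolding branches_def
  proof (rule runs_each[OF ctxD(1)[OF c] _ _ _ _ M, where J = ?J])
    fix k t assume k: "k < length L" and J: "?J k t" and v: "ireg t rV = L ! k" and f: "frame (each ?c) s t"
    let ?v = "L ! k"
    have vA: "?v \<in> A" "?v < n" using dfs_out_nth[OF ctxD(1)[OF c] k] by auto
    have dep: "imem t bDep ?v = d x ?v" using ctxD(6)[OF c vA(1)] by (simp add: frameD[OF f])
    have vt: "?v \<notin> set (take k L)" using not_in_take ctxD(3)[OF c] k by auto
    show "?J (Suc k) (sx ?c t)"
    proof (cases "?v = x")
      case True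
      then have "?B (Suc k) y = ?B k y" for y unfolding set_take_Suc[OF k] by auto
      then show ?thesis using J dep True v x by (simp add: set_take_Suc[OF k] branch_def)
    next
      case False
      have k1: "1 \<le> k" using dfs_out_0(2)[OF ctxD(1)[OF c] x] False by (cases k) auto
      have par: "imem t bPar ?v = nx ?v x"
        using dfs_out_parent(2)[OF ctxD(1)[OF c] x k1 k] by (simp add: frameD[OF f])
      obtain j where "j < k" "nx ?v x = L ! j" using dfs_out_parent(3)[OF ctxD(1)[OF c] x k1 k] by blast
      then have pk: "nx ?v x \<in> set (take k L)" using k by (auto simp: in_set_conv_nth)
      have d0: "d x ?v \<noteq> 0" using d_0[of x ?v] x vA False by auto
      let ?y = "branch x ?v"
      have y: "?y \<in> A" "d x ?y = 1" using branch_child[OF vA(1) False] by auto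
      have "(if d x ?v = 1 then ?v else imem t bBr (nx ?v x)) = ?y"
        using branch_step[OF x(1) vA(2) False] J pk by auto
      then have s: "sx ?c t = t\<lparr>imem := (imem t)(bBr := (imem t bBr)(?v := ?y),
          bBz := (imem t bBz)(?y := Suc (imem t bBz ?y)))\<rparr>"
        using v dep par d0 by auto
      have "?B (Suc k) z = (if z = ?y then insert ?v (?B k z) else ?B k z)" for z
        unfolding set_take_Suc[OF k] using False by auto
      then have B: "card (?B (Suc k) z) = (if z = ?y then Suc (card (?B k z)) else card (?B k z))" for z
        using vt by simp
      show ?thesis unfolding s B using J y by (simp add: set_take_Suc[OF k])
    qed
  qed (use z in auto)
  then show ?thesis by (rule runs_mono) (use ctxD(4)[OF c] in \<open>auto simp: bz_def\<close>)
qed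

lemma runs_bases:
  assumes c: "ctx L s" and M: "length L + 2 \<le> M" and z: "\<And>v. v \<in> A \<Longrightarrow> d x v = 1 \<Longrightarrow> imem s bBz v = bz v"
    and wl: "worklist R s" and K: "ireg s rK = 0"
  shows "runs bases M (\<lambda>s'. (\<forall>y\<in>A. d x y = 1 \<longrightarrow> imem s' bBase y = base L y) \<and>
    worklist (R @ filter (\<lambda>v. d x v = 1) L) s') s"
proof -
  let ?J = "\<lambda>k (s :: ram_state). (\<forall>i<k. d x (L ! i) = 1 \<longrightarrow> imem s bBase (L ! i) = base L (L ! i)) \<and>
    worklist (R @ filter (\<lambda>v. d x v = 1) (take k L)) s \<and> ireg s rK = prior (take k L)"
  let ?c = "If (IEq (ix bDep rV) (INum 1))
     (block [SetIMem bBase (IReg rV) (IReg rK), SetIReg rK (IAdd (IReg rK) (ix bBz rV)),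
       SetIMem bWl (IReg rWp) (IReg rV), SetIReg rWp (IAdd (IReg rWp) (INum 1))])
     Skip"
  have "runs bases M (?J (length L)) s" unfolding bases_def
  proof (rule runs_each[OF ctxD(1)[OF c] _ _ _ _ M, where J = ?J])
    fix k t assume k: "k < length L" and J: "?J k t" and v: "ireg t rV = L ! k" and f: "frame (each ?c) s t"
    let ?v = "L ! k"
    have vA: "?v \<in> A" "?v < n" using dfs_out_nth[OF ctxD(1)[OF c] k] by auto
    have dep: "imem t bDep ?v = d x ?v" using ctxD(6)[OF c vA(1)] by (simp add: frameD[OF f])
    have ne: "L ! i \<noteq> ?v" if "i < k" for i
      using that k ctxD(3)[OF c] nth_eq_iff_index_eq[of L i k] by simp
    have tk: "take (Suc k) L = take k L @ [?v]" using k by (simp add: take_Suc_conv_app_nth)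
    show "?J (Suc k) (sx ?c t)"
    proof (cases "d x ?v = 1")
      case False
      then show ?thesis using J v dep by (simp add: tk less_Suc_eq prior_def)
    next
      case True
      have bzv: "imem t bBz ?v = bz ?v" using z[OF vA(1) True] by (simp add: frameD[OF f])
      have b: "base L ?v = prior (take k L)" using base_nth[OF ctxD(3)[OF c] k] .
      show ?thesis
        using J v dep True bzv b ne by (auto simp: tk less_Suc_eq prior_def worklist_def nth_append)
    qed
  qed (use wl K in \<open>auto simp: worklist_def prior_def\<close>)
  then show ?thesis
  proof (rule runs_mono)
    fix s' assume J: "?J (length L) s'"
    have "imem s' bBase y = base L y" if "y \<in> A" "d x y = 1" for y
    proof -
      have "y \<in> set L" using that ctxD(4)[OF c] by simp
      then obtain i where "i < length L" "y = L ! i" unfolding in_set_conv_nth by blast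
      then show ?thesis using J \<open>d x y = 1\<close> by auto
    qed
    then show "(\<forall>y\<in>A. d x y = 1 \<longrightarrow> imem s' bBase y = base L y) \<and>
      worklist (R @ filter (\<lambda>v. d x v = 1) L) s'" using J by simp
  qed simp
qed

end

section \<open>The bucket passes over the branches of a centroid\<close>

context centroid_step
begin

abbreviation U :: "nat \<Rightarrow> bool" where "U u \<equiv> undone (insert x X) (te u)"

abbreviation total_at :: "nat list \<Rightarrow> nat \<Rightarrow> real" where
  "total_at L i \<equiv> \<Sum>v | v \<in> A \<and> (U v \<and> 0 < D v - d x v) \<and> min (D v - d x v) (length L) - 1 = i. \<pi> v"

abbreviation total_from :: "nat list \<Rightarrow> nat \<Rightarrow> real" where
  "total_from L i \<equiv> \<Sum>v | v \<in> A \<and> (U v \<and> 0 < D v - d x v) \<and> i \<le> min (D v - d x v) (length L) - 1. \<pi> v"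

abbreviation own_at :: "nat list \<Rightarrow> nat \<Rightarrow> real" where
  "own_at L i \<equiv> \<Sum>v | v \<in> A \<and> (U v \<and> 1 < D v - d x v) \<and> slot L v = i. \<pi> v"

abbreviation own_from :: "nat list \<Rightarrow> nat \<Rightarrow> real" where
  "own_from L i \<equiv> \<Sum>v | v \<in> A \<and> (U v \<and> 1 < D v - d x v) \<and> i \<le> slot L v. \<pi> v"

abbreviation best_at :: "nat list \<Rightarrow> nat \<Rightarrow> nat \<Rightarrow> real" where
  "best_at L i y \<equiv> max0 (class_sum A x te \<pi>) {v \<in> A. (U v \<and> D v - d x v < length L) \<and> D v - d x v = i \<and> branch x v \<noteq> y}"

abbreviation best_upto :: "nat list \<Rightarrow> nat \<Rightarrow> nat \<Rightarrow> real" where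
  "best_upto L i y \<equiv> max0 (class_sum A x te \<pi>) {v \<in> A. (U v \<and> D v - d x v < length L) \<and> D v - d x v \<le> i \<and> branch x v \<noteq> y}"

lemma not_U_x: "\<not> U x"
  by (auto simp: undone_def)

definition won :: "nat \<Rightarrow> real" where
  "won v = (\<Sum>u | u \<in> A \<and> U u \<and> branch x u \<noteq> branch x v \<and> d x v + d x u < D u. \<pi> u)"

definition lost :: "nat \<Rightarrow> real" where
  "lost v = max0 (beyond x) {u \<in> A. U u \<and> branch x u \<noteq> branch x v \<and> D u \<le> d x v + d x u}"

lemma won_total:
  "(\<Sum>u | u \<in> A \<and> U u \<and> d x v + d x u < D u. \<pi> u) =
    (\<Sum>u | u \<in> A \<and> U u \<and> branch x u = branch x v \<and> d x v + d x u < D u. \<pi> u) + won v"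
proof -
  have "{u. u \<in> A \<and> U u \<and> d x v + d x u < D u} =
    {u. u \<in> A \<and> U u \<and> branch x u = branch x v \<and> d x v + d x u < D u} \<union>
    {u. u \<in> A \<and> U u \<and> branch x u \<noteq> branch x v \<and> d x v + d x u < D u}" by blast
  then show ?thesis unfolding won_def by (simp only:) (rule sum.union_disjoint; auto)
qed

lemma depth_less: "ctx L s \<Longrightarrow> v \<in> A \<Longrightarrow> d x v < length L"
proof (cases "v = x")
  case True
  assume "ctx L s" "v \<in> A"
  then show ?thesis using True x dfs_out_0(1)[OF ctxD(1) x] by simp
next
  case False
  assume c: "ctx L s" and v: "v \<in> A"
  show ?thesis using depth_le_bz[OF v False] base_bound[OF ctxD(3,4)[OF c] branch_child(1,2)[OF v False]] by linarith
qed

lemma runs_insert_total: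
  assumes c: "ctx L s" and M: "length L + 2 \<le> M" and z: "\<And>i. i < length L \<Longrightarrow> rmem s mTotal i = 0"
  shows "runs insert_total M (\<lambda>s'. \<forall>i<length L. rmem s' mTotal i =
    total_at L i) s"
  unfolding insert_total_def
proof (rule runs_insert_sum[OF ctxD(1,2)[OF c] _ M z])
  fix t v assume f: "frame (insert_sum mTotal (And live (ILess (INum 0) excess)) (ISub (imin excess (IReg rCnt)) (INum 1))) s t"
    and v: "ireg t rV = v" "v \<in> A"
  note f' = frameD[OF f]
  show "tval (And live (ILess (INum 0) excess)) t = (U v \<and> 0 < D v - d x v)"
    using v ctxD(6-9)[OF c v(2)] by (simp add: f')
  show "ival (ISub (imin excess (IReg rCnt)) (INum 1)) t = min (D v - d x v) (length L) - 1"
    using v ctxD(5)[OF c] ctxD(6-9)[OF c v(2)] by (simp add: f' imin_min)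
qed simp

lemma runs_insert_branch:
  assumes c: "ctx L s" and M: "length L + 2 \<le> M" and z: "\<And>i. i < length L \<Longrightarrow> rmem s mOwn i = 0"
    and br: "\<And>v. v \<in> A \<Longrightarrow> imem s bBr v = branch x v"
    and ba: "\<And>y. y \<in> A \<Longrightarrow> d x y = 1 \<Longrightarrow> imem s bBase y = base L y \<and> imem s bBz y = bz y"
  shows "runs insert_branch M (\<lambda>s'. \<forall>i<length L. rmem s' mOwn i =
    own_at L i) s"
  unfolding insert_branch_def
proof (rule runs_insert_sum[OF ctxD(1,2)[OF c] _ M z])
  fix t v assume f: "frame (insert_sum mOwn (And live (ILess (INum 1) excess))
     (ISub (IAdd (IMem bBase (ix bBr rV)) (imin excess (IAdd (IMem bBz (ix bBr rV)) (INum 1)))) (INum 2))) s t"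
    and v: "ireg t rV = v" "v \<in> A"
  note f' = frameD[OF f]
  show "tval (And live (ILess (INum 1) excess)) t = (U v \<and> 1 < D v - d x v)"
    using v ctxD(6-9)[OF c v(2)] by (simp add: f')
  assume P: "U v \<and> 1 < D v - d x v"
  then have "v \<noteq> x" using not_U_x by metis
  note b = branch_child[OF v(2) this]
  show "ival (ISub (IAdd (IMem bBase (ix bBr rV)) (imin excess (IAdd (IMem bBz (ix bBr rV)) (INum 1)))) (INum 2)) t = slot L v"
    using v ba[OF b(1,2)] br[OF v(2)] ctxD(6-9)[OF c v(2)] by (simp add: f' imin_min slot_def)
qed simp

lemma runs_insert_beyond:
  assumes c: "ctx L s" and M: "length L + 2 \<le> M" and z: "\<And>i. i < length L \<Longrightarrow> rmem s mBest i = 0 \<and> rmem s mNext i = 0"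
    and br: "\<And>v. v \<in> A \<Longrightarrow> imem s bBr v = branch x v" and F: "\<And>v. v \<in> A \<Longrightarrow> rmem s mAcc v = F v \<and> 0 \<le> F v"
  shows "runs insert_beyond M (\<lambda>s'. \<forall>i<length L. bucket_ok s' i \<and> (\<forall>y. bucket s' i y =
    max0 F {v \<in> A. (U v \<and> D v - d x v < length L) \<and> D v - d x v = i \<and> branch x v \<noteq> y})) s"
  unfolding insert_beyond_def
proof (rule runs_insert_max[OF ctxD(1)[OF c] M z F br])
  fix t v assume f: "frame (insert_max (And live (ILess excess (IReg rCnt))) excess) s t"
    and v: "ireg t rV = v" "v \<in> A"
  note f' = frameD[OF f]
  show "tval (And live (ILess excess (IReg rCnt))) t = (U v \<and> D v - d x v < length L)"
    using v ctxD(5)[OF c] ctxD(6-9)[OF c v(2)] by (simp add: f')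
  show "ival excess t = D v - d x v"
    using v ctxD(6-9)[OF c v(2)] by (simp add: f')
qed auto

lemma class_sum_nonneg: "0 \<le> class_sum A x te \<pi> v"
  unfolding class_sum_def by (rule sum_nonneg) (use \<pi>_nonneg comp_sub in auto)

text \<open>An unmet territory has no vertex outside the component, so restricting the sum to it
  loses nothing. For a met one the equation may fail; the test \<open>live\<close> keeps such
  vertices out of the buckets.\<close>

lemma class_sum_beyond:
  assumes "v \<in> A" "U v"
  shows "class_sum A x te \<pi> v = beyond x v"
  unfolding class_sum_def beyond_def
proof (rule sum.cong)
  have und: "undone X (te v)" using assms(2) by (auto simp: undone_def)
  have "u \<in> A" if "u < n" "te u = te v" for u
    using comp_territory(4)[OF x(1) assms(1) und that] .
  then show "{u \<in> A. btw x v u \<and> te u = te v} = {u' \<in> {..<n}. te u' = te v \<and> btw x v u'}"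
    using comp_sub by auto
qed simp

lemma runs_query:
  assumes c: "ctx L s" and M: "length L + 2 \<le> M"
    and br: "\<And>v. v \<in> A \<Longrightarrow> imem s bBr v = branch x v"
    and ba: "\<And>y. y \<in> A \<Longrightarrow> d x y = 1 \<Longrightarrow> imem s bBase y = base L y \<and> imem s bBz y = bz y"
    and tot: "\<And>i. i < length L \<Longrightarrow> rmem s mTotal i =
      total_from L i"
    and own: "\<And>i. i < length L \<Longrightarrow> rmem s mOwn i =
      own_from L i"
    and bk: "\<And>i y. i < length L \<Longrightarrow> bucket s i y =
      best_upto L i y"
  shows "runs query M (\<lambda>s'. \<forall>v<n. rmem s' mGain v = (if v \<in> A then rmem s mGain v + won v else rmem s mGain v) \<and>
     rmem s' mRest v = (if v \<in> A then max (rmem s mRest v) (lost v) else rmem s mRest v)) s"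
proof -
  let ?J = "\<lambda>k (t :: ram_state). \<forall>v<n. rmem t mGain v = (if v \<in> set (take k L) then rmem s mGain v + won v else rmem s mGain v) \<and>
     rmem t mRest v = (if v \<in> set (take k L) then max (rmem s mRest v) (lost v) else rmem s mRest v)"
  let ?c = "block [SetIReg rU (ix bBr rV),
     If (ILess (INum 0) (ix bDep rV))
       (SetRReg 0 (RSub (RMem mOwn (ISub (IAdd (ix bBase rU) (ix bDep rV)) (INum 1)))
          (RMem mOwn (IAdd (ix bBase rU) (ix bBz rU)))))
       (SetRReg 0 (RNum 0)),
     SetRMem mGain (IReg rV) (RAdd (RMem mGain (IReg rV)) (RSub (RMem mTotal (ix bDep rV)) (RReg 0))),
     If (IEq (IMem bBi (ix bDep rV)) (IReg rU)) (SetRReg 0 (RMem mNext (ix bDep rV))) (SetRReg 0 (RMem mBest (ix bDep rV))),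
     If (RLess (RMem mRest (IReg rV)) (RReg 0)) (SetRMem mRest (IReg rV) (RReg 0)) Skip]"
  have "runs query M (?J (length L)) s" unfolding query_def
  proof (rule runs_each[OF ctxD(1)[OF c] _ _ _ _ M, where J = ?J])
    fix k and t :: ram_state assume k: "k < length L" and J: "?J k t" and v: "ireg t rV = L ! k" and f: "frame (each ?c) s t"
    define v where "v = L ! k"
    have vA: "v \<in> A" "v < n" using dfs_out_nth[OF ctxD(1)[OF c] k] unfolding v_def by auto
    have vt: "v \<notin> set (take k L)" using not_in_take ctxD(3)[OF c] k unfolding v_def by auto
    note f' = frameD[OF f]
    let ?t = "d x v" and ?y = "branch x v"
    have tl: "?t < length L" using depth_less[OF c vA(1)] .
    have dep: "imem t bDep v = ?t" "imem t bBr v = ?y" using ctxD(6)[OF c vA(1)] br[OF vA(1)] by (simp_all add: f')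
    have T: "rmem t mTotal ?t = (\<Sum>u | u \<in> A \<and> U u \<and> ?t + d x u < D u. \<pi> u)"
    proof -
      have "rmem t mTotal ?t = rmem s mTotal ?t" by (simp add: f')
      \<comment> \<open>The cap in the bucket index is invisible here, since the queried depth is
        below \<open>length L\<close>.\<close>
      also have "\<dots> = (\<Sum>u | u \<in> A \<and> U u \<and> ?t + d x u < D u. \<pi> u)"
        unfolding tot[OF tl] by (rule sum.cong) (use tl in auto)
      finally show ?thesis .
    qed
    have B: "(if imem t bBi ?t = ?y then rmem t mNext ?t else rmem t mBest ?t) = lost v"
    proof -
      have "(if imem t bBi ?t = ?y then rmem t mNext ?t else rmem t mBest ?t) = bucket s ?t ?y"
        by (simp add: f' bucket_def)
      \<comment> \<open>Vertices whose difference is at least \<open>length L\<close> were never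
        inserted; no depth is large enough to ask for them.\<close>
      also have "\<dots> = max0 (class_sum A x te \<pi>) {u \<in> A. U u \<and> branch x u \<noteq> ?y \<and> D u \<le> ?t + d x u}"
        unfolding bk[OF tl] by (rule arg_cong[where f = "max0 (class_sum A x te \<pi>)"]) (use tl in auto)
      also have "\<dots> = lost v"
        unfolding lost_def max0_def using class_sum_beyond by (intro arg_cong[where f = Max] arg_cong2[where f = insert] image_cong) auto
      finally show ?thesis .
    qed
    have W: "rmem t mTotal ?t - (if 0 < ?t then rmem t mOwn (imem t bBase ?y + ?t - 1) - rmem t mOwn (imem t bBase ?y + imem t bBz ?y) else 0) = won v"
    proof (cases "v = x")
      case True
      have bx: "branch x x = x" by (simp add: branch_def)
      \<comment> \<open>The branch of the centroid consists of the centroid alone, whose territory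
        counts as met.\<close>
      have "{u. u \<in> A \<and> U u \<and> branch x u = branch x x \<and> d x x + d x u < D u} = {}"
        unfolding bx using branch_eq_x not_U_x by blast
      then show ?thesis using T won_total[of v] True x by (simp only: sum.empty) simp
    next
      case False
      note b = branch_child[OF vA(1) False]
      have t0: "0 < ?t" using d_0[of x v] x vA(2) False by auto
      have m: "imem t bBase ?y = base L ?y" "imem t bBz ?y = bz ?y" using ba[OF b(1,2)] by (simp_all add: f')
      have l: "base L ?y + bz ?y < length L" using base_bound[OF ctxD(3,4)[OF c] b(1,2)] .
      then have l': "base L ?y + ?t - 1 < length L" using depth_le_bz[OF vA(1) False] by linarith
      have "rmem t mOwn (base L ?y + ?t - 1) - rmem t mOwn (base L ?y + bz ?y) =
        (\<Sum>u | u \<in> A \<and> U u \<and> branch x u = ?y \<and> ?t + d x u < D u. \<pi> u)"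
        using branch_segment_sum[OF ctxD(3,4)[OF c] vA(1) False, of U] not_U_x own[OF l] own[OF l'] by (simp add: f')
      then show ?thesis using T won_total[of v] t0 m by simp
    qed
    have s2: "rmem (sx ?c t) mGain = (rmem t mGain)(v := rmem t mGain v + won v)"
      unfolding W[symmetric] using v dep by (simp add: v_def[symmetric])
    have s3: "rmem (sx ?c t) mRest = (rmem t mRest)(v := max (rmem t mRest v) (lost v))"
    proof -
      have "rmem (sx ?c t) mRest = (if rmem t mRest v < lost v then (rmem t mRest)(v := lost v) else rmem t mRest)"
        unfolding B[symmetric] using v dep by (cases "0 < ?t"; cases "imem t bBi ?t = ?y") (simp_all add: v_def[symmetric])
      then show ?thesis by (simp add: max_def fun_upd_idem not_less order_less_imp_le)
    qed
    show "?J (Suc k) (sx ?c t)"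
      unfolding s2 s3 set_take_Suc[OF k] v_def[symmetric] using J vt by simp
  qed auto
  then show ?thesis by (rule runs_mono) (use ctxD(4)[OF c] in auto)
qed

lemma runs_split:
  assumes inp: "input s" and half: "half_table s" and rem: "removed X s" and lab: "labels s"
    and dt: "done_table (insert x X) s" and X: "ireg s rX = x" and wl: "worklist R s"
  shows "runs split (vol A) (\<lambda>s'. removed (insert x X) s' \<and>
    (\<forall>v<n. rmem s' mGain v = (if v \<in> A then rmem s mGain v + won v else rmem s mGain v) \<and>
     rmem s' mRest v = (if v \<in> A then max (rmem s mRest v) (lost v) else rmem s mRest v)) \<and>
    (\<exists>K. distinct K \<and> set K = {y \<in> A. d x y = 1} \<and> worklist (R @ K) s')) s"
    (is "runs split ?M ?Post s")
proof -
  let ?s1 = "s\<lparr>ireg := (ireg s)(rRoot := x)\<rparr>"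
  have inp1: "input ?s1" "half_table ?s1" "removed X ?s1" "labels ?s1" "done_table (insert x X) ?s1"
    using inp half rem lab dt by (simp_all add: input_def half_table_def removed_def labels_def done_table_def)
  have M1: "1 \<le> ?M" using vol_ge_card[of A] card_comp_pos[OF x] by simp
  have d: "runs dfs ?M (\<lambda>s'. \<exists>L. dfs_out x X L s') ?s1"
    using runs_dfs[OF inp1(1-3) x] by simp
  let ?acc = "acc_sum (IEq (ix bTe rV) (ix bTe rU))"
  let ?c12 = "Seq query (SetIMem bRem (IReg rX) (INum 1))"
  let ?c11 = "Seq scan_max ?c12"
  let ?c10 = "Seq (scan_sum mOwn) ?c11"
  let ?c9 = "Seq (scan_sum mTotal) ?c10"
  let ?c8 = "Seq insert_beyond ?c9"
  let ?c7 = "Seq insert_branch ?c8"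
  let ?c6 = "Seq insert_total ?c7"
  let ?c5 = "Seq bases ?c6"
  let ?c4 = "Seq (SetIReg rK (INum 0)) ?c5"
  let ?c3 = "Seq branches ?c4"
  let ?c2 = "Seq ?acc ?c3"
  let ?c1 = "Seq split_init ?c2"
  have r: "runs (Seq dfs ?c1) ?M ?Post ?s1"
  proof (rule runs_then[OF d order_refl])
    fix s2 assume "\<exists>L. dfs_out x X L s2" and f2: "frame dfs ?s1 s2"
    then obtain L where out2: "dfs_out x X L s2" by blast
    have M: "length L + 2 \<le> ?M" "length L \<le> ?M" using length_le_vol[OF out2 x] by auto
    have c2: "ctx L s2"
      using out2 input_frame[OF inp1(1) f2] labels_frame[OF inp1(4) f2] done_table_frame[OF inp1(5) f2]
      by (simp add: ctx_def)
    let ?K = "filter (\<lambda>v. d x v = 1) L"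
    show "runs ?c1 ?M ?Post s2"
    proof (rule runs_then[OF runs_split_init[OF c2 M(1)] order_refl], elim conjE)
      fix s3 assume pi3: "\<forall>v\<in>A. rmem s3 mAcc v = \<pi> v \<and> imem s3 bBz v = 0"
        and z3: "\<forall>i<length L. rmem s3 mTotal i = 0 \<and> rmem s3 mOwn i = 0 \<and> rmem s3 mBest i = 0 \<and> rmem s3 mNext i = 0"
        and f3: "frame split_init s2 s3"
      have c3: "ctx L s3" using ctx_frame[OF c2 f3] by simp
      have a: "runs ?acc ?M (\<lambda>s'. \<forall>v\<in>A. rmem s' mAcc v = class_sum A x te \<pi> v) s3"
      proof (rule runs_acc_sum[OF ctxD(1)[OF c3] x M(2)])
        show "te z = te v" if "btw v z u" "te u = te v" for v z u
          using te_connected[of v u z] that by simp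
        fix t v assume f: "frame ?acc s3 t" and v: "v < n" "nx v x < n" "ireg t rV = v" "ireg t rU = nx v x"
        have "labels t" using c3 labels_frame[OF _ f] by (simp add: ctx_def)
        then show "tval (IEq (ix bTe rV) (ix bTe rU)) t = (te v = te (nx v x))"
          using v by (simp add: labels_def)
      qed (use pi3 in auto)
      show "runs ?c2 ?M ?Post s3"
      proof (rule runs_then[OF a order_refl])
        fix s4 assume F4: "\<forall>v\<in>A. rmem s4 mAcc v = class_sum A x te \<pi> v" and f4: "frame ?acc s3 s4"
        have c4: "ctx L s4" using ctx_frame[OF c3 f4] by simp
        have z4: "\<And>v. v \<in> A \<Longrightarrow> imem s4 bBz v = 0" using pi3 by (simp add: frameD[OF f4])
        show "runs ?c3 ?M ?Post s4"
        proof (rule runs_then[OF runs_branches[OF c4 M(1) z4] order_refl])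
          fix s5 assume br5: "\<forall>v\<in>A. imem s5 bBr v = branch x v \<and> (d x v = 1 \<longrightarrow> imem s5 bBz v = bz v)"
            and f5: "frame branches s4 s5"
          let ?s6 = "s5\<lparr>ireg := (ireg s5)(rK := 0)\<rparr>"
          have c6: "ctx L ?s6" using ctx_frame[OF c4 f5]
            by (simp add: ctx_def dfs_out_def input_def labels_def done_table_def)
          have wl6: "worklist R ?s6" using wl
            by (simp add: worklist_def frameD[OF f2] frameD[OF f3] frameD[OF f4] frameD[OF f5])
          have bz6: "\<And>v. v \<in> A \<Longrightarrow> d x v = 1 \<Longrightarrow> imem ?s6 bBz v = bz v" using br5 by simp
          have b: "runs bases ?M (\<lambda>s'. (\<forall>y\<in>A. d x y = 1 \<longrightarrow> imem s' bBase y = base L y) \<and> worklist (R @ ?K) s') ?s6"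
            by (rule runs_bases[OF c6 M(1) bz6 wl6]) simp_all
          have r5: "runs ?c5 ?M ?Post ?s6"
          proof (rule runs_then[OF b order_refl], elim conjE)
            fix s7 assume ba7: "\<forall>y\<in>A. d x y = 1 \<longrightarrow> imem s7 bBase y = base L y" and wl7: "worklist (R @ ?K) s7"
              and f7: "frame bases ?s6 s7"
            have c7: "ctx L s7" using ctx_frame[OF c6 f7] by simp
            have z7: "\<And>i. i < length L \<Longrightarrow> rmem s7 mTotal i = 0 \<and> rmem s7 mOwn i = 0 \<and> rmem s7 mBest i = 0 \<and> rmem s7 mNext i = 0"
              using z3 by (simp add: frameD[OF f4] frameD[OF f5] frameD[OF f7])
            have br7: "\<And>v. v \<in> A \<Longrightarrow> imem s7 bBr v = branch x v" using br5 by (simp add: frameD[OF f7])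
            have bb7: "\<And>y. y \<in> A \<Longrightarrow> d x y = 1 \<Longrightarrow> imem s7 bBase y = base L y \<and> imem s7 bBz y = bz y"
              using br5 ba7 by (simp add: frameD[OF f7])
            have F7: "\<And>v. v \<in> A \<Longrightarrow> rmem s7 mAcc v = class_sum A x te \<pi> v \<and> 0 \<le> class_sum A x te \<pi> v"
              using F4 class_sum_nonneg by (simp add: frameD[OF f5] frameD[OF f7])
            have X7: "ireg s7 rX = x" "rmem s7 mGain = rmem s mGain" "rmem s7 mRest = rmem s mRest" "imem s7 bRem = imem s bRem"
              using X by (simp_all add: frameD[OF f2] frameD[OF f3] frameD[OF f4] frameD[OF f5] frameD[OF f7])
            have "runs insert_total ?M (\<lambda>s'. \<forall>i<length L. rmem s' mTotal i =
              total_at L i) s7"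
              by (rule runs_insert_total[OF c7 M(1)]) (use z7 in simp)
            then show "runs ?c6 ?M ?Post s7"
            proof (rule runs_then[OF _ order_refl])
              fix s8 assume t8: "\<forall>i<length L. rmem s8 mTotal i =
                total_at L i"
                and f8: "frame insert_total s7 s8"
              have c8: "ctx L s8" using ctx_frame[OF c7 f8] by simp
              have "runs insert_branch ?M (\<lambda>s'. \<forall>i<length L. rmem s' mOwn i =
                own_at L i) s8"
                by (rule runs_insert_branch[OF c8 M(1)]) (use z7 br7 bb7 in \<open>simp_all add: frameD[OF f8]\<close>)
              then show "runs ?c7 ?M ?Post s8"
              proof (rule runs_then[OF _ order_refl])
                fix s9 assume t9: "\<forall>i<length L. rmem s9 mOwn i =
                  own_at L i"
                  and f9: "frame insert_branch s8 s9"
                have c9: "ctx L s9" using ctx_frame[OF c8 f9] by simp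
                have "runs insert_beyond ?M (\<lambda>s'. \<forall>i<length L. bucket_ok s' i \<and> (\<forall>y. bucket s' i y =
                  best_at L i y)) s9"
                  by (rule runs_insert_beyond[OF c9 M(1)]) (use z7 br7 F7 in \<open>simp_all add: frameD[OF f8] frameD[OF f9]\<close>)
                then show "runs ?c8 ?M ?Post s9"
                proof (rule runs_then[OF _ order_refl])
                  fix s10 assume t10: "\<forall>i<length L. bucket_ok s10 i \<and> (\<forall>y. bucket s10 i y =
                    best_at L i y)"
                    and f10: "frame insert_beyond s9 s10"
                  have c10: "ctx L s10" using ctx_frame[OF c9 f10] by simp
                  have "runs (scan_sum mTotal) ?M (\<lambda>s'. \<forall>i<length L. rmem s' mTotal i =
                    total_from L i) s10"
                  proof (rule runs_scan_sum[OF ctxD(1)[OF c10] x M(2)])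
                    show "rmem s10 mTotal i = total_at L i"
                      if "i < length L" for i using t8 that by (simp add: frameD[OF f9] frameD[OF f10])
                    show "min (D v - d x v) (length L) - 1 < length L" for v
                      using dfs_out_0(1)[OF ctxD(1)[OF c10] x] min.cobounded2[of "D v - d x v" "length L"] by linarith
                  qed
                  then show "runs ?c9 ?M ?Post s10"
                  proof (rule runs_then[OF _ order_refl])
                    fix s11 assume t11: "\<forall>i<length L. rmem s11 mTotal i =
                      total_from L i"
                      and f11: "frame (scan_sum mTotal) s10 s11"
                    have c11: "ctx L s11" using ctx_frame[OF c10 f11] by simp
                    have sl: "slot L v < length L" if "v \<in> A" "U v \<and> 1 < D v - d x v" for v
                    proof -
                      have ne: "v \<noteq> x" using that not_U_x by metis
                      show ?thesis using slot_range(2)[OF that(1) ne, of L] that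
                        base_bound[OF ctxD(3,4)[OF c10] branch_child(1,2)[OF that(1) ne]] by linarith
                    qed
                    have "runs (scan_sum mOwn) ?M (\<lambda>s'. \<forall>i<length L. rmem s' mOwn i =
                      own_from L i) s11"
                    proof (rule runs_scan_sum[OF ctxD(1)[OF c11] x M(2)])
                      show "rmem s11 mOwn i = own_at L i"
                        if "i < length L" for i using t9 that by (simp add: frameD[OF f10] frameD[OF f11])
                    qed (use sl in blast)
                    then show "runs ?c10 ?M ?Post s11"
                    proof (rule runs_then[OF _ order_refl])
                      fix s12 assume t12: "\<forall>i<length L. rmem s12 mOwn i =
                        own_from L i"
                        and f12: "frame (scan_sum mOwn) s11 s12"
                      have c12: "ctx L s12" using ctx_frame[OF c11 f12] by simp
                      have k12: "bucket s12 = bucket s10" "bucket_ok s12 = bucket_ok s10"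
                        by (auto simp: bucket_def bucket_ok_def fun_eq_iff frameD[OF f11] frameD[OF f12])
                      have "runs scan_max ?M (\<lambda>s'. \<forall>i<length L. \<forall>y. bucket s' i y =
                        best_upto L i y) s12"
                        by (rule runs_scan_max[OF ctxD(1)[OF c12] x M(1)]) (use t10 k12 in simp)
                      then show "runs ?c11 ?M ?Post s12"
                      proof (rule runs_then[OF _ order_refl])
                        fix s13 assume t13: "\<forall>i<length L. \<forall>y. bucket s13 i y =
                          best_upto L i y"
                          and f13: "frame scan_max s12 s13"
                        have c13: "ctx L s13" using ctx_frame[OF c12 f13] by simp
                        note fr = frameD[OF f8] frameD[OF f9] frameD[OF f10] frameD[OF f11] frameD[OF f12] frameD[OF f13]
                        have q: "runs query ?M (\<lambda>s'. \<forall>v<n. rmem s' mGain v = (if v \<in> A then rmem s13 mGain v + won v else rmem s13 mGain v) \<and>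
                            rmem s' mRest v = (if v \<in> A then max (rmem s13 mRest v) (lost v) else rmem s13 mRest v)) s13"
                        proof (rule runs_query[OF c13 M(1)])
                          show "imem s13 bBr v = branch x v" if "v \<in> A" for v using br7[OF that] by (simp add: fr)
                          show "imem s13 bBase y = base L y \<and> imem s13 bBz y = bz y" if "y \<in> A" "d x y = 1" for y
                            using bb7[OF that] by (simp add: fr)
                          show "rmem s13 mTotal i = total_from L i"
                            if "i < length L" for i using t11 that by (simp add: frameD[OF f12] frameD[OF f13])
                          show "rmem s13 mOwn i = own_from L i"
                            if "i < length L" for i using t12 that by (simp add: frameD[OF f13])
                          show "bucket s13 i y = best_upto L i y" if "i < length L" for i y using t13 that by blast
                        qed
                        show "runs ?c12 ?M ?Post s13"
                        proof (rule runs_then[OF q order_refl])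
                          fix s14 assume q14: "\<forall>v<n. rmem s14 mGain v = (if v \<in> A then rmem s13 mGain v + won v else rmem s13 mGain v) \<and>
                            rmem s14 mRest v = (if v \<in> A then max (rmem s13 mRest v) (lost v) else rmem s13 mRest v)"
                            and f14: "frame query s13 s14"
                          note fr = fr frameD[OF f14]
                          let ?s15 = "s14\<lparr>imem := (imem s14)(bRem := (imem s14 bRem)(x := 1))\<rparr>"
                          have e: "sx (SetIMem bRem (IReg rX) (INum 1)) s14 = ?s15" using X7(1) by (simp add: fr)
                          have "removed (insert x X) ?s15" using rem x X7(4) by (auto simp: removed_def fr)
                          moreover have "worklist (R @ ?K) ?s15" using wl7 by (simp add: worklist_def fr)
                          moreover have "rmem s13 mGain = rmem s mGain" "rmem s13 mRest = rmem s mRest" using X7 by (simp_all add: fr)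
                          moreover have "distinct ?K" "set ?K = {y \<in> A. d x y = 1}"
                            using ctxD(3,4)[OF c13] by auto
                          ultimately have "?Post ?s15" using q14 by auto
                          then show "runs (SetIMem bRem (IReg rX) (INum 1)) ?M ?Post s14"
                            by (intro runs_sx) (use M1 e in simp_all)
                        qed
                      qed
                    qed
                  qed
                qed
              qed
            qed
          qed
          show "runs ?c4 ?M ?Post s5"
            by (rule runs_sx_then[OF _ M1]) (use r5 in \<open>simp_all only: loopfree.simps sx.simps ival.simps\<close>)
        qed
      qed
    qed
  qed
  show ?thesis unfolding split_def block.simps
    by (rule runs_sx_then[OF _ M1]) (use r in \<open>simp_all only: loopfree.simps sx.simps ival.simps X\<close>)
qed

end

section \<open>The decomposition\<close>

text \<open>A root weight of 0 means that no unmet site is left in the component. Then every pair of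
  one of its vertices with a territory is handled, and the component is dropped.\<close>

definition process :: com where
  "process = block [SetIReg rWp (ISub (IReg rWp) (INum 1)), SetIReg rRoot (ix bWl rWp), dfs, find_centroid,
     If (RLess (RNum 0) (RMem mAcc (IReg rRoot)))
       (block [SetIReg rC (ix bTe rX), If (IEq (ix bDone rC) (INum 0)) own Skip, split])
       Skip]"

definition main_loop :: com where
  "main_loop = While (ILess (INum 0) (IReg rWp)) process"

text \<open>The number of binary digits of \<open>q\<close>, that is, how often \<open>q\<close> can
  be halved before it becomes 0.\<close>

fun lev :: "nat \<Rightarrow> nat" where
  "lev q = (if q = 0 then 0 else Suc (lev (q div 2)))"

declare lev.simps [simp del]

lemma lev_0 [simp]: "lev 0 = 0"
  by (simp add: lev.simps)

lemma lev_pos: "0 < q \<Longrightarrow> lev q = Suc (lev (q div 2))"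
  by (subst lev.simps) simp

lemma lev_mono: "a \<le> b \<Longrightarrow> lev a \<le> lev b"
proof (induction b arbitrary: a rule: less_induct)
  case (less b)
  show ?case
  proof (cases "a = 0")
    case False
    then have "lev (a div 2) \<le> lev (b div 2)" using less by (intro less.IH) (auto simp: div_le_mono)
    then show ?thesis using False less.prems by (simp add: lev_pos)
  qed simp
qed

lemma pow_lev: "0 < q \<Longrightarrow> 2 ^ lev q \<le> 2 * q"
proof (induction q rule: less_induct)
  case (less q)
  show ?case
  proof (cases "q div 2 = 0")
    case True
    then show ?thesis using less.prems by (simp add: lev_pos)
  next
    case False
    then have "2 ^ lev (q div 2) \<le> 2 * (q div 2)" using less by auto
    then show ?thesis using less.prems by (simp add: lev_pos)
  qed
qed

context ram_instance
begin

text \<open>Every vertex of a component with \<open>q\<close> unmet sites takes part in at most \<open>lev q + 1\<close> more components.\<close>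

definition pot :: "nat set \<Rightarrow> nat list \<Rightarrow> nat" where
  "pot X R = (\<Sum>r\<leftarrow>R. vol (comp X r) * Suc (lev (card (sites X r))))"

text \<open>The last clause gives completeness: once nothing is pending, every territory has been
  met. Disjointness ensures that removing a centroid leaves the other pending components
  unchanged.\<close>

definition roots_ok :: "nat set \<Rightarrow> nat list \<Rightarrow> bool" where
  "roots_ok X R \<longleftrightarrow> (\<forall>r\<in>set R. r < n \<and> r \<notin> X) \<and> sorted_wrt (\<lambda>a b. comp X a \<inter> comp X b = {}) R \<and>
     (\<forall>j. undone X j \<longrightarrow> (\<exists>r\<in>set R. S ! j \<in> comp X r))"

text \<open>Entries at sites are left open: sites are not candidates, and \<open>own\<close> may
  write a meaningless value at the site where its search starts.\<close>

definition totals :: "nat set \<Rightarrow> ram_state \<Rightarrow> bool" where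
  "totals X s \<longleftrightarrow> (\<forall>v<n. v \<notin> set S \<longrightarrow> rmem s mGain v = partial_gain X v \<and> rmem s mRest v = partial_rest X v)"

definition item_inv :: "nat set \<Rightarrow> nat list \<Rightarrow> ram_state \<Rightarrow> bool" where
  "item_inv X R s \<longleftrightarrow> input s \<and> half_table s \<and> removed X s \<and> labels s \<and> done_table X s \<and>
     totals X s \<and> worklist R s \<and> roots_ok X R"

lemma vol_mono: "finite B \<Longrightarrow> A \<subseteq> B \<Longrightarrow> vol A \<le> vol B"
  unfolding vol_def by (rule sum_mono2) auto

lemma sites_sub_insert: "comp (insert x X) r = comp X r \<Longrightarrow> sites (insert x X) r \<subseteq> sites X r"
  by (auto simp: sites_def undone_def)

lemma undone_insert: "undone (insert x X) j \<longleftrightarrow> undone X j \<and> te x \<noteq> j"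
  by (auto simp: undone_def)

text \<open>The 1 added to \<open>lev\<close> in the potential pays for a component that is searched
  only to find that it has no unmet site.\<close>

lemma drop_root:
  assumes "roots_ok X (R @ [r])" "sites X r = {}"
  shows "roots_ok X R" "vol (comp X r) + pot X R \<le> pot X (R @ [r])"
proof -
  have "\<forall>j. undone X j \<longrightarrow> S ! j \<notin> comp X r" using sites_empty_iff[of r X] assms by (auto simp: roots_ok_def)
  then show "roots_ok X R" using assms(1) by (auto simp: roots_ok_def sorted_wrt_append)
  show "vol (comp X r) + pot X R \<le> pot X (R @ [r])" using assms(2) by (simp add: pot_def)
qed

text \<open>The new components are disjoint parts of the old one, and by \<open>sites_half\<close>
  each is at least one level lower. Their joint potential is thus at most \<open>vol\<close> times
  the old level, and the freed \<open>vol\<close> pays for the round.\<close>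

lemma split_roots:
  assumes ok: "roots_ok X (R @ [r])" and cen: "centroid X r x"
    and K: "distinct K" "set K = {y \<in> comp X x. d x y = 1}"
  shows "roots_ok (insert x X) (R @ K)" "vol (comp X r) + pot (insert x X) (R @ K) \<le> pot X (R @ [r])"
proof -
  let ?X = "insert x X" and ?A = "comp X r"
  have r: "r < n" "r \<notin> X" using ok by (auto simp: roots_ok_def)
  have x: "x \<in> ?A" using cen by (simp add: centroid_def)
  have A: "comp X x = ?A" by (rule comp_eq) (use r x in auto)
  have xn: "x < n" "x \<notin> X" using x comp_sub comp_notin[of r x X] r by auto
  have y: "y \<in> ?A" "d x y = 1" "y \<noteq> x" "y < n" "nx x y = y" if "y \<in> set K" for y
  proof -
    show 1: "y \<in> ?A" "d x y = 1" using that K(2) A by auto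
    then show 2: "y < n" "y \<noteq> x" using comp_sub xn by auto
    show "nx x y = y" using nx_adj[of x y] 1 2 xn by auto
  qed
  have comp_y: "comp ?X y = {u \<in> ?A. u \<noteq> x \<and> nx x u = y}" if "y \<in> set K" for y
    using comp_insert_branch[of r x X y] y[OF that] r x by simp
  have other: "comp ?X a = comp X a" if a: "a \<in> set R" for a
  proof (rule comp_insert_out)
    show "a \<in> {..<n}" using ok a by (auto simp: roots_ok_def)
    show "x \<notin> comp X a" using ok a x by (auto simp: roots_ok_def sorted_wrt_append)
  qed
  have disj_R: "comp X a \<inter> ?A = {}" if "a \<in> set R" for a
    using ok that by (auto simp: roots_ok_def sorted_wrt_append)
  have R_notin: "a < n \<and> a \<notin> ?X" if a: "a \<in> set R" for a
  proof -
    have "a < n" "a \<notin> X" using ok a by (auto simp: roots_ok_def)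
    moreover have "a \<in> comp X a" using comp_self calculation by simp
    ultimately show ?thesis using disj_R[OF a] x by auto
  qed
  have K_notin: "y < n \<and> y \<notin> ?X" if "y \<in> set K" for y
    using y[OF that] comp_notin[of r y X] r by auto
  show "roots_ok ?X (R @ K)" unfolding roots_ok_def
  proof (intro conjI allI impI)
    show "\<forall>a\<in>set (R @ K). a < n \<and> a \<notin> ?X" using R_notin K_notin by auto
    have "sorted_wrt (\<lambda>a b. comp X a \<inter> comp X b = {}) R" using ok by (auto simp: roots_ok_def sorted_wrt_append)
    then have "sorted_wrt (\<lambda>a b. comp ?X a \<inter> comp ?X b = {}) R"
      by (rule sorted_wrt_mono_rel[rotated]) (simp add: other)
    moreover have "sorted_wrt (\<lambda>a b. comp ?X a \<inter> comp ?X b = {}) K"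
    proof -
      have "sorted_wrt (\<noteq>) K" using K(1) by (simp add: distinct_conv_nth sorted_wrt_iff_nth_less)
      then show ?thesis by (rule sorted_wrt_mono_rel[rotated]) (auto simp: comp_y)
    qed
    moreover have "\<forall>a\<in>set R. \<forall>b\<in>set K. comp ?X a \<inter> comp ?X b = {}"
      using other comp_y disj_R by fastforce
    ultimately show "sorted_wrt (\<lambda>a b. comp ?X a \<inter> comp ?X b = {}) (R @ K)"
      by (simp add: sorted_wrt_append)
    fix j assume j: "undone ?X j"
    then have jX: "undone X j" "te x \<noteq> j" "j < p" by (auto simp: undone_def)
    then obtain a where a: "a \<in> set (R @ [r])" "S ! j \<in> comp X a" using ok unfolding roots_ok_def by blast
    show "\<exists>a\<in>set (R @ K). S ! j \<in> comp ?X a"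
    proof (cases "a \<in> set R")
      case True
      then show ?thesis using a other by auto
    next
      case False
      then have sA: "S ! j \<in> ?A" using a by auto
      have ne: "S ! j \<noteq> x" using te_S(1)[OF jX(3)] jX(2) by auto
      have sn: "S ! j < n" using sA comp_sub by auto
      let ?y = "nx x (S ! j)"
      have yy: "?y < n" "d x ?y = 1" "d x (S ! j) = Suc (d ?y (S ! j))" using nx[of x "S ! j"] ne sn xn by auto
      then have "btw x ?y (S ! j)" using xn sn by (simp add: btw_def)
      then have "?y \<in> comp X x" using comp_btw[of "S ! j" X x ?y] sA A by simp
      then have "?y \<in> set K" using K(2) yy by simp
      moreover then have "S ! j \<in> comp ?X ?y" using comp_y sA ne by simp
      ultimately show ?thesis by auto
    qed
  qed
  let ?q = "card (sites X r)"
  have q: "0 < ?q"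
  proof -
    have "card {u \<in> sites X r. btw r x u} \<le> ?q" by (rule card_mono) auto
    moreover have "?q < 2 * card {u \<in> sites X r. btw r x u}" using cen by (simp add: centroid_def)
    ultimately show ?thesis by linarith
  qed
  have lev_y: "Suc (lev (card (sites ?X y))) \<le> lev ?q" if "y \<in> set K" for y
  proof -
    have "card (sites ?X y) \<le> ?q div 2"
      by (rule sites_half) (use r x y[OF that] cen in \<open>auto simp: centroid_def\<close>)
    then show ?thesis using lev_mono lev_pos[OF q] by auto
  qed
  have "(\<Sum>y\<leftarrow>K. vol (comp ?X y)) = (\<Sum>y\<in>set K. vol (comp ?X y))"
    using K(1) by (simp add: sum_list_distinct_conv_sum_set)
  also have "\<dots> = vol (\<Union>y\<in>set K. comp ?X y)"
    unfolding vol_def by (rule sum.UNION_disjoint[symmetric]) (auto simp: comp_y)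
  also have "\<dots> \<le> vol ?A" by (rule vol_mono) (auto simp: comp_y)
  finally have volK: "(\<Sum>y\<leftarrow>K. vol (comp ?X y)) \<le> vol ?A" .
  have "pot ?X K \<le> (\<Sum>y\<leftarrow>K. vol (comp ?X y) * lev ?q)"
    unfolding pot_def by (intro sum_list_mono mult_le_mono2 lev_y)
  also have "\<dots> = (\<Sum>y\<leftarrow>K. vol (comp ?X y)) * lev ?q" by (simp add: sum_list_mult_const)
  also have "\<dots> \<le> vol ?A * lev ?q" using volK by (rule mult_le_mono1)
  finally have "pot ?X K \<le> vol ?A * lev ?q" .
  moreover have "pot ?X R \<le> pot X R"
    unfolding pot_def
  proof (rule sum_list_mono)
    fix a assume a: "a \<in> set R"
    have "lev (card (sites ?X a)) \<le> lev (card (sites X a))"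
      by (rule lev_mono, rule card_mono) (use sites_sub_insert[OF other[OF a]] in auto)
    then show "vol (comp ?X a) * Suc (lev (card (sites ?X a))) \<le> vol (comp X a) * Suc (lev (card (sites X a)))"
      using other[OF a] by simp
  qed
  ultimately show "vol ?A + pot ?X (R @ K) \<le> pot X (R @ [r])" by (simp add: pot_def)
qed

lemma runs_process:
  assumes inv: "item_inv X (R @ [r]) s"
  shows "runs process (vol (comp X r)) (\<lambda>s'. \<exists>X' R'. item_inv X' R' s' \<and>
    vol (comp X r) + pot X' R' \<le> pot X (R @ [r])) s" (is "runs _ ?M ?Post s")
proof -
  let ?A = "comp X r"
  have r: "r < n" "r \<notin> X" using inv by (auto simp: item_inv_def roots_ok_def)
  have M1: "1 \<le> ?M" using vol_ge_card[of ?A] card_comp_pos[OF r] by simp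
  let ?s1 = "s\<lparr>ireg := (ireg s)(rWp := length R, rRoot := r)\<rparr>"
  have s1: "input ?s1" "half_table ?s1" "removed X ?s1" "labels ?s1" "done_table X ?s1" "totals X ?s1" "worklist R ?s1"
    using inv by (auto simp: item_inv_def input_def half_table_def removed_def labels_def done_table_def
      totals_def worklist_def nth_append)
  have d: "runs dfs ?M (\<lambda>s'. \<exists>L. dfs_out r X L s') ?s1" using runs_dfs[OF s1(1-3) r] by simp
  let ?body = "block [SetIReg rC (ix bTe rX), If (IEq (ix bDone rC) (INum 0)) own Skip, split]"
  let ?if = "If (RLess (RNum 0) (RMem mAcc (IReg rRoot))) ?body Skip"
  let ?c2 = "Seq find_centroid ?if"
  have main: "runs (Seq dfs ?c2) ?M ?Post ?s1"
  proof (rule runs_then[OF d order_refl])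
    fix s2 assume "\<exists>L. dfs_out r X L s2" and f2: "frame dfs ?s1 s2"
    then obtain L where out2: "dfs_out r X L s2" by blast
    have s2: "labels s2" "done_table X s2" "ireg s2 rRoot = r"
      using labels_frame[OF s1(4) f2] done_table_frame[OF s1(5) f2] by (simp_all add: frameD[OF f2])
    show "runs ?c2 ?M ?Post s2"
    proof (rule runs_then[OF runs_find_centroid[OF out2 r s2] order_refl], elim conjE)
      fix s3 assume q3: "rmem s3 mAcc r = real (card (sites X r))"
        and cen3: "sites X r \<noteq> {} \<longrightarrow> centroid X r (ireg s3 rX)" and f3: "frame find_centroid s2 s3"
      have s3: "input s3" "half_table s3" "removed X s3" "labels s3" "done_table X s3"
        using input_frame[OF input_frame[OF s1(1) f2] f3] half_table_frame[OF half_table_frame[OF s1(2) f2] f3]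
          removed_frame[OF removed_frame[OF s1(3) f2] f3] labels_frame[OF s2(1) f3] done_table_frame[OF s2(2) f3]
        by simp_all
      have s3': "totals X s3" "worklist R s3" "ireg s3 rRoot = r"
        using s1(6,7) s2(3) by (simp_all add: totals_def worklist_def frameD[OF f2] frameD[OF f3])
      show "runs ?if ?M ?Post s3"
      proof (rule runs_If[OF M1])
        assume "\<not> tval (RLess (RNum 0) (RMem mAcc (IReg rRoot))) s3"
        then have "sites X r = {}" using q3 s3'(3) by simp
        then have "item_inv X R s3 \<and> vol ?A + pot X R \<le> pot X (R @ [r])"
          using drop_root[of X R r] inv s3 s3' by (simp add: item_inv_def)
        then show "runs Skip ?M ?Post s3" by (intro runs_sx) (use M1 in auto)
      next
        assume "tval (RLess (RNum 0) (RMem mAcc (IReg rRoot))) s3"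
        then have "sites X r \<noteq> {}" using q3 s3'(3) by auto
        then have cen: "centroid X r (ireg s3 rX)" using cen3 by blast
        define x where "x = ireg s3 rX"
        have cen: "centroid X r x" using cen by (simp add: x_def)
        have xA: "x \<in> ?A" using cen by (simp add: centroid_def)
        have xn: "x < n" "x \<notin> X" using xA comp_sub comp_notin[of r x X] r by auto
        have A: "comp X x = ?A" by (rule comp_eq) (use r xA in auto)
        interpret c: centroid_step n d S \<pi> adj x X by unfold_locales (use xn in auto)
        let ?c = "te x"
        let ?s4 = "s3\<lparr>ireg := (ireg s3)(rC := ?c)\<rparr>"
        have s4: "input ?s4" "half_table ?s4" "removed X ?s4" "labels ?s4" "done_table X ?s4"
          using s3 by (simp_all add: input_def half_table_def removed_def labels_def done_table_def)
        have e4: "sx (SetIReg rC (ix bTe rX)) s3 = ?s4"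
          using s3(4) xn by (simp add: labels_def x_def[symmetric])
        \<comment> \<open>The state between \<open>own\<close> and \<open>split\<close>: the
          territory of the centroid is included if it was unmet, the other branches are not.\<close>
        let ?w = "\<lambda>(t :: ram_state) v. rmem t mGain v = (if v \<in> ?A \<and> undone X ?c then partial_gain X v + gain ?c v else partial_gain X v) \<and>
            rmem t mRest v = (if v \<in> ?A \<and> undone X ?c then max (partial_rest X v) (rest ?c v) else partial_rest X v)"
        let ?Q = "\<lambda>t. (\<forall>v<n. v \<notin> set S \<longrightarrow> ?w t v) \<and> done_table (insert x X) t"
        let ?own = "If (IEq (ix bDone rC) (INum 0)) own Skip"
        have dc: "imem s3 bDone ?c = 0 \<longleftrightarrow> undone X ?c" using s3(5) te_lt[of x] by (simp add: done_table_def)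
        have o: "runs ?own ?M ?Q ?s4"
        proof (rule runs_If[OF M1])
          assume "tval (IEq (ix bDone rC) (INum 0)) ?s4"
          then have und: "undone X ?c" using dc by simp
          show "runs own ?M ?Q ?s4"
          proof (rule runs_mono[OF runs_own[OF s4(1-4) r xA und]])
            fix t :: ram_state assume "(\<forall>v<n. v \<notin> set S \<longrightarrow>
              rmem t mGain v = (if v \<in> ?A then rmem ?s4 mGain v + gain ?c v else rmem ?s4 mGain v) \<and>
              rmem t mRest v = (if v \<in> ?A then max (rmem ?s4 mRest v) (rest ?c v) else rmem ?s4 mRest v)) \<and>
              imem t bDone = (imem ?s4 bDone)(?c := 1)"
            then show "?Q t" using s3'(1) s3(5) und by (simp add: totals_def done_table_def undone_insert)
          qed simp_all
        next
          assume "\<not> tval (IEq (ix bDone rC) (INum 0)) ?s4"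
          then have "\<not> undone X ?c" using dc by simp
          moreover then have "undone (insert x X) j \<longleftrightarrow> undone X j" for j by (auto simp: undone_insert)
          ultimately have "?Q ?s4" using s3'(1) s3(5) by (simp add: totals_def done_table_def)
          then show "runs Skip ?M ?Q ?s4" by (intro runs_sx) (use M1 in auto)
        qed
        have "runs (Seq ?own split) ?M ?Post ?s4"
        proof (rule runs_then[OF o order_refl], elim conjE)
          fix s5 assume w5: "\<forall>v<n. v \<notin> set S \<longrightarrow> ?w s5 v" and d5: "done_table (insert x X) s5"
            and f5: "frame ?own ?s4 s5"
          have s5: "input s5" "half_table s5" "removed X s5" "labels s5"
            using input_frame[OF s4(1) f5] half_table_frame[OF s4(2) f5] removed_frame[OF s4(3) f5] labels_frame[OF s4(4) f5]
            by simp_all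
          have X5: "ireg s5 rX = x" "worklist R s5" using s3'(2) by (simp_all add: frameD[OF f5] x_def worklist_def)
          show "runs split ?M ?Post s5"
          proof (rule runs_conseq[OF c.runs_split[OF s5 d5 X5, unfolded A] order_refl], elim conjE exE)
            fix s6 K assume rem6: "removed (insert x X) s6"
              and w6: "\<forall>v<n. rmem s6 mGain v = (if v \<in> ?A then rmem s5 mGain v + c.won v else rmem s5 mGain v) \<and>
                rmem s6 mRest v = (if v \<in> ?A then max (rmem s5 mRest v) (c.lost v) else rmem s5 mRest v)"
              and K: "distinct K" "set K = {y \<in> ?A. d x y = 1}" "worklist (R @ K) s6" and f6: "frame split s5 s6"
            have K': "set K = {y \<in> comp X x. d x y = 1}" using K A by simp
            have ok: "roots_ok X (R @ [r])" using inv by (simp add: item_inv_def)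
            have s6: "input s6" "half_table s6" "labels s6" "done_table (insert x X) s6"
              using input_frame[OF s5(1) f6] half_table_frame[OF s5(2) f6] labels_frame[OF s5(4) f6] done_table_frame[OF d5 f6]
              by simp_all
            have "totals (insert x X) s6" unfolding totals_def
            proof (intro allI impI)
              fix v assume v: "v < n" "v \<notin> set S"
              show "rmem s6 mGain v = partial_gain (insert x X) v \<and> rmem s6 mRest v = partial_rest (insert x X) v"
              proof (cases "v \<in> ?A")
                case False
                then have "partial_gain (insert x X) v = partial_gain X v" "partial_rest (insert x X) v = partial_rest X v"
                  using partial_outside[of r x X v] r xA v by simp_all
                then show ?thesis using False w5 w6 v by simp
              next
                case True
                have vx: "v \<in> comp X x" "x \<in> comp X x" using True xA A by auto
                have "partial_gain (insert x X) v = partial_gain X v + (if undone X ?c then gain ?c v else 0) + c.won v"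
                  using partial_gain_insert[of x x X v] vx xn
                  by (simp add: c.won_def opposite_def conj_assoc)
                moreover have "partial_rest (insert x X) v = max (partial_rest X v) (max (if undone X ?c then rest ?c v else 0) (c.lost v))"
                  using partial_rest_insert[of x x X v] vx xn
                  by (simp add: c.lost_def max0_def opposite_def conj_assoc)
                \<comment> \<open>If the territory of the centroid was met before, it enters the
                  maximum as 0, which the nonnegative \<open>lost\<close> absorbs.\<close>
                moreover have "max 0 (c.lost v) = c.lost v"
                  unfolding c.lost_def by (intro max_absorb2 max0_nonneg) simp
                ultimately show ?thesis using True w5 w6 v by (simp add: max.assoc)
              qed
            qed
            then have "item_inv (insert x X) (R @ K) s6 \<and> vol ?A + pot (insert x X) (R @ K) \<le> pot X (R @ [r])"
              using s6 rem6 K(3) split_roots[OF ok cen K(1) K'] by (simp add: item_inv_def)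
            then show "?Post s6" by blast
          qed
        qed
        then show "runs ?body ?M ?Post s3" unfolding block.simps
          by (intro runs_sx_then[OF _ M1, of "SetIReg rC (ix bTe rX)"]) (simp_all only: e4 loopfree.simps)
      qed
    qed
  qed
  have e: "sx (SetIReg rRoot (ix bWl rWp)) (sx (SetIReg rWp (ISub (IReg rWp) (INum 1))) s) = ?s1"
    using inv by (simp add: item_inv_def worklist_def nth_append)
  show ?thesis unfolding process_def block.simps
    by (rule runs_sx_then[OF _ M1], simp only: loopfree.simps, rule runs_sx_then[OF _ M1], simp only: loopfree.simps)
      (use main in \<open>simp only: e block.simps\<close>)
qed

lemma runs_main_loop:
  assumes inv: "item_inv X R s"
  shows "runs main_loop (pot X R + 1) (\<lambda>s'. \<exists>X'. item_inv X' [] s') s"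
proof -
  \<comment> \<open>The parameters of the invariant are recovered from memory, \<open>X\<close> from
    the removal marks and \<open>R\<close> from the worklist, which makes \<open>pot\<close> a
    function of the state.\<close>
  define \<Phi> :: "ram_state \<Rightarrow> nat" where
    "\<Phi> s = pot {v. v < n \<and> imem s bRem v = 1} (map (imem s bWl) [0..<ireg s rWp])" for s
  have \<Phi>: "\<Phi> s = pot X R" if "item_inv X R s" for X R s
  proof -
    have "{v. v < n \<and> imem s bRem v = 1} = X" using that by (auto simp: item_inv_def removed_def split: if_splits)
    moreover have "map (imem s bWl) [0..<ireg s rWp] = R"
      using that by (auto simp: item_inv_def worklist_def intro: nth_equalityI)
    ultimately show ?thesis by (simp add: \<Phi>_def)
  qed
  let ?I = "\<lambda>s. \<exists>X R. item_inv X R s"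
  have "runs main_loop (\<Phi> s + 1) (\<lambda>s'. ?I s' \<and> \<not> tval (ILess (INum 0) (IReg rWp)) s') s"
    unfolding main_loop_def
  proof (rule runs_While)
    show "?I s" using inv by blast
  next
    fix t assume "?I t" and b: "tval (ILess (INum 0) (IReg rWp)) t"
    then obtain X R where i: "item_inv X R t" by blast
    then have "R \<noteq> []" using b by (auto simp: item_inv_def worklist_def)
    then obtain R' r where R: "R = R' @ [r]" by (metis append_butlast_last_id)
    note i = i[unfolded R]
    have r: "r < n" "r \<notin> X" using i by (auto simp: item_inv_def roots_ok_def)
    have "1 \<le> vol (comp X r)" using vol_ge_card[of "comp X r"] card_comp_pos[OF r] by simp
    moreover have "runs process (vol (comp X r)) (\<lambda>s'. ?I s' \<and> vol (comp X r) + \<Phi> s' \<le> \<Phi> t) t"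
    proof (rule runs_mono[OF runs_process[OF i] order_refl])
      fix s' assume "\<exists>X' R''. item_inv X' R'' s' \<and> vol (comp X r) + pot X' R'' \<le> pot X (R' @ [r])"
      then obtain X' R'' where "item_inv X' R'' s'" "vol (comp X r) + pot X' R'' \<le> pot X (R' @ [r])" by blast
      then show "?I s' \<and> vol (comp X r) + \<Phi> s' \<le> \<Phi> t" using \<Phi>[of X' R'' s'] \<Phi>[OF i] by auto
    qed
    ultimately show "\<exists>M\<ge>1. runs process M (\<lambda>s'. ?I s' \<and> M + \<Phi> s' \<le> \<Phi> t) t" by blast
  qed
  then show ?thesis
    by (rule runs_mono) (use \<Phi>[OF inv] in \<open>auto simp: item_inv_def worklist_def\<close>)
qed

lemma item_inv_final:
  assumes "item_inv X [] s" "v < n" "v \<notin> set S"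
  shows "rmem s mGain v = (\<Sum>u | u < n \<and> d u v < D u. \<pi> u)" "rmem s mRest v = Max ((\<lambda>j. rest j v) ` {..<p})"
  using partial_complete[of X v] assms unfolding item_inv_def roots_ok_def totals_def by auto

end

section \<open>The whole program\<close>

definition relax :: "nat \<Rightarrow> nat \<Rightarrow> com" where
  "relax a b = If (Or (ILess (IAdd (ix bD b) (INum 1)) (ix bD a))
       (And (IEq (IAdd (ix bD b) (INum 1)) (ix bD a)) (ILess (ix bTe b) (ix bTe a))))
     (Seq (SetIMem bTe (IReg a) (ix bTe b)) (SetIMem bD (IReg a) (IAdd (ix bD b) (INum 1)))) Skip"

text \<open>Without division, half of \<open>i\<close> is obtained as one more than half of
  \<open>i - 2\<close>; the entries 0 and 1 are zero in the initial memory.\<close>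

definition halves :: com where
  "halves = for_up rI (INum 2) (IAdd (IReg rN) (INum 1))
     (SetIMem bHf (IReg rI) (IAdd (IMem bHf (ISub (IReg rI) (INum 2))) (INum 1)))"

definition blank_labels :: com where
  "blank_labels = for_up rI (INum 0) (IReg rN) (Seq (SetIMem bD (IReg rI) (IReg rN)) (SetIMem bTe (IReg rI) (IReg rP)))"

definition site_labels :: com where
  "site_labels = for_up rI (INum 0) (IReg rP) (Seq (SetIMem bD (ix bS rI) (INum 0)) (SetIMem bTe (ix bS rI) (IReg rI)))"

definition relax_up :: com where
  "relax_up = each_down (relax rU rV)"

definition relax_down :: com where
  "relax_down = each (If (ILess (INum 0) (ix bDep rV)) (Seq (SetIReg rU (ix bPar rV)) (relax rV rU)) Skip)"

definition relax_all :: com where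
  "relax_all = Seq relax_up relax_down"

definition prepare :: com where
  "prepare = block [halves, blank_labels, site_labels, SetIReg rRoot (INum 0), dfs, relax_all,
     SetIMem bWl (INum 0) (INum 0), SetIReg rWp (INum 1)]"

definition choose_best :: com where
  "choose_best = Seq (SetIReg rK (INum 0)) (for_up rI (INum 0) (IReg rN)
     (If (ILess (INum 0) (ix bD rI))
       (Seq (If (RLess (RMem mGain (IReg rI)) (RMem mRest (IReg rI))) (SetRReg 1 (RMem mRest (IReg rI))) (SetRReg 1 (RMem mGain (IReg rI))))
         (If (Or (IEq (IReg rK) (INum 0)) (RLess (RReg 1) (RReg 0)))
           (block [SetRReg 0 (RReg 1), SetIReg rX (IReg rI), SetIReg rK (INum 1)]) Skip))
       Skip))"

definition balanced_vertex_program :: com where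
  "balanced_vertex_program = block [prepare, main_loop, choose_best, SetIReg 0 (IReg rX)]"

lemma w_prepare [simp]:
  "wir (relax a b) = {}" "wim (relax a b) = {bD, bTe}" "wrr (relax a b) = {}" "wrm (relax a b) = {}"
  "wir halves = {rI}" "wim halves = {bHf}" "wrr halves = {}" "wrm halves = {}"
  "wir blank_labels = {rI}" "wim blank_labels = {bD, bTe}" "wrr blank_labels = {}" "wrm blank_labels = {}"
  "wir site_labels = {rI}" "wim site_labels = {bD, bTe}" "wrr site_labels = {}" "wrm site_labels = {}"
  "wir relax_up = {rI, rV, rU}" "wim relax_up = {bD, bTe}" "wrr relax_up = {}" "wrm relax_up = {}"
  "wir relax_down = {rI, rV, rU}" "wim relax_down = {bD, bTe}" "wrr relax_down = {}" "wrm relax_down = {}"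
  "wir relax_all = {rI, rV, rU}" "wim relax_all = {bD, bTe}" "wrr relax_all = {}" "wrm relax_all = {}"
  by (auto simp: relax_all_def relax_def halves_def blank_labels_def site_labels_def relax_up_def relax_down_def)

lemma loopfree_relax [simp]: "loopfree (relax a b)"
  by (simp add: relax_def)

section \<open>Distances and positions of nearest sites by two sweeps\<close>

definition key :: "ram_state \<Rightarrow> nat \<Rightarrow> nat \<times> nat" where
  "key s v = (imem s bD v, imem s bTe v)"

definition kle :: "nat \<times> nat \<Rightarrow> nat \<times> nat \<Rightarrow> bool" where
  "kle k l \<longleftrightarrow> fst k < fst l \<or> fst k = fst l \<and> snd k \<le> snd l"

definition bump :: "nat \<times> nat \<Rightarrow> nat \<times> nat" where
  "bump k = (Suc (fst k), snd k)"

lemma kle_refl [simp]: "kle k k"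
  by (simp add: kle_def)

lemma kle_trans: "kle k l \<Longrightarrow> kle l m \<Longrightarrow> kle k m"
  unfolding kle_def by linarith

lemma kle_total: "\<not> kle k l \<Longrightarrow> kle l k"
  unfolding kle_def by linarith

lemma kle_bump: "kle k l \<Longrightarrow> kle (bump k) (bump l)" "kle k (bump k)"
  by (auto simp: kle_def bump_def)

lemma key_upd [simp]: "key (s\<lparr>ireg := f\<rparr>) = key s"
  by (simp add: key_def fun_eq_iff)

lemma key_relax:
  assumes "ireg s a = u" "ireg s b = v" "u \<noteq> v"
  shows "key (sx (relax a b) s) = (key s)(u := if kle (key s u) (bump (key s v)) then key s u else bump (key s v))"
  using assms by (auto simp: relax_def key_def kle_def bump_def fun_eq_iff)

context ram_instance
begin

text \<open>Keys whose values are attained by some site, or are still blank, and that no edge can improve are the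
  lexicographic minima: this local criterion replaces an analysis of what each pass computes.\<close>

definition good_keys :: "(nat \<Rightarrow> nat \<times> nat) \<Rightarrow> bool" where
  "good_keys k \<longleftrightarrow> (\<forall>v<n. snd (k v) < p \<and> d v (S ! snd (k v)) \<le> fst (k v) \<or> n \<le> fst (k v)) \<and>
     (\<forall>j<p. k (S ! j) = (0, j))"

text \<open>The key of a site has first component 0 and cannot be undercut by a bumped key.
  Elsewhere the triangle inequality carries the bound over the edge, and blank keys stay at
  \<open>n\<close> or above.\<close>

lemma good_keys_relax:
  assumes k: "good_keys k" and V: "u < n" "v < n" "d u v = 1"
  shows "good_keys (k(u := if kle (k u) (bump (k v)) then k u else bump (k v)))"
proof (cases "kle (k u) (bump (k v))")
  case False
  have "u \<noteq> S ! j" if "j < p" for j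
    using False k that by (auto simp: good_keys_def kle_def bump_def)
  moreover have "snd (k v) < p \<and> d u (S ! snd (k v)) \<le> Suc (fst (k v)) \<or> n \<le> Suc (fst (k v))"
    using k V d_tri[of u v "S ! snd (k v)"] S_in_V[of "snd (k v)"] unfolding good_keys_def by fastforce
  ultimately show ?thesis using k False by (auto simp: good_keys_def bump_def)
qed (use k in simp)

text \<open>Induction along the way to a site bounds the key of \<open>v\<close> by the distance and
  position of that site. A blank key exceeds every distance, so the key belongs to some site and is
  the lexicographic minimum, which is the priority rule.\<close>

lemma labels_from_keys:
  assumes k: "good_keys k" and edge: "\<And>u v. u < n \<Longrightarrow> v < n \<Longrightarrow> d u v = 1 \<Longrightarrow> kle (k u) (bump (k v))" and v: "v < n"
  shows "fst (k v) = D v" "snd (k v) = te v"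
proof -
  have le: "kle (k u) (d u (S ! j), j)" if "u < n" "j < p" for u j
    using that(1)
  proof (induction "d u (S ! j)" arbitrary: u)
    case 0
    then have "u = S ! j" using d_0[of u "S ! j"] S_in_V[OF that(2)] by auto
    then show ?case using 0 k that by (auto simp: good_keys_def kle_def)
  next
    case (Suc m)
    have s: "S ! j < n" using S_in_V[OF that(2)] by simp
    have ne: "u \<noteq> S ! j" using Suc.hyps s by auto
    let ?y = "nx u (S ! j)"
    have y: "?y < n" "d u ?y = 1" "d u (S ! j) = Suc (d ?y (S ! j))" using nx[of u "S ! j"] ne s Suc.prems by auto
    have "kle (bump (k ?y)) (bump (d ?y (S ! j), j))" using Suc.hyps y by (intro kle_bump) simp
    moreover have "bump (d ?y (S ! j), j) = (d u (S ! j), j)" using y by (simp add: bump_def)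
    ultimately show ?case using edge[OF Suc.prems y(1,2)] kle_trans by metis
  qed
  have p0: "0 < p" using S_ne by simp
  have "fst (k v) \<le> d v (S ! 0)" using le[OF v p0] by (auto simp: kle_def)
  then have "fst (k v) < n" using d_less[OF v, of "S ! 0"] S_in_V[OF p0] by simp
  then have s: "snd (k v) < p" "d v (S ! snd (k v)) \<le> fst (k v)" using k v by (auto simp: good_keys_def)
  have e: "fst (k v) = d v (S ! snd (k v))" using le[OF v s(1)] s(2) by (auto simp: kle_def)
  show t: "snd (k v) = te v"
  proof (rule te_eqI[symmetric])
    show "d v (S ! snd (k v)) \<le> d v (S ! i)" if "i < p" for i using le[OF v that] e by (auto simp: kle_def)
    show "d v (S ! snd (k v)) < d v (S ! i)" if "i < snd (k v)" for i
      using le[OF v, of i] e that s(1) by (auto simp: kle_def)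
  qed (rule s(1))
  show "fst (k v) = D v" using e t by (simp add: D_def)
qed

text \<open>Of two adjacent vertices one is the parent of the other. Conditions on edges thus reduce
  to parent pairs, and the number of arcs is bounded.\<close>

lemma adjacent_cases:
  assumes "u < n" "v < n" "d u v = 1" "r < n"
  shows "u \<noteq> r \<and> nx u r = v \<or> v \<noteq> r \<and> nx v r = u"
proof (cases "u \<noteq> r \<and> nx u r = v")
  case False
  have "d v r = Suc (d u r)" using step_away[of u r v] assms False by auto
  then have "v \<noteq> r" "d u r \<le> d v r" using assms by auto
  moreover have "d v u = 1" using assms d_sym[of v u] by simp
  ultimately show ?thesis using nx_unique[of v r u] assms by auto
qed simp

lemma runs_halves:
  assumes inp: "input s" and z: "imem s bHf 0 = 0" "imem s bHf 1 = 0" and M: "n + 1 \<le> M"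
  shows "runs halves M half_table s"
proof -
  let ?J = "\<lambda>k (s :: ram_state). \<forall>i<k. imem s bHf i = i div 2"
  have n: "1 \<le> n" using S_in_V[of 0] S_ne by auto
  have "runs halves M (?J (Suc n)) s" unfolding halves_def
  proof (rule runs_for_up[where I = ?J and m = "Suc n" and ?k0.0 = 2])
    show "?J 2 (s\<lparr>ireg := (ireg s)(rI := 2)\<rparr>)" using z by (auto simp: less_2_cases_iff)
  next
    fix k and t :: ram_state assume k: "2 \<le> k" "k < Suc n" "ireg t rI = k" "?J k t"
    then have "Suc (imem t bHf (k - 2)) = k div 2" by (simp add: le_div_geq)
    then show "?J (Suc k) ((sx (SetIMem bHf (IReg rI) (IAdd (IMem bHf (ISub (IReg rI) (INum 2))) (INum 1))) t)
      \<lparr>ireg := (ireg (sx (SetIMem bHf (IReg rI) (IAdd (IMem bHf (ISub (IReg rI) (INum 2))) (INum 1))) t))(rI := Suc k)\<rparr>)"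
      using k by (auto simp: less_Suc_eq)
  qed (use M n inp in \<open>auto simp: input_def frame_def\<close>)
  then show ?thesis by (rule runs_mono) (auto simp: half_table_def)
qed

lemma runs_blank_labels:
  assumes inp: "input s" and M: "n + 2 \<le> M"
  shows "runs blank_labels M (\<lambda>s'. \<forall>v<n. key s' v = (n, p)) s"
proof -
  have "runs blank_labels M ((\<lambda>k s. \<forall>v<k. key s v = (n, p)) n) s" unfolding blank_labels_def
  proof (rule runs_for_up[where I = "\<lambda>k s. \<forall>v<k. key s v = (n, p)" and m = n and ?k0.0 = 0])
    fix k and t :: ram_state assume k: "k < n" "ireg t rI = k" "\<forall>v<k. key t v = (n, p)"
      and f: "frame (for_up rI (INum 0) (IReg rN) (Seq (SetIMem bD (IReg rI) (IReg rN)) (SetIMem bTe (IReg rI) (IReg rP)))) s t"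
    have "ireg t rN = n" "ireg t rP = p" using inp by (simp_all add: frameD[OF f] input_def)
    then show "\<forall>v<Suc k. key ((sx (Seq (SetIMem bD (IReg rI) (IReg rN)) (SetIMem bTe (IReg rI) (IReg rP))) t)
      \<lparr>ireg := (ireg (sx (Seq (SetIMem bD (IReg rI) (IReg rN)) (SetIMem bTe (IReg rI) (IReg rP))) t))(rI := Suc k)\<rparr>) v = (n, p)"
      using k by (auto simp: less_Suc_eq key_def)
  qed (use M inp in \<open>auto simp: input_def frame_def\<close>)
  then show ?thesis .
qed

lemma runs_site_labels:
  assumes inp: "input s" and M: "p + 2 \<le> M" and b: "\<forall>v<n. key s v = (n, p)"
  shows "runs site_labels M (\<lambda>s'. good_keys (key s')) s"
proof -
  let ?J = "\<lambda>k (s :: ram_state). (\<forall>j<k. key s (S ! j) = (0, j)) \<and> (\<forall>v<n. v \<notin> set (take k S) \<longrightarrow> key s v = (n, p))"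
  let ?c = "Seq (SetIMem bD (ix bS rI) (INum 0)) (SetIMem bTe (ix bS rI) (IReg rI))"
  have "runs site_labels M (?J p) s" unfolding site_labels_def
  proof (rule runs_for_up[where I = ?J and m = p and ?k0.0 = 0])
    fix k and t :: ram_state assume k: "k < p" "ireg t rI = k" and J: "?J k t"
      and f: "frame (for_up rI (INum 0) (IReg rP) ?c) s t"
    have "imem t bS k = S ! k" using S_cells[OF inp k(1)] by (simp add: frameD[OF f])
    then have e: "key (sx ?c t) = (key t)(S ! k := (0, k))" using k by (auto simp: key_def fun_eq_iff)
    have ne: "S ! j \<noteq> S ! k" if "j < k" for j
      using that k S_distinct nth_eq_iff_index_eq[of S j k] by auto
    show "?J (Suc k) ((sx ?c t)\<lparr>ireg := (ireg (sx ?c t))(rI := Suc k)\<rparr>)"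
      unfolding key_upd e using J ne by (auto simp: less_Suc_eq set_take_Suc[OF k(1)])
  qed (use M inp b in \<open>auto simp: input_def frame_def\<close>)
  then show ?thesis
  proof (rule runs_mono)
    fix s' assume J: "?J p s'"
    have "snd (key s' v) < p \<and> d v (S ! snd (key s' v)) \<le> fst (key s' v) \<or> n \<le> fst (key s' v)" if v: "v < n" for v
    proof (cases "v \<in> set S")
      case True
      then obtain j where "j < p" "v = S ! j" by (metis in_set_conv_nth)
      then show ?thesis using J v by auto
    next
      case False
      then show ?thesis using J v by simp
    qed
    then show "good_keys (key s')" using J by (simp add: good_keys_def)
  qed simp
qed

text \<open>In the sweep towards the root a key is final once its own position is reached, so
  afterwards no child can improve its parent. The sweep away from the root ensures the converse and
  keeps the first property, because a key taken over from the parent exceeds that of the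
  parent.\<close>

lemma runs_relax:
  assumes out: "dfs_out r {} L s0" and r: "r < n" and M: "length L + 2 \<le> M" and g: "good_keys (key s0)"
  shows "runs relax_all M labels s0"
proof -
  have rX: "r \<notin> {}" by simp
  have A: "comp {} r = {..<n}" by (auto simp: comp_def)
  have L: "set L = {..<n}" "distinct L" using out A by (auto simp: dfs_out_def)
  let ?par = "\<lambda>i. nx (L ! i) r"
  have par: "\<exists>j<i. ?par i = L ! j" "?par i < n" "L ! i < n" "d (?par i) (L ! i) = 1" "d (L ! i) (?par i) = 1" "?par i \<noteq> L ! i"
    if "1 \<le> i" "i < length L" for i
  proof -
    show "\<exists>j<i. ?par i = L ! j" using dfs_out_parent(3)[OF out r rX that] .
    show l: "L ! i < n" using dfs_out_nth(1)[OF out that(2)] .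
    have ne: "L ! i \<noteq> r" using dfs_out_parent(1)[OF out r rX that] .
    show pn: "?par i < n" and p1: "d (L ! i) (?par i) = 1" using nx[of "L ! i" r] l ne r by auto
    then show "d (?par i) (L ! i) = 1" using d_sym[of "?par i" "L ! i"] l by simp
    show "?par i \<noteq> L ! i" using p1 l by auto
  qed
  have Lne: "L ! i \<noteq> L ! j" if "i < length L" "j < length L" "i \<noteq> j" for i j
    using that L(2) nth_eq_iff_index_eq by blast
  let ?J = "\<lambda>k s. good_keys (key s) \<and> (\<forall>i. 1 \<le> i \<longrightarrow> k \<le> i \<longrightarrow> i < length L \<longrightarrow> kle (key s (?par i)) (bump (key s (L ! i))))"
  have 1: "runs relax_up M (?J 1) s0" unfolding relax_up_def
  proof (rule runs_each_down[OF out r rX, where J = ?J])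
    fix k s assume k: "1 \<le> k" "k < length L" and J: "?J (Suc k) s" and v: "ireg s rV = L ! k" "ireg s rU = ?par k"
    let ?k' = "(key s)(?par k := if kle (key s (?par k)) (bump (key s (L ! k))) then key s (?par k) else bump (key s (L ! k)))"
    have e: "key (sx (relax rU rV) s) = ?k'" by (rule key_relax) (use v par(6)[OF k] in auto)
    have "good_keys ?k'" by (rule good_keys_relax) (use J par[OF k] in auto)
    moreover have "kle (?k' (?par i)) (bump (?k' (L ! i)))" if i: "1 \<le> i" "k \<le> i" "i < length L" for i
    proof -
      obtain j where j: "j < k" "?par k = L ! j" using par(1)[OF k] by blast
      have ne: "L ! i \<noteq> ?par k" using Lne[of i j] j i k by auto
      show ?thesis
      proof (cases "i = k")
        case True
        then show ?thesis using ne by auto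
      next
        case False
        then have k1: "kle (key s (?par i)) (bump (key s (L ! i)))" using J i by auto
        have k2: "kle (?k' (?par i)) (key s (?par i))" using kle_total by auto
        have "?k' (L ! i) = key s (L ! i)" using ne by simp
        then show ?thesis using kle_trans[OF k2 k1] by (simp only:)
      qed
    qed
    ultimately show "?J k (sx (relax rU rV) s)" unfolding e by blast
  qed (use M g in auto)
  let ?J2 = "\<lambda>k s. good_keys (key s) \<and> (\<forall>i. 1 \<le> i \<longrightarrow> i < length L \<longrightarrow> kle (key s (?par i)) (bump (key s (L ! i)))) \<and>
     (\<forall>i. 1 \<le> i \<longrightarrow> i < k \<longrightarrow> kle (key s (L ! i)) (bump (key s (?par i))))"
  let ?c = "If (ILess (INum 0) (ix bDep rV)) (Seq (SetIReg rU (ix bPar rV)) (relax rV rU)) Skip"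
  show ?thesis unfolding relax_all_def
  proof (rule runs_then[OF 1 order_refl])
    fix s1 assume J1: "?J 1 s1" and f1: "frame relax_up s0 s1"
    have out1: "dfs_out r {} L s1" using dfs_out_frame[OF out f1] by simp
    have "runs relax_down M (?J2 (length L)) s1" unfolding relax_down_def
    proof (rule runs_each[OF out1 _ _ _ _ M, where J = ?J2])
      fix k s assume k: "k < length L" and J: "?J2 k s" and v: "ireg s rV = L ! k" and f: "frame (each ?c) s1 s"
      have dep: "imem s bDep (L ! k) = d r (L ! k)"
        using out1 nth_mem[OF k] by (simp add: dfs_out_def frameD[OF f])
      show "?J2 (Suc k) (sx ?c s)"
      proof (cases "k = 0")
        case True
        then have "L ! k = r" using dfs_out_0[OF out r rX] by simp
        then have "sx ?c s = s" using dep v r by simp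
        then show ?thesis using J True by auto
      next
        case False
        then have k1: "1 \<le> k" by simp
        note pk = par[OF k1 k]
        have ne: "L ! k \<noteq> r" using dfs_out_parent(1)[OF out r rX k1 k] .
        have d0: "d r (L ! k) \<noteq> 0" using d_0[of r "L ! k"] ne r pk(3) by auto
        have pp: "imem s bPar (L ! k) = ?par k"
          using dfs_out_parent(2)[OF out1 r rX k1 k] by (simp add: frameD[OF f])
        let ?k' = "(key s)(L ! k := if kle (key s (L ! k)) (bump (key s (?par k))) then key s (L ! k) else bump (key s (?par k)))"
        let ?s = "s\<lparr>ireg := (ireg s)(rU := ?par k)\<rparr>"
        have "sx ?c s = sx (relax rV rU) ?s" using dep d0 pp v by simp
        moreover have "key (sx (relax rV rU) ?s) = ?k'" using key_relax[of ?s rV "L ! k" rU "?par k"] v pk(6) by simp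
        ultimately have e: "key (sx ?c s) = ?k'" by simp
        have g': "good_keys ?k'" by (rule good_keys_relax) (use J pk in auto)
        have dec: "kle (?k' w) (key s w)" for w using kle_total by auto
        have other: "?k' w = key s w" if "w \<noteq> L ! k" for w using that by simp
        have a: "kle (?k' (?par i)) (bump (?k' (L ! i)))" if i: "1 \<le> i" "i < length L" for i
        proof (cases "i = k")
          case True
          have "kle (key s (?par k)) (bump (key s (L ! k)))" using J i True by blast
          moreover have "kle (key s (?par k)) (bump (bump (key s (?par k))))" using kle_bump(2) kle_trans by blast
          ultimately show ?thesis using True pk(6) by auto
        next
          case False
          have "kle (key s (?par i)) (bump (key s (L ! i)))" using J i by blast
          then have "kle (?k' (?par i)) (bump (key s (L ! i)))" using dec kle_trans by blast
          then show ?thesis using other[OF Lne[OF i(2) k False]] by simp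
        qed
        have b: "kle (?k' (L ! i)) (bump (?k' (?par i)))" if i: "1 \<le> i" "i < Suc k" for i
        proof (cases "i = k")
          case True
          then show ?thesis using pk(6) kle_total by auto
        next
          case False
          then have ik: "i < k" using i by simp
          obtain j where j: "j < i" "?par i = L ! j" using par(1)[OF i(1)] ik k by auto
          have "?par i \<noteq> L ! k" using Lne[of j k] j ik k by auto
          moreover have "L ! i \<noteq> L ! k" using Lne[of i k] ik k by auto
          moreover have "kle (key s (L ! i)) (bump (key s (?par i)))" using J i ik by blast
          ultimately show ?thesis using other by simp
        qed
        show ?thesis unfolding e using g' a b by blast
      qed
    qed (use J1 in auto)
    then show "runs relax_down M labels s1"
    proof (rule runs_mono)
      fix s2 assume J: "?J2 (length L) s2"
      have "kle (key s2 u) (bump (key s2 v))" if uv: "u < n" "v < n" "d u v = 1" for u v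
      proof -
        have idx: "\<exists>i. 1 \<le> i \<and> i < length L \<and> w = L ! i" if w: "w < n" "w \<noteq> r" for w
        proof -
          have "w \<in> set L" using L w by simp
          then obtain i where i: "i < length L" "w = L ! i" unfolding in_set_conv_nth by blast
          then have "1 \<le> i" using dfs_out_0(2)[OF out r rX] w(2) by (cases i) auto
          then show ?thesis using i by blast
        qed
        consider "u \<noteq> r" "nx u r = v" | "v \<noteq> r" "nx v r = u" using adjacent_cases[OF uv r] by blast
        then show ?thesis
        proof cases
          case 1
          then show ?thesis using idx[OF uv(1)] J by blast
        next
          case 2
          then show ?thesis using idx[OF uv(2)] J by blast
        qed
      qed
      then have "fst (key s2 v) = D v" "snd (key s2 v) = te v" if "v < n" for v
        using labels_from_keys[of "key s2" v] J that by blast+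
      then show "labels s2" by (simp add: labels_def key_def)
    qed simp
  qed
qed

definition fresh :: "ram_state \<Rightarrow> bool" where
  "fresh s \<longleftrightarrow> input s \<and> (\<forall>b i. b \<notin> {bOff, bAdj, bS} \<longrightarrow> imem s b i = 0) \<and> (\<forall>b i. b \<noteq> 0 \<longrightarrow> rmem s b i = 0)"

lemma comp_empty: "r < n \<Longrightarrow> comp {} r = {..<n}"
  by (auto simp: comp_def)

lemma p_le_n: "p \<le> n"
  using card_mono[OF _ S_V] distinct_card[OF S_distinct] by simp

lemma runs_prepare:
  assumes fr: "fresh s" and M: "vol {..<n} + 1 \<le> M"
  shows "runs prepare M (item_inv {} [0]) s"
proof -
  have n: "0 < n" using S_in_V[of 0] S_ne by auto
  have v3: "3 * n \<le> vol {..<n}" using vol_ge_card[of "{..<n}"] by simp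
  have Mn: "n + 2 \<le> M" "p + 2 \<le> M" "n + 1 \<le> M" "1 \<le> M" using v3 n M p_le_n by linarith+
  have inp: "input s" using fr by (simp add: fresh_def)
  let ?c7 = "Seq (SetIMem bWl (INum 0) (INum 0)) (SetIReg rWp (INum 1))"
  let ?c5 = "Seq relax_all ?c7"
  let ?c4 = "Seq dfs ?c5"
  let ?c3 = "Seq (SetIReg rRoot (INum 0)) ?c4"
  have h: "runs halves M half_table s" by (rule runs_halves[OF inp]) (use fr Mn in \<open>simp_all add: fresh_def\<close>)
  show ?thesis unfolding prepare_def block.simps
  proof (rule runs_then[OF h order_refl])
    fix s1 assume half1: "half_table s1" and f1: "frame halves s s1"
    have inp1: "input s1" using input_frame[OF inp f1] by simp
    show "runs (Seq blank_labels (Seq site_labels ?c3)) M (item_inv {} [0]) s1"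
    proof (rule runs_then[OF runs_blank_labels[OF inp1 Mn(1)] order_refl])
      fix s2 assume b2: "\<forall>v<n. key s2 v = (n, p)" and f2: "frame blank_labels s1 s2"
      have inp2: "input s2" using input_frame[OF inp1 f2] by simp
      show "runs (Seq site_labels ?c3) M (item_inv {} [0]) s2"
      proof (rule runs_then[OF runs_site_labels[OF inp2 Mn(2) b2] order_refl])
        fix s3 assume g3: "good_keys (key s3)" and f3: "frame site_labels s2 s3"
        let ?s4 = "s3\<lparr>ireg := (ireg s3)(rRoot := 0)\<rparr>"
        have inp4: "input ?s4" using input_frame[OF inp2 f3] by (simp add: input_def)
        have half4: "half_table ?s4" using half_table_frame[OF half_table_frame[OF half1 f2] f3] by (simp add: half_table_def)
        have z: "imem s3 bRem = imem s bRem" "imem s3 bDone = imem s bDone" "rmem s3 mGain = rmem s mGain" "rmem s3 mRest = rmem s mRest"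
          by (simp_all add: frameD[OF f1] frameD[OF f2] frameD[OF f3])
        have rem4: "removed {} ?s4" using fr z by (simp add: removed_def fresh_def)
        have d: "runs dfs (vol {..<n}) (\<lambda>s'. \<exists>L. dfs_out 0 {} L s') ?s4"
          using runs_dfs[OF inp4 half4 rem4 n] comp_empty[OF n] by simp
        have r4: "runs ?c4 M (item_inv {} [0]) ?s4"
        proof (rule runs_then[OF d])
          show "vol {..<n} \<le> M" using M by simp
          fix s5 assume "\<exists>L. dfs_out 0 {} L s5" and f5: "frame dfs ?s4 s5"
          then obtain L where out5: "dfs_out 0 {} L s5" by blast
          have "length L = n" using dfs_out_length[OF out5] comp_empty[OF n] by simp
          then have LM: "length L + 2 \<le> M" using Mn by simp
          have g5: "good_keys (key s5)" using g3 by (simp add: good_keys_def key_def frameD[OF f5])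
          show "runs ?c5 M (item_inv {} [0]) s5"
            proof (rule runs_then[OF runs_relax[OF out5 n LM g5] order_refl])
              fix s6 assume lab6: "labels s6" and f6: "frame relax_all s5 s6"
              let ?s7 = "s6\<lparr>imem := (imem s6)(bWl := (imem s6 bWl)(0 := 0)), ireg := (ireg s6)(rWp := 1)\<rparr>"
              have "input s6" "half_table s6" "removed {} s6"
                using input_frame[OF input_frame[OF inp4 f5] f6] half_table_frame[OF half_table_frame[OF half4 f5] f6]
                  removed_frame[OF removed_frame[OF rem4 f5] f6] by simp_all
              then have "input ?s7" "half_table ?s7" "removed {} ?s7" "labels ?s7"
                using lab6 by (simp_all add: input_def half_table_def removed_def labels_def)
              moreover have "done_table {} ?s7"
                using fr z by (simp add: done_table_def undone_def fresh_def frameD[OF f5] frameD[OF f6])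
              moreover have "totals {} ?s7"
                using fr z partial_empty by (simp add: totals_def fresh_def frameD[OF f5] frameD[OF f6])
              moreover have "worklist [0] ?s7" by (simp add: worklist_def)
              moreover have "roots_ok {} [0]"
                using n S_in_V comp_empty[OF n] by (auto simp: roots_ok_def undone_def)
              ultimately have "item_inv {} [0] ?s7" by (simp add: item_inv_def)
              then show "runs ?c7 M (item_inv {} [0]) s6" by (intro runs_sx) (use Mn in simp_all)
          qed
        qed
        show "runs ?c3 M (item_inv {} [0]) s3"
          by (rule runs_sx_then[OF _ Mn(4)]) (use r4 in \<open>simp_all only: sx.simps ival.simps loopfree.simps\<close>)
      qed
    qed
  qed
qed

text \<open>\<open>rK\<close> records whether a candidate has been seen; until then real register 0
  holds no objective value to compare with. Sites are recognised by distance 0.\<close>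

lemma runs_choose_best:
  assumes inp: "input s" and lab: "labels s" and M: "n + 2 \<le> M"
  shows "runs choose_best M (\<lambda>s'. (\<exists>v<n. v \<notin> set S) \<longrightarrow> ireg s' rX < n \<and> ireg s' rX \<notin> set S \<and>
    (\<forall>u<n. u \<notin> set S \<longrightarrow> max (rmem s mGain (ireg s' rX)) (rmem s mRest (ireg s' rX)) \<le> max (rmem s mGain u) (rmem s mRest u))) s"
proof -
  let ?val = "\<lambda>u. max (rmem s mGain u) (rmem s mRest u)"
  let ?J = "\<lambda>k (t :: ram_state). ireg t rK = 0 \<and> (\<forall>v<k. v \<in> set S) \<or>
    ireg t rK = 1 \<and> ireg t rX < k \<and> ireg t rX \<notin> set S \<and> rreg t 0 = ?val (ireg t rX) \<and>
      (\<forall>v<k. v \<notin> set S \<longrightarrow> rreg t 0 \<le> ?val v)"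
  let ?c = "If (ILess (INum 0) (ix bD rI))
       (Seq (If (RLess (RMem mGain (IReg rI)) (RMem mRest (IReg rI))) (SetRReg 1 (RMem mRest (IReg rI))) (SetRReg 1 (RMem mGain (IReg rI))))
         (If (Or (IEq (IReg rK) (INum 0)) (RLess (RReg 1) (RReg 0)))
           (block [SetRReg 0 (RReg 1), SetIReg rX (IReg rI), SetIReg rK (INum 1)]) Skip))
       Skip"
  let ?s = "s\<lparr>ireg := (ireg s)(rK := 0)\<rparr>"
  have r: "runs (for_up rI (INum 0) (IReg rN) ?c) M (?J n) ?s"
  proof (rule runs_for_up[where I = ?J and m = n and ?k0.0 = 0])
    fix k and t :: ram_state assume k: "k < n" "ireg t rI = k" and J: "?J k t"
      and f: "frame (for_up rI (INum 0) (IReg rN) ?c) ?s t"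
    have D: "0 < imem t bD k \<longleftrightarrow> k \<notin> set S"
      using lab k D_0_iff[of k] by (auto simp: labels_def frameD[OF f])
    have m: "rmem t mGain = rmem s mGain" "rmem t mRest = rmem s mRest" by (simp_all add: frameD[OF f])
    show "?J (Suc k) ((sx ?c t)\<lparr>ireg := (ireg (sx ?c t))(rI := Suc k)\<rparr>)"
    proof (cases "k \<in> set S")
      case True
      then show ?thesis using J D k by (auto simp: less_Suc_eq)
    next
      case False
      let ?t = "t\<lparr>rreg := (rreg t)(1 := ?val k)\<rparr>"
      have "sx (If (RLess (RMem mGain (IReg rI)) (RMem mRest (IReg rI))) (SetRReg 1 (RMem mRest (IReg rI))) (SetRReg 1 (RMem mGain (IReg rI)))) t = ?t"
        using k m by (simp add: max_def)
      then have e: "sx ?c t = (if ireg t rK = 0 \<or> ?val k < rreg t 0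
          then ?t\<lparr>rreg := (rreg ?t)(0 := ?val k), ireg := (ireg t)(rX := k, rK := 1)\<rparr> else ?t)"
        using D False k by simp
      show ?thesis
      proof (cases "ireg t rK = 0 \<or> ?val k < rreg t 0")
        case True
        then have "\<forall>v<k. v \<notin> set S \<longrightarrow> ?val k \<le> ?val v" using J by force
        then show ?thesis unfolding e using True False by (auto simp: less_Suc_eq)
      next
        case no: False
        then show ?thesis unfolding e using J False by (auto simp: less_Suc_eq)
      qed
    qed
  qed (use inp M in \<open>auto simp: input_def frame_def\<close>)
  have "runs (for_up rI (INum 0) (IReg rN) ?c) M (\<lambda>s'. (\<exists>v<n. v \<notin> set S) \<longrightarrow> ireg s' rX < n \<and> ireg s' rX \<notin> set S \<and>
    (\<forall>u<n. u \<notin> set S \<longrightarrow> ?val (ireg s' rX) \<le> ?val u)) ?s"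
    by (rule runs_mono[OF r order_refl]) auto
  then show ?thesis unfolding choose_best_def
    by (intro runs_sx_then[where c = "SetIReg rK (INum 0)"]) (use M in simp_all)
qed

definition objective :: "nat \<Rightarrow> real" where
  "objective v = max (\<Sum>u | u < n \<and> d u v < D u. \<pi> u) (Max ((\<lambda>j. rest j v) ` {..<p}))"

text \<open>The initial component has at most \<open>p\<close> unmet sites, so the potential is at
  most \<open>vol * (lev p + 1)\<close>; the additional \<open>vol\<close> absorbs additive
  constants. The successive parts share one factor, so their bounds need not be added up.\<close>

lemma runs_program:
  assumes fr: "fresh s"
  shows "runs balanced_vertex_program (vol {..<n} * (lev p + 2)) (\<lambda>s'. (\<exists>v<n. v \<notin> set S) \<longrightarrow>
    result s' < n \<and> result s' \<notin> set S \<and> (\<forall>u<n. u \<notin> set S \<longrightarrow> objective (result s') \<le> objective u)) s"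
    (is "runs _ ?M ?Post s")
proof -
  have n: "0 < n" using S_in_V[of 0] S_ne by auto
  have v3: "3 * n \<le> vol {..<n}" using vol_ge_card[of "{..<n}"] by simp
  have M2: "vol {..<n} * 2 \<le> ?M" by (intro mult_le_mono2) simp
  have M: "vol {..<n} + 1 \<le> ?M" "n + 2 \<le> ?M" "1 \<le> ?M" using v3 n M2 by linarith+
  have "card (sites {} 0) \<le> card (set S)"
    by (rule card_mono) (use D_0_iff comp_sub in \<open>auto simp: sites_def\<close>)
  then have "lev (card (sites {} 0)) \<le> lev p" using lev_mono distinct_card[OF S_distinct] by simp
  then have "pot {} [0] \<le> vol {..<n} * (lev p + 1)"
    unfolding pot_def using comp_empty[OF n] by (simp add: mult_le_mono2 del: mult_Suc_right)
  moreover have "vol {..<n} * (lev p + 1) + vol {..<n} = ?M" by (simp add: algebra_simps)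
  ultimately have pM: "pot {} [0] + 1 \<le> ?M" using v3 n by linarith
  show ?thesis unfolding balanced_vertex_program_def block.simps
  proof (rule runs_then[OF runs_prepare[OF fr M(1)] order_refl])
    fix s1 assume i1: "item_inv {} [0] s1"
    show "runs (Seq main_loop (Seq choose_best (SetIReg 0 (IReg rX)))) ?M ?Post s1"
    proof (rule runs_then[OF runs_main_loop[OF i1] pM])
      fix s2 assume "\<exists>X'. item_inv X' [] s2"
      then obtain X where i2: "item_inv X [] s2" by blast
      have inp2: "input s2" and lab2: "labels s2" using i2 by (auto simp: item_inv_def)
      have val: "max (rmem s2 mGain v) (rmem s2 mRest v) = objective v" if "v < n" "v \<notin> set S" for v
        using item_inv_final[OF i2 that] by (simp add: objective_def)
      show "runs (Seq choose_best (SetIReg 0 (IReg rX))) ?M ?Post s2"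
      proof (rule runs_then[OF runs_choose_best[OF inp2 lab2 M(2)] order_refl])
        fix s3 :: ram_state assume h: "(\<exists>v<n. v \<notin> set S) \<longrightarrow> ireg s3 rX < n \<and> ireg s3 rX \<notin> set S \<and>
          (\<forall>u<n. u \<notin> set S \<longrightarrow> max (rmem s2 mGain (ireg s3 rX)) (rmem s2 mRest (ireg s3 rX)) \<le> max (rmem s2 mGain u) (rmem s2 mRest u))"
        have r: "result (sx (SetIReg 0 (IReg rX)) s3) = ireg s3 rX" by (simp add: result_def)
        have "?Post (sx (SetIReg 0 (IReg rX)) s3)" unfolding r
        proof
          assume "\<exists>v<n. v \<notin> set S"
          then have x: "ireg s3 rX < n" "ireg s3 rX \<notin> set S" and
            opt: "\<And>u. u < n \<Longrightarrow> u \<notin> set S \<Longrightarrow> max (rmem s2 mGain (ireg s3 rX)) (rmem s2 mRest (ireg s3 rX)) \<le> max (rmem s2 mGain u) (rmem s2 mRest u)"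
            using h by blast+
          have "objective (ireg s3 rX) \<le> objective u" if "u < n" "u \<notin> set S" for u
            using opt[OF that] by (simp only: val[OF that] val[OF x])
          then show "ireg s3 rX < n \<and> ireg s3 rX \<notin> set S \<and> (\<forall>u<n. u \<notin> set S \<longrightarrow> objective (ireg s3 rX) \<le> objective u)"
            using x by blast
        qed
        then show "runs (SetIReg 0 (IReg rX)) ?M ?Post s3" by (intro runs_sx[OF _ M(3)]) auto
      qed
    qed
  qed
qed

text \<open>With root 0 every arc leads to or from a parent, so there are at most
  \<open>2 * n\<close> arcs; the remaining \<open>3 * n\<close> is the constant part of
  \<open>vol\<close>.\<close>

lemma vol_le: "vol {..<n} \<le> 5 * n"
proof -
  let ?E = "SIGMA v:{..<n}. set (adj ! v)"
  have "(\<Sum>v<n. length (adj ! v)) = card ?E"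
    by (subst card_SigmaI) (auto simp: distinct_card[OF adj_distinct])
  also have "?E \<subseteq> (\<lambda>v. (v, nx v 0)) ` {..<n} \<union> (\<lambda>v. (nx v 0, v)) ` {..<n}"
  proof
    fix e assume "e \<in> ?E"
    then obtain v w where e: "e = (v, w)" "v < n" "w < n" "d v w = 1" using set_adj by blast
    then show "e \<in> (\<lambda>v. (v, nx v 0)) ` {..<n} \<union> (\<lambda>v. (nx v 0, v)) ` {..<n}"
      using adjacent_cases[of v w 0] by auto
  qed
  then have "card ?E \<le> card ((\<lambda>v. (v, nx v 0)) ` {..<n} \<union> (\<lambda>v. (nx v 0, v)) ` {..<n})"
    by (intro card_mono) auto
  also have "\<dots> \<le> card ((\<lambda>v. (v, nx v 0)) ` {..<n}) + card ((\<lambda>v. (nx v 0, v)) ` {..<n})"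
    by (rule card_Un_le)
  also have "\<dots> \<le> n + n" by (intro add_mono) (use card_image_le[of "{..<n}"] in force)+
  finally show ?thesis by (simp add: vol_def sum.distrib)
qed

end

section \<open>The running time and the result\<close>

lemma undirected_tree_metric:
  fixes G :: "'a pair_pre_digraph"
  assumes "undirected_tree G"
  shows "pair_graph G" "tree_metric (pverts G) (pair_graph.hops G)"
    "\<And>u v. u \<in> pverts G \<Longrightarrow> v \<in> pverts G \<Longrightarrow> pair_graph.hops G u v = 1 \<longleftrightarrow> (u, v) \<in> parcs G"
    "\<And>u v. u \<in> pverts G \<Longrightarrow> v \<in> pverts G \<Longrightarrow> gdist G u v = ereal (real (pair_graph.hops G u v))"
proof -
  show pg: "pair_graph G" using assms by (simp add: undirected_tree_def)
  interpret pair_graph G by (rule pg)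
  have "strongly_connected (with_proj G)"
    using assms symmetric_connected_imp_strongly_connected[OF sym_arcs]
    by (simp add: undirected_tree_def)
  then have conn: "\<exists>p. awalk u p v" if "u \<in> pverts G" "v \<in> pverts G" for u v
    using that by (auto simp: strongly_connected_def reachable_awalk)
  have acyc: "\<not> (\<exists>p. cycle p \<and> length p \<ge> 3)" using assms by (simp add: undirected_tree_def)
  show "tree_metric (pverts G) hops"
  proof
    show "finite (pverts G)" by (rule pair_finite_verts)
    fix u v assume uv: "u \<in> pverts G" "v \<in> pverts G"
    show "hops u v = 0 \<longleftrightarrow> u = v" by (rule hops_0[OF conn uv])
    show "hops u v = hops v u" by (rule hops_sym[OF conn uv])
    show "\<exists>w\<in>pverts G. hops u w = 1 \<and> hops u v = Suc (hops w v)" if "u \<noteq> v"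
      by (rule hops_step[OF conn uv that])
    fix w assume w: "w \<in> pverts G"
    show "hops u w \<le> hops u v + hops v w" by (rule hops_triangle[OF conn uv w])
    show "hops w' v = Suc (hops u v)"
      if "w' \<in> pverts G" "hops u w = 1" "hops u w' = 1" "w \<noteq> w'" "hops w v \<le> hops u v" for w'
      by (rule hops_unique[OF conn acyc uv(1) uv(2) w that])
  qed
  show "hops u v = 1 \<longleftrightarrow> (u, v) \<in> parcs G" if "u \<in> pverts G" "v \<in> pverts G" for u v
    by (rule hops_1[OF conn that])
  show "gdist G u v = ereal (real (hops u v))" if "u \<in> pverts G" "v \<in> pverts G" for u v
    unfolding gdist_def by (rule mu_hops[OF conn that])
qed

section \<open>The objective as the maximal load after adding a vertex\<close>

context ram_instance
begin

lemma list_dist_snoc: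
  assumes g: "\<And>u v. u < n \<Longrightarrow> v < n \<Longrightarrow> gdist G u v = ereal (real (d u v))" and u: "u < n" and v: "v < n"
  shows "list_dist G u (S @ [v]) = ereal (real (min (D u) (d u v)))"
  unfolding list_dist_def
proof (rule Min_eqI)
  show "finite (gdist G u ` set (S @ [v]))" by simp
  show "ereal (real (min (D u) (d u v))) \<le> y" if y: "y \<in> gdist G u ` set (S @ [v])" for y
  proof -
    obtain w where w: "w \<in> set (S @ [v])" "y = gdist G u w" using y by blast
    have "min (D u) (d u v) \<le> d u w \<and> w < n"
    proof (cases "w \<in> set S")
      case True
      then obtain i where "i < p" "w = S ! i" unfolding in_set_conv_nth by blast
      then show ?thesis using D_le[of i u] S_in_V[of i] by auto
    qed (use w v in auto)
    then show ?thesis using g[OF u] w by simp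
  qed
  have "S ! te u \<in> set S" using te_lt nth_mem by blast
  moreover have "gdist G u (S ! te u) = ereal (real (D u))" using g[OF u] S_in_V[OF te_lt[of u]] by (simp add: D_def)
  moreover have "gdist G u v = ereal (real (d u v))" using g u v by simp
  ultimately show "ereal (real (min (D u) (d u v))) \<in> gdist G u ` set (S @ [v])"
    by (cases "D u \<le> d u v") (force simp: min_def)+
qed

text \<open>The new vertex has lowest priority: an old site keeps its vertices with
  \<open>D u \<le> d u v\<close>, and the new one gets exactly those with strict inequality. Ties
  among old sites are decided as before, by \<open>te\<close>.\<close>

lemma max_load_snoc:
  assumes G: "pverts G = {..<n}"
    and g: "\<And>u v. u < n \<Longrightarrow> v < n \<Longrightarrow> gdist G u v = ereal (real (d u v))" and v: "v < n"
  shows "max_load G \<pi> (S @ [v]) = objective v"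
proof -
  have gi: "gdist G u ((S @ [v]) ! i) = ereal (real (d u (S ! i)))" if "u < n" "i < p" for u i
    using g[OF that(1)] S_in_V[OF that(2)] that by (simp add: nth_append)
  have gv: "gdist G u ((S @ [v]) ! p) = ereal (real (d u v))" if "u < n" for u
    using g[OF that v] by simp
  note ld = list_dist_snoc[OF g _ v]
  have T: "territory G (S @ [v]) i = {u. u \<in> {..<n} \<and> te u = i \<and> D u \<le> d u v}" if i: "i < p" for i
  proof -
    have "(gdist G u ((S @ [v]) ! i) = list_dist G u (S @ [v]) \<and> (\<forall>j<i. gdist G u ((S @ [v]) ! j) > list_dist G u (S @ [v])))
      \<longleftrightarrow> te u = i \<and> D u \<le> d u v" if u: "u < n" for u
    proof -
      have "(gdist G u ((S @ [v]) ! i) = list_dist G u (S @ [v]) \<and> (\<forall>j<i. gdist G u ((S @ [v]) ! j) > list_dist G u (S @ [v])))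
        \<longleftrightarrow> d u (S ! i) = min (D u) (d u v) \<and> (\<forall>j<i. min (D u) (d u v) < d u (S ! j))"
        using i u gi ld by auto
      also have "\<dots> \<longleftrightarrow> te u = i \<and> D u \<le> d u v"
      proof
        assume *: "d u (S ! i) = min (D u) (d u v) \<and> (\<forall>j<i. min (D u) (d u v) < d u (S ! j))"
        then have e: "d u (S ! i) = D u" "D u \<le> d u v" using D_le[OF i, of u] by auto
        have "te u = i"
          by (rule te_eqI) (use i e * D_le in \<open>auto simp: min_def\<close>)
        then show "te u = i \<and> D u \<le> d u v" using e by simp
      next
        assume *: "te u = i \<and> D u \<le> d u v"
        then show "d u (S ! i) = min (D u) (d u v) \<and> (\<forall>j<i. min (D u) (d u v) < d u (S ! j))"
          using te_first[of _ u] by (auto simp: D_def min_def)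
      qed
      finally show ?thesis .
    qed
    then show ?thesis unfolding territory_def G by blast
  qed
  have Tp: "territory G (S @ [v]) p = {u. u < n \<and> d u v < D u}"
  proof -
    have "(gdist G u ((S @ [v]) ! p) = list_dist G u (S @ [v]) \<and> (\<forall>j<p. gdist G u ((S @ [v]) ! j) > list_dist G u (S @ [v])))
      \<longleftrightarrow> d u v < D u" if u: "u < n" for u
    proof -
      have "(gdist G u ((S @ [v]) ! p) = list_dist G u (S @ [v]) \<and> (\<forall>j<p. gdist G u ((S @ [v]) ! j) > list_dist G u (S @ [v])))
        \<longleftrightarrow> d u v = min (D u) (d u v) \<and> (\<forall>j<p. min (D u) (d u v) < d u (S ! j))"
        using u gi gv ld by auto
      also have "\<dots> \<longleftrightarrow> d u v < D u"
      proof
        assume "d u v = min (D u) (d u v) \<and> (\<forall>j<p. min (D u) (d u v) < d u (S ! j))"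
        then show "d u v < D u" using te_lt[of u] unfolding D_def by auto
      next
        assume "d u v < D u"
        then show "d u v = min (D u) (d u v) \<and> (\<forall>j<p. min (D u) (d u v) < d u (S ! j))"
          using D_le[of _ u] by (auto simp: min_def intro: less_le_trans)
      qed
      finally show ?thesis .
    qed
    then show ?thesis unfolding territory_def G by blast
  qed
  have "{..<length (S @ [v])} = insert p {..<p}" by auto
  then have "max_load G \<pi> (S @ [v]) = Max (insert (load G \<pi> (S @ [v]) p) (load G \<pi> (S @ [v]) ` {..<p}))"
    unfolding max_load_def by simp
  also have "load G \<pi> (S @ [v]) ` {..<p} = (\<lambda>j. rest j v) ` {..<p}"
    by (rule image_cong) (use T in \<open>auto simp: load_def rest_def\<close>)
  also have "load G \<pi> (S @ [v]) p = (\<Sum>u | u < n \<and> d u v < D u. \<pi> u)"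
    unfolding load_def Tp ..
  also have "Max (insert (\<Sum>u | u < n \<and> d u v < D u. \<pi> u) ((\<lambda>j. rest j v) ` {..<p})) = objective v"
    unfolding objective_def using S_ne by (subst Max_insert) auto
  finally show ?thesis .
qed

lemma fresh_input_state: "fresh (input_state adj \<pi> S)"
  by (simp add: fresh_def input_def input_state_def length_adj)

text \<open>With logarithms to base 2, \<open>pow_lev\<close> gives
  \<open>lev p + 2 \<le> 3 + log p\<close>, and this is at most \<open>4 * log (p + 1)\<close>
  because \<open>log (p + 1)\<close> is at least 1.\<close>

lemma lev_ln: "real (lev p + 2) \<le> 4 / ln 2 * ln (real p + 1)"
proof -
  have p: "1 \<le> p" using S_ne by (cases S) auto
  have "2 ^ lev p \<le> 2 * p" using pow_lev[of p] p by linarith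
  then have "real (2 ^ lev p) \<le> real (2 * p)" by (rule of_nat_mono)
  then have "ln ((2::real) ^ lev p) \<le> ln (2 * real p)" using p by (subst ln_le_cancel_iff) auto
  then have "lev p * ln 2 \<le> ln 2 + ln (real p)" using p S_ne by (simp add: ln_realpow ln_mult)
  moreover have "real (lev p + 2) * ln 2 = lev p * ln 2 + 2 * ln 2" by (simp add: algebra_simps)
  moreover have "ln 2 \<le> ln (real p + 1)" "ln (real p) \<le> ln (real p + 1)"
    using p by (simp, subst ln_le_cancel_iff, auto)
  ultimately have "real (lev p + 2) * ln 2 \<le> 4 * ln (real p + 1)" by linarith
  then show ?thesis by (simp add: field_simps)
qed

end

theorem mainTheorem8:
  shows "\<exists>(prog :: com) (C :: real).
    \<forall>(G :: nat pair_pre_digraph) (adj :: nat list list) (\<pi> :: nat \<Rightarrow> real) (S :: nat list).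
      undirected_tree G \<longrightarrow> adjacency_lists G adj \<longrightarrow>
      (\<forall>v\<in>pverts G. \<pi> v \<ge> 0) \<longrightarrow> proper_vertex_list G S \<longrightarrow>
      (\<exists>t s. exec prog (input_state adj \<pi> S) t s \<and>
             real t \<le> C * (real (card (pverts G)) * ln (real (length S) + 1)) \<and>
             (pverts G - set S \<noteq> {} \<longrightarrow> balanced_vertex G \<pi> S (result s)))"
proof (rule exI[of _ balanced_vertex_program], rule exI[of _ "real (cst balanced_vertex_program) * 20 / ln 2"],
    intro allI impI)
  fix G :: "nat pair_pre_digraph" and adj :: "nat list list" and \<pi> :: "nat \<Rightarrow> real" and S :: "nat list"
  assume tree: "undirected_tree G" and adj: "adjacency_lists G adj" and \<pi>: "\<forall>v\<in>pverts G. \<pi> v \<ge> 0"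
    and S: "proper_vertex_list G S"
  let ?c = "real (cst balanced_vertex_program)"
  define n where "n = length adj"
  define d where "d = pair_graph.hops G"
  have G: "pverts G = {..<n}" using adj by (simp add: adjacency_lists_def n_def)
  note tm = undirected_tree_metric[OF tree, folded d_def, unfolded G]
  have g: "gdist G u v = ereal (real (d u v))" if "u < n" "v < n" for u v using tm(4) that by simp
  interpret tree_metric "{..<n}" d by (rule tm(2))
  interpret ram_instance n d S \<pi> adj
  proof
    show "S \<noteq> []" "distinct S" "set S \<subseteq> {..<n}" using S G by (auto simp: proper_vertex_list_def)
    show "0 \<le> \<pi> v" if "v \<in> {..<n}" for v using \<pi> G that by simp
    show "length adj = n" by (simp add: n_def)
    show "distinct (adj ! v)" if "v < n" for v using adj that by (simp add: adjacency_lists_def n_def)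
    show "set (adj ! v) = {w. w < n \<and> d v w = 1}" if "v < n" for v
    proof -
      interpret pair_graph G by (rule tm(1))
      have "w < n" if "(v, w) \<in> parcs G" for w using arc_snd_in_verts[OF that] G by simp
      then show ?thesis using adj that tm(3) by (auto simp: adjacency_lists_def n_def)
    qed
  qed
  obtain t s where ex: "exec balanced_vertex_program (input_state adj \<pi> S) t s"
    and t: "t \<le> cst balanced_vertex_program * (vol {..<n} * (lev p + 2))"
    and opt: "(\<exists>v<n. v \<notin> set S) \<longrightarrow> result s < n \<and> result s \<notin> set S \<and>
      (\<forall>u<n. u \<notin> set S \<longrightarrow> objective (result s) \<le> objective u)"
    using runs_program[OF fresh_input_state] unfolding runs_def by blast
  have "real t \<le> ?c * (real (vol {..<n}) * real (lev p + 2))"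
    using of_nat_mono[OF t, where 'a = real] by (simp only: of_nat_mult)
  \<comment> \<open>The 5 is that of \<open>vol_le\<close> and \<open>4 / ln 2\<close> that of
    \<open>lev_ln\<close>; their product is the \<open>20 / ln 2\<close> in the constant.\<close>
  also have "\<dots> \<le> ?c * ((5 * real n) * (4 / ln 2 * ln (real p + 1)))"
  proof (intro mult_left_mono mult_mono)
    show "real (vol {..<n}) \<le> 5 * real n" using of_nat_mono[OF vol_le, where 'a = real] by simp
  qed (use lev_ln in auto)
  also have "\<dots> = (?c * 20 / ln 2) * (real (card (pverts G)) * ln (real p + 1))"
    by (simp add: G)
  finally have time: "real t \<le> (?c * 20 / ln 2) * (real (card (pverts G)) * ln (real p + 1))" .
  have "balanced_vertex G \<pi> S (result s)" if "pverts G - set S \<noteq> {}"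
  proof -
    have r: "result s < n" "result s \<notin> set S" "\<And>u. u < n \<Longrightarrow> u \<notin> set S \<Longrightarrow> objective (result s) \<le> objective u"
      using opt that G by auto
    show ?thesis unfolding balanced_vertex_def
    proof (intro conjI ballI)
      show "result s \<in> pverts G - set S" using r G by simp
      fix u assume "u \<in> pverts G - set S"
      then have "u < n" "u \<notin> set S" using G by auto
      then show "max_load G \<pi> (S @ [result s]) \<le> max_load G \<pi> (S @ [u])"
        using r(3)[of u] max_load_snoc[OF G g] r(1) by simp
    qed
  qed
  then show "\<exists>t s. exec balanced_vertex_program (input_state adj \<pi> S) t s \<and>
     real t \<le> (?c * 20 / ln 2) * (real (card (pverts G)) * ln (real (length S) + 1)) \<and>
     (pverts G - set S \<noteq> {} \<longrightarrow> balanced_vertex G \<pi> S (result s))"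
    using ex time by blast
qed

end
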